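(* Let $\mathbb{B}$ be the unit ball of $\mathbb{C}^n$, let $k\ge0$ be an integer and $1\le p\le\infty$. If $S\subset\mathbb{B}$ is a sequence of points which is dual bounded in $A^p_k(\mathbb{B})$, then for any $q$ with $1\le q<p$, $S$ is $A^q_k(\mathbb{B})$ interpolating with the linear extension property.
   Context: Take $r(z)=|z|^2-1$ as defining function of $\mathbb{B}$. $dm_0=dm$ is Lebesgue measure, $dm_k=(k+1)v_{k+1}(-r)^k\,dm$ for $k\ge1$ ($v_{k+1}$ the volume of the unit ball of $\mathbb{C}^{k+1}$). $A^p_k(\mathbb{B})$ is the space of holomorphic $f$ with $\|f\|_p^p=\int_{\mathbb{B}}|f|^p\,dm_k<\infty$ (for $p=\infty$: bounded holomorphic functions with the sup norm). $b_{k,a}$ denotes the reproducing (Bergman) kernel of $A^2_k(\mathbb{B})$ at $a$: $f(a)=\langle f,b_{k,a}\rangle=\int_{\mathbb{B}}f\,\overline{b_{k,a}}\,dm_k$; $\|b_{k,a}\|_p$ is its $A^p_k(\mathbb{B})$ norm, and $p'$ is the conjugate exponent of $p$. $S$ is dual bounded in $A^p_k(\mathbb{B})$ if there are $C>0$ and $\{\rho_a\}_{a\in S}\subset A^p_k(\mathbb{B})$ with $\|\rho_a\|_p\le C$ for all $a\in S$ and $\langle\rho_a,b_{k,c}\rangle=\rho_a(c)=\delta_{a,c}\|b_{k,a}\|_{p'}$ for all $a,c\in S$ ($\delta_{a,c}$ Kronecker delta). $S$ is $A^q_k(\mathbb{B})$ interpolating if for every $\lambda\in\ell^q(S)$ there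 is $f\in A^q_k(\mathbb{B})$ with $f(a)=\lambda_a\|b_{k,a}\|_{q'}$ for all $a\in S$. It has the linear extension property if moreover there is a bounded linear operator $E:\ell^q(S)\to A^q_k(\mathbb{B})$ with $E(\lambda)(a)=\lambda_a\|b_{k,a}\|_{q'}$ for all $a\in S$ and $\lambda\in\ell^q(S)$. *)

theory Defs
  imports "HOL-Analysis.Analysis"
begin

text \<open>Exponents range over \<open>[1, \<infinity>]\<close> and are values of type \<^typ>\<open>ennreal\<close>;
  for \<open>p \<ge> 1\<close> the conjugate exponent is \<open>1 / (1 - 1 / p)\<close>, where
  \<open>1 / 0 = \<infinity>\<close> and \<open>1 / \<infinity> = 0\<close>.\<close>

definition conj_exponent :: "ennreal \<Rightarrow> ennreal" where
  "conj_exponent p = inverse (1 - inverse p)"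

lemma conj_exponent_1: "conj_exponent 1 = \<infinity>"
  by (simp add: conj_exponent_def)

lemma conj_exponent_top: "conj_exponent \<infinity> = 1"
  by (simp add: conj_exponent_def)

lemma conj_exponent_sum:
  assumes "1 \<le> p"
  shows "inverse p + inverse (conj_exponent p) = 1"
proof -
  have "inverse p \<le> 1"
  proof (cases p)
    case (real r)
    with assms have "1 \<le> r"
      by simp
    then have "inverse p = ennreal (inverse r)" and "inverse r \<le> 1"
      using real by (simp_all add: inverse_ennreal inverse_le_1_iff)
    then show ?thesis
      by simp
  qed simp
  then show ?thesis
    unfolding conj_exponent_def
    using divide_ennreal_def one_divide_one_divide_ennreal by auto
qed

definition holomorphic_several :: "(complex ^ 'n \<Rightarrow> complex) \<Rightarrow> (complex ^ 'n) set \<Rightarrow> bool" where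
  "holomorphic_several f U \<longleftrightarrow>
     (\<forall>z\<in>U. \<exists>D. (f has_derivative D) (at z within U) \<and> (\<forall>c v. D (c *s v) = c * D v))"

text \<open>The measure \<open>dm\<^sub>k\<close> on the unit ball; \<open>unit_ball_vol (2 * (k + 1))\<close> is the volume of the
  unit ball of \<open>\<complex>\<^sup>k\<^sup>+\<^sup>1\<close>, whose real dimension is \<open>2 (k + 1)\<close>.  The case \<open>k = 0\<close> is separate
  because \<open>dm\<^sub>0\<close> carries no constant, whereas the general formula would give \<open>\<pi>\<close>.\<close>

definition ball_measure :: "nat \<Rightarrow> (complex ^ 'n) measure" where
  "ball_measure k = density (restrict_space lborel (ball 0 1))
     (\<lambda>z. ennreal (if k = 0 then 1
                   else real (k + 1) * unit_ball_vol (real (2 * (k + 1))) * (1 - (norm z)\<^sup>2) ^ k))"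

text \<open>A function on the ball is represented by its extension by \<open>0\<close>, so that equality in the
  Bergman space is equality of HOL functions.\<close>

definition bergman_space :: "nat \<Rightarrow> ennreal \<Rightarrow> (complex ^ 'n \<Rightarrow> complex) set" where
  "bergman_space k p = {f. holomorphic_several f (ball 0 1) \<and> (\<forall>z. z \<notin> ball 0 1 \<longrightarrow> f z = 0) \<and>
     (if p = \<infinity> then bounded (f ` ball 0 1)
      else integrable (ball_measure k) (\<lambda>z. norm (f z) powr enn2real p))}"

definition bergman_norm :: "nat \<Rightarrow> ennreal \<Rightarrow> (complex ^ 'n \<Rightarrow> complex) \<Rightarrow> real" where
  "bergman_norm k p f =
     (if p = \<infinity> then (SUP z\<in>ball 0 1. norm (f z))
      else (\<integral>z. norm (f z) powr enn2real p \<partial>ball_measure k) powr (1 / enn2real p))"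

definition bergman_kernel :: "nat \<Rightarrow> complex ^ 'n \<Rightarrow> complex ^ 'n \<Rightarrow> complex" where
  "bergman_kernel k a = (THE b. b \<in> bergman_space k 2 \<and>
     (\<forall>f\<in>bergman_space k 2. f a = (\<integral>z. f z * cnj (b z) \<partial>ball_measure k)))"

definition dual_bounded :: "nat \<Rightarrow> ennreal \<Rightarrow> (complex ^ 'n) set \<Rightarrow> bool" where
  "dual_bounded k p S \<longleftrightarrow>
     (\<exists>C>0. \<exists>\<rho>. \<forall>a\<in>S. \<rho> a \<in> bergman_space k p \<and> bergman_norm k p (\<rho> a) \<le> C \<and>
        (\<forall>c\<in>S. \<rho> a c =
           (if a = c then of_real (bergman_norm k (conj_exponent p) (bergman_kernel k a)) else 0)))"

text \<open>Likewise, families indexed by \<open>S\<close> are extended by \<open>0\<close>.\<close>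

definition lq_space :: "ennreal \<Rightarrow> 'a set \<Rightarrow> ('a \<Rightarrow> complex) set" where
  "lq_space q S = {l. (\<forall>a. a \<notin> S \<longrightarrow> l a = 0) \<and>
     (if q = \<infinity> then bounded (range l) else (\<lambda>a. norm (l a) powr enn2real q) summable_on S)}"

definition lq_norm :: "ennreal \<Rightarrow> 'a set \<Rightarrow> ('a \<Rightarrow> complex) \<Rightarrow> real" where
  "lq_norm q S l =
     (if q = \<infinity> then (SUP a. norm (l a))
      else (\<Sum>\<^sub>\<infinity>a\<in>S. norm (l a) powr enn2real q) powr (1 / enn2real q))"

definition interpolates :: "nat \<Rightarrow> ennreal \<Rightarrow> (complex ^ 'n) set \<Rightarrow> (complex ^ 'n \<Rightarrow> complex) \<Rightarrow>
    (complex ^ 'n \<Rightarrow> complex) \<Rightarrow> bool" where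
  "interpolates k q S l f \<longleftrightarrow>
     (\<forall>a\<in>S. f a = l a * of_real (bergman_norm k (conj_exponent q) (bergman_kernel k a)))"

definition interpolating :: "nat \<Rightarrow> ennreal \<Rightarrow> (complex ^ 'n) set \<Rightarrow> bool" where
  "interpolating k q S \<longleftrightarrow>
     (\<forall>l\<in>lq_space q S. \<exists>f\<in>bergman_space k q. interpolates k q S l f)"

definition bounded_linear_operator_lq_bergman ::
    "nat \<Rightarrow> ennreal \<Rightarrow> (complex ^ 'n) set \<Rightarrow> ((complex ^ 'n \<Rightarrow> complex) \<Rightarrow> complex ^ 'n \<Rightarrow> complex) \<Rightarrow> bool"
  where
  "bounded_linear_operator_lq_bergman k q S E \<longleftrightarrow>
     E ` lq_space q S \<subseteq> bergman_space k q \<and>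
     (\<forall>l\<in>lq_space q S. \<forall>m\<in>lq_space q S. E (\<lambda>a. l a + m a) = (\<lambda>z. E l z + E m z)) \<and>
     (\<forall>c. \<forall>l\<in>lq_space q S. E (\<lambda>a. c * l a) = (\<lambda>z. c * E l z)) \<and>
     (\<exists>K. \<forall>l\<in>lq_space q S. bergman_norm k q (E l) \<le> K * lq_norm q S l)"

definition linear_extension_property :: "nat \<Rightarrow> ennreal \<Rightarrow> (complex ^ 'n) set \<Rightarrow> bool" where
  "linear_extension_property k q S \<longleftrightarrow>
     (\<exists>E. bounded_linear_operator_lq_bergman k q S E \<and>
          (\<forall>l\<in>lq_space q S. interpolates k q S l (E l)))"

end

theory Submission
  imports Defs "HOL-Complex_Analysis.Complex_Analysis" "HOL-Real_Asymp.Real_Asymp"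
begin

text \<open>Let \<open>N = n + 1 + k\<close> and \<open>A a = 1 - \<bar>a\<bar>\<^sup>2\<close>.  The Bergman kernel at \<open>a\<close> is a multiple of
  \<open>(1 - \<langle>z, a\<rangle>)\<^sup>-\<^sup>N\<close>, and by the Forelli-Rudin estimates its norms are
  \<open>\<bar>\<bar>b\<^sub>a\<bar>\<bar>\<^sub>p\<^sub>' \<approx> A a powr (- N / p)\<close> for \<open>p < \<infinity>\<close>.  A dual system \<open>\<rho>\<^sub>a\<close> bounded in \<open>A\<^sup>p\<close> forces \<open>S\<close> to be separated,
  since functions in \<open>A\<^sup>p\<close> oscillate little on small pseudohyperbolic balls.  With \<open>1/q = 1/p + 1/r\<close>,
  the extension operator is
  \<open>E l = \<Sum>a\<in>S. l\<^sub>a c\<^sub>a \<rho>\<^sub>a \<kappa>\<^sub>a\<close> with \<open>\<kappa>\<^sub>a z = A a powr (M - N / r) / (1 - \<langle>z, a\<rangle>)\<^sup>M\<close>, bounded constants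
  \<open>c\<^sub>a\<close> and \<open>M\<close> large.  Its boundedness follows from Hoelder's inequality, first in the sum over \<open>S\<close> with
  the weights \<open>A a ^ (n + 1) / \<bar>1 - \<langle>z, a\<rangle>\<bar> powr (n + 1 + \<epsilon>)\<close>, whose sum is controlled by separation, and
  then in the integral with the exponents \<open>p / q\<close> and \<open>r / q\<close>.  For \<open>p = \<infinity>\<close> the functions
  \<open>\<rho>\<^sub>a \<kappa>\<^sub>a\<close> form a dual system for any finite exponent greater than \<open>q\<close>.\<close>

unbundle no fps_syntax

text \<open>Neither polar coordinates nor changes of variables by automorphisms of the ball are
  used. Under a rotation-invariant measure distinct powers of \<open>ip z w\<close> are orthogonal,
  so the integral of a power series in \<open>ip z w\<close> times one in \<open>ip w z\<close> is a
  series of moments. Gaussian and ball moments determine each other by homogeneity. Parseval then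
  yields the reproducing formula and, after a comparison of Pochhammer symbols, the Forelli-Rudin
  estimates.

  The power of \<open>A a\<close> in \<kappa>_a serves two demands at once. At \<open>a\<close> it
  gives \<kappa>_a(a) = A^(-N/r), so that \<rho>_a \<kappa>_a has the size A^(-N/p - N/r) = A^(-N/q)
  of the prescribed value; and it normalises \<kappa>_a to bounded r-norm. The Hoelder inequality in
  the sum costs a factor (1 - |z|^2)^(-\<epsilon>(q-1)). A small \<epsilon> keeps the weight
  integrable after the second Hoelder inequality, and a large M keeps the remaining kernel integral
  in the Forelli-Rudin range.\<close>

definition ip :: "complex ^ 'n \<Rightarrow> complex ^ 'n \<Rightarrow> complex" where
  "ip z w = (\<Sum>i\<in>UNIV. z $ i * cnj (w $ i))"

lemma ip_add_left: "ip (x + y) w = ip x w + ip y w"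
  by (simp add: ip_def distrib_right sum.distrib)

lemma ip_diff_left: "ip (x - y) w = ip x w - ip y w"
  by (simp add: ip_def left_diff_distrib sum_subtractf)

lemma ip_add_right: "ip w (x + y) = ip w x + ip w y"
  by (simp add: ip_def distrib_left sum.distrib)

lemma ip_diff_right: "ip w (x - y) = ip w x - ip w y"
  by (simp add: ip_def right_diff_distrib sum_subtractf)

lemma ip_smult_left: "ip (c *s x) w = c * ip x w"
  by (simp add: ip_def sum_distrib_left mult.assoc)

lemma ip_smult_right: "ip w (c *s x) = cnj c * ip w x"
  by (simp add: ip_def sum_distrib_left mult.assoc mult.left_commute)

lemma cnj_ip: "cnj (ip z w) = ip w z"
  by (simp add: ip_def mult.commute)

lemma Re_ip: "Re (ip z w) = inner z w"
  by (simp add: ip_def inner_vec_def inner_complex_def)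

lemma ip_self: "ip z z = of_real ((norm z)\<^sup>2)"
  by (intro complex_eqI)
     (simp_all add: Re_ip power2_norm_eq_inner, simp add: ip_def)

lemma ip_zero_left [simp]: "ip 0 w = 0"
  by (simp add: ip_def)

lemma ip_zero_right [simp]: "ip z 0 = 0"
  by (simp add: ip_def)

lemma scaleR_eq_smult: "r *\<^sub>R z = complex_of_real r *s (z :: complex ^ 'n)"
  by (simp add: vec_eq_iff of_real_def)

lemma ip_scaleR_left: "ip (r *\<^sub>R x) w = of_real r * ip x w"
  by (simp add: scaleR_eq_smult ip_smult_left)

lemma norm_smult: "norm (c *s z) = norm c * norm (z :: complex ^ 'n)"
proof -
  have "complex_of_real ((norm (c *s z))\<^sup>2) = of_real ((norm c * norm z)\<^sup>2)"
    unfolding ip_self[symmetric] ip_smult_left ip_smult_right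
    by (simp add: ip_self power_mult_distrib complex_norm_square[of c] mult_ac del: of_real_power)
  then have "(norm (c *s z))\<^sup>2 = (norm c * norm z)\<^sup>2"
    using of_real_eq_iff by blast
  then show ?thesis
    by (simp add: power2_eq_iff_nonneg)
qed

lemma norm_ip_le: "norm (ip z w) \<le> norm z * norm w"
proof (cases "ip z w = 0")
  case False
  \<comment> \<open>The conjugate phase of \<open>ip z w\<close>: after \<open>z\<close> is rotated
    by it, the complex product is a nonnegative real, hence a real inner product, to which the real
    Cauchy-Schwarz inequality applies.\<close>
  define c where "c = cnj (ip z w) / of_real (norm (ip z w))"
  have [simp]: "norm c = 1"
    using False by (simp add: c_def norm_divide)
  have "c * ip z w = (ip z w * cnj (ip z w)) / of_real (norm (ip z w))"
    by (simp add: c_def)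
  also have "\<dots> = of_real (norm (ip z w))"
    using False unfolding complex_norm_square[symmetric] by (simp add: power2_eq_square)
  finally have "c * ip z w = of_real (norm (ip z w))" .
  then have "norm (ip z w) = Re (ip (c *s z) w)"
    by (simp add: ip_smult_left)
  also have "\<dots> \<le> norm (c *s z) * norm w"
    unfolding Re_ip by (rule norm_cauchy_schwarz)
  finally show ?thesis
    by (simp add: norm_smult)
qed simp

lemma bounded_linear_ip: "bounded_linear (\<lambda>z. ip z w)"
  by (rule bounded_linear_intro[of _ "norm w"])
     (simp_all add: ip_add_left ip_scaleR_left norm_ip_le scaleR_conv_of_real[where x="ip _ _"])

lemma bounded_linear_ip_right: "bounded_linear (\<lambda>z. ip w z)"
  using bounded_linear_compose[OF bounded_linear_cnj bounded_linear_ip[of w]]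
  by (simp add: cnj_ip)

lemma continuous_on_ip [continuous_intros]:
  assumes "continuous_on A f" "continuous_on A g"
  shows "continuous_on A (\<lambda>x. ip (f x) (g x))"
  unfolding ip_def by (intro continuous_intros assms)

lemma borel_measurable_ip [measurable]: "(\<lambda>z. ip z w) \<in> borel_measurable borel"
  by (intro borel_measurable_continuous_onI continuous_intros)

lemma borel_measurable_ip_right [measurable]: "(\<lambda>z. ip w z) \<in> borel_measurable borel"
  by (intro borel_measurable_continuous_onI continuous_intros)

lemma bounded_linear_smult_left: "bounded_linear (\<lambda>c. c *s (z :: complex ^ 'n))"
  by (rule bounded_linear_intro[of _ "norm z"])
     (simp_all add: norm_smult vector_sadd_rdistrib, simp add: vec_eq_iff)

lemma continuous_on_smult [continuous_intros]:
  fixes g :: "'a::topological_space \<Rightarrow> complex ^ 'n"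
  assumes "continuous_on A f" "continuous_on A g"
  shows "continuous_on A (\<lambda>x. f x *s g x)"
proof -
  have *: "(\<lambda>x. f x *s g x) = (\<lambda>x. \<chi> i. f x * g x $ i)"
    by (simp add: fun_eq_iff vec_eq_iff)
  show ?thesis
    unfolding * using assms by (intro continuous_on_vec_lambda continuous_intros)
qed

subsection \<open>Isometries preserve Lebesgue measure\<close>

text \<open>A translation-invariant measure \<open>\<mu>\<close> is a multiple of Lebesgue measure \<open>\<lambda>\<close>: integrating
  \<open>1\<^sub>A (x + y) 1\<^sub>Q (y)\<close> over \<open>\<mu> \<otimes> \<lambda>\<close> in either order gives \<open>\<mu> A \<lambda> Q = \<lambda> A \<mu> (-Q)\<close>.\<close>

lemma lborel_distr_isometry:
  fixes T :: "'a::euclidean_space \<Rightarrow> 'a"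
  assumes "linear T" and iso: "\<And>x. norm (T x) = norm x"
  shows "distr lborel borel T = lborel"
proof -
  have injT: "inj T"
    using assms by (simp add: linear_injective_0) (metis norm_eq_zero)
  then have "surj T"
    using assms(1) linear_inj_imp_surj by blast
  define R where "R = inv T"
  have TR: "T (R x) = x" for x
    by (simp add: R_def \<open>surj T\<close> surj_f_inv_f)
  have [measurable]: "T \<in> borel_measurable borel"
    using assms(1) by (auto intro!: borel_measurable_continuous_onI linear_continuous_on simp: linear_conv_bounded_linear)
  let ?\<mu> = "distr lborel borel T"
  interpret mu: sigma_finite_measure ?\<mu>
  proof (rule sigma_finite_measure.intro, intro exI conjI ballI)
    show "countable (range (\<lambda>n::nat. ball (0::'a) n))" by simp
    show "range (\<lambda>n::nat. ball (0::'a) n) \<subseteq> sets ?\<mu>" by auto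
    show "\<Union> (range (\<lambda>n::nat. ball (0::'a) n)) = space ?\<mu>"
      by (auto simp: reals_Archimedean2)
    fix B assume "B \<in> range (\<lambda>n::nat. ball (0::'a) n)"
    then obtain n :: nat where B: "B = ball 0 (real n)" by auto
    have "T -` B = B" using iso by (auto simp: B)
    then show "emeasure ?\<mu> B \<noteq> \<infinity>"
      using emeasure_bounded_finite[OF bounded_ball[of "0::'a" "real n"]]
      by (auto simp: emeasure_distr B)
  qed
  interpret P: pair_sigma_finite "?\<mu>" "lborel :: 'a measure" ..
  \<comment> \<open>The unit ball is symmetric, so the reflection of \<open>Q\<close> disappears,
    and invariant under \<open>T\<close>, so both measures agree on it. Its volume is positive and
    finite and can be cancelled.\<close>
  define Q where "Q = ball (0::'a) 1"
  have [measurable]: "Q \<in> sets borel" and Q_ball: "\<And>x. x \<in> Q \<longleftrightarrow> norm x < 1"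
    by (auto simp: Q_def)
  have transl: "(\<integral>\<^sup>+x. f (x + y) \<partial>?\<mu>) = (\<integral>\<^sup>+x. f x \<partial>?\<mu>)" if [measurable]: "f \<in> borel_measurable borel" for f and y :: 'a
  proof -
    have "(\<integral>\<^sup>+x. f (x + y) \<partial>?\<mu>) = (\<integral>\<^sup>+x. f (T x + y) \<partial>lborel)"
      by (subst nn_integral_distr) auto
    also have "\<dots> = (\<integral>\<^sup>+x. f (T (R y + x)) \<partial>lborel)"
      using assms(1) by (intro nn_integral_cong) (simp add: linear_add TR add.commute)
    also have "\<dots> = (\<integral>\<^sup>+x. f (T x) \<partial>distr lborel borel ((+) (R y)))"
      by (subst nn_integral_distr) auto
    also have "\<dots> = (\<integral>\<^sup>+x. f x \<partial>?\<mu>)"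
      by (subst lborel_distr_plus, subst nn_integral_distr) auto
    finally show ?thesis .
  qed
  have ltransl: "(\<integral>\<^sup>+x. f (y + x) \<partial>lborel) = (\<integral>\<^sup>+x. f x \<partial>lborel)" if [measurable]: "f \<in> borel_measurable borel" for f and y :: 'a
    by (subst (2) lborel_distr_plus[of y, symmetric], subst nn_integral_distr) auto
  have key: "emeasure ?\<mu> A * emeasure lborel Q = emeasure lborel A * emeasure ?\<mu> Q"
    if [measurable]: "A \<in> sets borel" for A
  proof -
    have "(\<integral>\<^sup>+y. (\<integral>\<^sup>+x. indicator A (x + y) * indicator Q y \<partial>?\<mu>) \<partial>lborel)
        = (\<integral>\<^sup>+y. emeasure ?\<mu> A * indicator Q y \<partial>lborel)"
      using transl[of "indicator A"] by (intro nn_integral_cong) (simp add: nn_integral_multc)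
    also have "\<dots> = emeasure ?\<mu> A * emeasure lborel Q"
      by (simp add: nn_integral_cmult_indicator)
    finally have 1: "(\<integral>\<^sup>+y. (\<integral>\<^sup>+x. indicator A (x + y) * indicator Q y \<partial>?\<mu>) \<partial>lborel)
       = emeasure ?\<mu> A * emeasure lborel Q" .
    have "(\<integral>\<^sup>+y. (\<integral>\<^sup>+x. indicator A (x + y) * indicator Q y \<partial>?\<mu>) \<partial>lborel)
        = (\<integral>\<^sup>+x. (\<integral>\<^sup>+y. indicator A (x + y) * indicator Q y \<partial>lborel) \<partial>?\<mu>)"
      by (rule P.Fubini') measurable
    also have "\<dots> = (\<integral>\<^sup>+x. (\<integral>\<^sup>+y. indicator A y * indicator Q (y - x) \<partial>lborel) \<partial>?\<mu>)"
    proof (rule nn_integral_cong)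
      fix x :: 'a
      show "(\<integral>\<^sup>+y. indicator A (x + y) * indicator Q y \<partial>lborel) = (\<integral>\<^sup>+y. indicator A y * indicator Q (y - x) \<partial>lborel)"
        using ltransl[of "\<lambda>y. indicator A y * indicator Q (y - x)" x] by simp
    qed
    also have "\<dots> = (\<integral>\<^sup>+y. (\<integral>\<^sup>+x. indicator A y * indicator Q (y - x) \<partial>?\<mu>) \<partial>lborel)"
      by (rule P.Fubini'[symmetric]) measurable
    also have "\<dots> = (\<integral>\<^sup>+y. (\<integral>\<^sup>+x. indicator A y * indicator Q (x + (- y)) \<partial>?\<mu>) \<partial>lborel)"
      by (intro nn_integral_cong) (auto simp: Q_ball norm_minus_commute split: split_indicator)
    also have "\<dots> = (\<integral>\<^sup>+y. indicator A y * emeasure ?\<mu> Q \<partial>lborel)"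
      using transl[of "indicator Q"] by (intro nn_integral_cong) (simp add: nn_integral_cmult del: add_uminus_conv_diff)
    also have "\<dots> = emeasure lborel A * emeasure ?\<mu> Q"
      by (simp add: nn_integral_multc)
    finally show ?thesis using 1 by simp
  qed
  have "T -` Q = Q" using iso by (auto simp: Q_ball)
  then have Q: "emeasure ?\<mu> Q = emeasure lborel Q"
    by (simp add: emeasure_distr)
  have Q0: "emeasure lborel Q \<noteq> 0"
    by (simp add: Q_def emeasure_ball unit_ball_vol_pos less_imp_neq[symmetric])
  have Qf: "emeasure lborel Q \<noteq> \<infinity>"
    using emeasure_lborel_ball_finite[of "0::'a" 1] by (auto simp: Q_def)
  show ?thesis
  proof (rule measure_eqI)
    fix A assume "A \<in> sets ?\<mu>"
    then have "A \<in> sets borel" by simp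
    from key[OF this] show "emeasure ?\<mu> A = emeasure lborel A"
      using Q Q0 Qf by (metis ennreal_mult_strict_right_mono infinity_ennreal_def less_irrefl linorder_cases mult.commute not_gr_zero top.not_eq_extremum)
  qed simp
qed

subsection \<open>Mean values over the unitary rotations fixing a vector\<close>

definition proj :: "complex ^ 'n \<Rightarrow> complex ^ 'n \<Rightarrow> complex ^ 'n" where
  "proj w z = (ip z w / of_real ((norm w)\<^sup>2)) *s w"

text \<open>For |c| = 1 a unitary map that fixes \<open>w\<close> and multiplies its orthogonal
  complement by \<open>c\<close>; for |c| < 1 a contraction. Thus \<open>c\<close> may run through
  the whole disc and functions may be holomorphic in it. Since \<open>proj 0 z = 0\<close>, the case
  \<open>w = 0\<close> is plain multiplication by \<open>c\<close>.\<close>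

definition rot :: "complex ^ 'n \<Rightarrow> complex \<Rightarrow> complex ^ 'n \<Rightarrow> complex ^ 'n" where
  "rot w c z = proj w z + c *s (z - proj w z)"

lemma proj_zero [simp]: "proj 0 z = 0"
  by (simp add: proj_def)

lemma rot_0 [simp]: "rot w 0 z = proj w z"
  by (simp add: rot_def)

lemma rot_zero_vec [simp]: "rot 0 c z = c *s z"
  by (simp add: rot_def)

lemma rot_1 [simp]: "rot w 1 z = z"
  by (simp add: rot_def)

lemma ip_proj: "ip (proj w z) w = ip z w"
  by (cases "w = 0") (auto simp: proj_def ip_smult_left ip_self)

lemma ip_proj_orth: "ip (proj w z) (z - proj w z) = 0"
proof -
  have "ip (z - proj w z) w = 0"
    by (simp add: ip_diff_left ip_proj)
  then have "ip w (z - proj w z) = 0"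
    by (metis cnj_ip complex_cnj_zero)
  then show ?thesis
    by (simp add: proj_def ip_smult_left)
qed

lemma ip_rot: "ip (rot w c z) w = ip z w"
  by (simp add: rot_def ip_add_left ip_smult_left ip_diff_left ip_proj)

lemma norm_rot_sq: "(norm (rot w c z))\<^sup>2 = (norm (proj w z))\<^sup>2 + (norm c)\<^sup>2 * (norm (z - proj w z))\<^sup>2"
proof -
  have "inner (proj w z) (c *s (z - proj w z)) = 0"
    by (metis Re_ip ip_proj_orth ip_smult_right mult_zero_right zero_complex.simps(1))
  then show ?thesis
    unfolding rot_def using norm_add_Pythagorean[of "proj w z" "c *s (z - proj w z)"]
    by (simp add: orthogonal_def norm_smult power_mult_distrib del: vector_ssub_ldistrib)
qed

lemma norm_rot: "norm c = 1 \<Longrightarrow> norm (rot w c z) = norm z"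
  using norm_rot_sq[of w c z] norm_rot_sq[of w 1 z]
    power2_eq_iff_nonneg[OF norm_ge_zero norm_ge_zero, of "rot w c z" z] by simp

lemma norm_rot_le: "norm c \<le> 1 \<Longrightarrow> norm (rot w c z) \<le> norm z"
proof -
  assume "norm c \<le> 1"
  then have "(norm c)\<^sup>2 \<le> 1"
    by (simp add: power_le_one)
  then have "(norm (rot w c z))\<^sup>2 \<le> (norm (rot w 1 z))\<^sup>2"
    unfolding norm_rot_sq by (simp add: mult_left_le_one_le)
  then show ?thesis
    by (simp add: power2_le_iff_abs_le)
qed

lemma linear_rot: "linear (rot w c)"
  by (rule linearI)
     (simp_all add: rot_def proj_def ip_add_left ip_scaleR_left vec_eq_iff field_simps,
      simp_all add: scaleR_conv_of_real[where x="_ :: complex"] algebra_simps add_divide_distrib)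

lemma continuous_on_rot [continuous_intros]:
  assumes "continuous_on A f" "continuous_on A g"
  shows "continuous_on A (\<lambda>x. rot w (f x) (g x))"
proof -
  have *: "rot w (f x) (g x) = proj w (g x) + f x *s (g x - proj w (g x))" for x
    by (simp add: rot_def)
  have "continuous_on A (\<lambda>x. proj w (g x))"
    unfolding proj_def divide_inverse by (intro continuous_intros assms)
  then show ?thesis
    unfolding * by (intro continuous_intros assms)
qed

definition radial :: "(real \<Rightarrow> real) \<Rightarrow> (complex ^ 'n) measure" where
  "radial v = density lborel (\<lambda>z. ennreal (v (norm z)))"

lemma sets_radial [simp, measurable_cong]: "sets (radial v) = sets borel"
  by (simp add: radial_def)

lemma space_radial [simp]: "space (radial v) = UNIV"
  by (simp add: radial_def)

lemma distr_radial_isometry: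
  fixes T :: "complex ^ 'n \<Rightarrow> complex ^ 'n"
  assumes "linear T" and iso: "\<And>x. norm (T x) = norm x" and [measurable]: "v \<in> borel_measurable borel"
  shows "distr (radial v) borel T = radial v"
proof -
  have [measurable]: "T \<in> borel_measurable borel"
    using assms(1) by (auto intro!: borel_measurable_continuous_onI linear_continuous_on simp: linear_conv_bounded_linear)
  have "radial v = density (distr lborel borel T) (\<lambda>z. ennreal (v (norm z)))"
    by (simp add: radial_def lborel_distr_isometry[OF assms(1,2)])
  also have "\<dots> = distr (density lborel (\<lambda>x. ennreal (v (norm (T x))))) borel T"
    by (subst density_distr) auto
  finally show ?thesis
    by (simp add: iso radial_def)
qed

text \<open>The integral is taken over a restricted Lebesgue measure instead of a contour because
  \<open>rot_mean_value\<close> interchanges it with a second measure by Fubini.\<close>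

lemma circle_mean_value:
  assumes "continuous_on (cball 0 1) h" "h holomorphic_on ball 0 1"
  shows "(\<integral>t. h (exp (2 * of_real pi * \<i> * of_real t)) \<partial>restrict_space lborel {0..1::real}) = h 0"
proof -
  define e where "e = (\<lambda>t::real. exp (2 * of_real pi * \<i> * of_real t))"
  have "((\<lambda>u. h u / (u - 0)) has_contour_integral (2 * of_real pi * \<i> * h 0)) (circlepath 0 1)"
    by (rule Cauchy_integral_circlepath) (use assms in auto)
  then have "((\<lambda>x. h (e x) / e x * (2 * of_real pi * \<i> * e x)) has_integral (2 * of_real pi * \<i> * h 0)) {0..1}"
    unfolding has_contour_integral_def
    by (rule has_integral_cong[THEN iffD1, rotated])
       (simp only: vector_derivative_circlepath01 atLeastAtMost_iff, simp add: circlepath e_def)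
  then have 0: "((\<lambda>x. (2 * of_real pi * \<i>) * h (e x)) has_integral (2 * of_real pi * \<i> * h 0)) {0..1}"
    by (simp add: e_def mult_ac)
  have 1: "((\<lambda>x. h (e x)) has_integral h 0) {0..1}"
  proof -
    have *: "inverse c * (c * y) = y" if "c \<noteq> 0" for c y :: complex
      using that by simp
    have nz: "2 * of_real pi * \<i> \<noteq> (0 :: complex)"
      by simp
    show ?thesis
      using has_integral_mult_right[OF 0, of "inverse (2 * of_real pi * \<i>)"]
      unfolding *[OF nz] .
  qed
  have ne: "norm (e t) = 1" for t
    by (simp add: e_def norm_exp_eq_Re)
  have "continuous_on {0..1} (\<lambda>x. h (e x))"
    by (rule continuous_on_compose2[OF assms(1)])
       (auto simp: ne, auto simp: e_def intro!: continuous_intros)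
  then have "set_integrable lborel {0..1} (\<lambda>x. h (e x))"
    by (rule borel_integrable_atLeastAtMost')
  from set_borel_integral_eq_integral(2)[OF this] 1
  have "(LINT x:{0..1}|lborel. h (e x)) = h 0"
    by (simp add: integral_unique)
  then show ?thesis
    by (simp add: integral_restrict_space set_lebesgue_integral_def e_def)
qed

text \<open>Every rotation with |c| = 1 preserves the measure, so averaging over the circle changes
  nothing. After Fubini the inner circle mean of a function holomorphic in \<open>c\<close> is its
  value at \<open>c = 0\<close>, where \<open>rot\<close> becomes the projection onto the line of
  \<open>w\<close>. Regularity is asked for only where the density is positive, because the other
  points form a null set.\<close>

lemma rot_mean_value:
  fixes g :: "complex ^ 'n \<Rightarrow> complex"
  assumes [measurable]: "v \<in> borel_measurable borel" and g: "integrable (radial v) g"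
    and fin: "finite_measure (radial v :: (complex ^ 'n) measure)"
    and cont: "\<And>z. v (norm z) > 0 \<Longrightarrow> continuous_on (cball 0 1) (\<lambda>c. g (rot w c z))"
    and hol: "\<And>z. v (norm z) > 0 \<Longrightarrow> (\<lambda>c. g (rot w c z)) holomorphic_on ball 0 1"
  shows "(\<integral>z. g z \<partial>radial v) = (\<integral>z. g (proj w z) \<partial>radial v)"
proof -
  define e where "e = (\<lambda>t::real. exp (2 * of_real pi * \<i> * of_real t))"
  let ?L = "restrict_space lborel {0..1::real}" and ?M = "radial v :: (complex ^ 'n) measure"
  have ne: "norm (e t) = 1" for t
    by (simp add: e_def norm_exp_eq_Re)
  have mg[measurable]: "g \<in> borel_measurable borel"
    using g by (simp add: integrable_iff_bounded cong: measurable_cong_sets)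
  have "finite_measure ?L"
    by (rule finite_measureI) (simp add: emeasure_restrict_space space_restrict_space)
  interpret L: finite_measure ?L by fact
  interpret M: finite_measure ?M by fact
  interpret P: pair_sigma_finite ?L ?M ..
  have cr: "continuous_on UNIV (\<lambda>x. rot w (e (fst x)) (snd x))"
    unfolding e_def by (intro continuous_intros)
  then have "(\<lambda>x. rot w (e (fst x)) (snd x)) \<in> borel_measurable borel"
    by (rule borel_measurable_continuous_onI)
  then have "(\<lambda>x. rot w (e (fst x)) (snd x)) \<in> borel_measurable (borel \<Otimes>\<^sub>M borel)"
    by (simp add: borel_prod)
  then have m1: "(\<lambda>x. rot w (e (fst x)) (snd x)) \<in> borel_measurable (?L \<Otimes>\<^sub>M ?M)"
  proof (rule measurable_compose[rotated])
    have [measurable]: "(\<lambda>t. t) \<in> borel_measurable ?L"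
      by (rule measurable_restrict_space1) auto
    have "(\<lambda>x. (fst x, snd x)) \<in> ?L \<Otimes>\<^sub>M ?M \<rightarrow>\<^sub>M borel \<Otimes>\<^sub>M borel"
      by measurable
    then show "(\<lambda>x. x) \<in> ?L \<Otimes>\<^sub>M ?M \<rightarrow>\<^sub>M borel \<Otimes>\<^sub>M borel"
      by simp
  qed
  have m2[measurable]: "(\<lambda>x. g (rot w (e (fst x)) (snd x))) \<in> borel_measurable (?L \<Otimes>\<^sub>M ?M)"
    by (rule measurable_compose[OF m1 mg])
  have dr: "distr ?M borel (rot w (e t)) = ?M" for t
    by (rule distr_radial_isometry) (simp_all add: linear_rot norm_rot ne)
  have [measurable]: "rot w c \<in> borel_measurable borel" for c
    by (intro borel_measurable_continuous_onI continuous_intros)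
  have inv: "integral\<^sup>L ?M (\<lambda>z. h (rot w (e t) z)) = integral\<^sup>L ?M h"
    if [measurable]: "h \<in> borel_measurable borel" for h :: "complex ^ 'n \<Rightarrow> 'a::{banach,second_countable_topology}" and t
  proof -
    have "integral\<^sup>L (distr ?M borel (rot w (e t))) h = integral\<^sup>L ?M (\<lambda>z. h (rot w (e t) z))"
      by (rule integral_distr) auto
    then show ?thesis by (simp add: dr)
  qed
  have int: "integrable (?L \<Otimes>\<^sub>M ?M) (\<lambda>x. g (rot w (e (fst x)) (snd x)))"
  proof (rule P.Fubini_integrable)
    show "integrable ?L (\<lambda>t. \<integral>z. norm (g (rot w (e (fst (t, z))) (snd (t, z)))) \<partial>?M)"
      using inv[of "\<lambda>z. norm (g z)"] by simp
    have "integrable ?M (\<lambda>z. g (rot w (e t) z))" for t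
    proof -
      have "integrable (distr ?M borel (rot w (e t))) g"
        by (simp add: dr g)
      then show ?thesis
        by (subst (asm) integrable_distr_eq) auto
    qed
    then show "AE t in ?L. integrable ?M (\<lambda>z. g (rot w (e (fst (t, z))) (snd (t, z))))"
      by simp
  qed (rule m2)
  have "(\<integral>z. g z \<partial>?M) = (\<integral>t. (\<integral>z. g (rot w (e t) z) \<partial>?M) \<partial>?L)"
    by (simp add: inv measure_restrict_space space_restrict_space)
  also have "\<dots> = (\<integral>z. (\<integral>t. g (rot w (e t) z) \<partial>?L) \<partial>?M)"
    using P.Fubini_integral[of "\<lambda>t z. g (rot w (e t) z)"] int by (simp add: case_prod_beta')
  also have "\<dots> = (\<integral>z. g (proj w z) \<partial>?M)"
  proof (rule integral_cong_AE)
    show "(\<lambda>z. \<integral>t. g (rot w (e t) z) \<partial>?L) \<in> borel_measurable ?M"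
      using measurable_compose[OF measurable_pair_swap' m2]
      by (intro L.borel_measurable_lebesgue_integral) (simp add: case_prod_beta')
    have "proj w \<in> borel_measurable borel"
      using \<open>\<And>c. rot w c \<in> borel_measurable borel\<close>[of 0]
      by (simp add: rot_0[abs_def, symmetric])
    then show "(\<lambda>z. g (proj w z)) \<in> borel_measurable ?M" by measurable
    have "(\<integral>t. g (rot w (e t) z) \<partial>?L) = g (proj w z)" if "v (norm z) > 0" for z
      using circle_mean_value[OF cont[OF that] hol[OF that]] by (simp add: e_def)
    then show "AE z in ?M. (\<integral>t. g (rot w (e t) z) \<partial>?L) = g (proj w z)"
      unfolding radial_def by (subst AE_density) auto
  qed
  finally show ?thesis .
qed

subsection \<open>Orthogonality of powers of a linear form\<close>

text \<open>The scalar rotation by \<open>c\<close> multiplies the integrand by c^j cnj(c)^l. The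
  angle pi/(j - l) makes this factor -1, so the integral equals its own negative. The argument
  covers nonintegrable integrands too, whose integral is 0 by convention.\<close>

lemma radial_orthogonal:
  assumes [measurable]: "v \<in> borel_measurable borel" and "j \<noteq> l"
  shows "(\<integral>z. ip z w ^ j * ip w z ^ l \<partial>radial v) = 0"
proof -
  define c where "c = cis (pi / (real j - real l))"
  let ?I = "\<integral>z. ip z w ^ j * ip w z ^ l \<partial>radial v"
  have c1: "norm c = 1"
    by (simp add: c_def)
  have cc: "c ^ j * cnj c ^ l = -1"
  proof -
    have "c ^ j * cnj c ^ l = cis (real j * (pi / (real j - real l)) - real l * (pi / (real j - real l)))"
      by (simp add: c_def Complex.DeMoivre cis_cnj cis_mult)
    also have "real j * (pi / (real j - real l)) - real l * (pi / (real j - real l)) = pi"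
      using assms(2) by (simp add: diff_divide_distrib[symmetric] left_diff_distrib[symmetric])
    finally show ?thesis by simp
  qed
  have "?I = integral\<^sup>L (distr (radial v) borel (rot 0 c)) (\<lambda>z. ip z w ^ j * ip w z ^ l)"
    by (subst distr_radial_isometry) (simp_all add: linear_rot norm_rot c1 del: rot_zero_vec)
  also have "\<dots> = (\<integral>z. ip (rot 0 c z) w ^ j * ip w (rot 0 c z) ^ l \<partial>radial v)"
    by (rule integral_distr)
       (auto intro!: borel_measurable_continuous_onI continuous_intros simp: measurable_cong_sets[OF sets_radial refl] simp del: rot_zero_vec)
  also have "\<dots> = (\<integral>z. (c ^ j * cnj c ^ l) * (ip z w ^ j * ip w z ^ l) \<partial>radial v)"
    by (simp add: ip_smult_left ip_smult_right power_mult_distrib mult_ac)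
  also have "\<dots> = - ?I"
    unfolding cc by simp
  finally show ?thesis
    by simp
qed

text \<open>One integrable majorant of the sum of norms supplies everything that termwise
  integration requires: it dominates each term and bounds the partial sums of the integrals.\<close>

lemma sums_integral_dominated:
  fixes f :: "nat \<Rightarrow> 'a \<Rightarrow> 'b::{banach, second_countable_topology}"
  assumes [measurable]: "\<And>i. f i \<in> borel_measurable M" and g: "integrable M g"
    and summ: "AE x in M. summable (\<lambda>i. norm (f i x))"
    and le: "AE x in M. (\<Sum>i. norm (f i x)) \<le> g x"
  shows "(\<lambda>i. integral\<^sup>L M (f i)) sums (\<integral>x. (\<Sum>i. f i x) \<partial>M)"
proof -
  have part: "AE x in M. (\<Sum>i\<in>A. norm (f i x)) \<le> g x" if "finite A" for A
    using summ le
  proof eventually_elim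
    case (elim x)
    have "(\<Sum>i\<in>A. norm (f i x)) \<le> (\<Sum>i. norm (f i x))"
      by (rule sum_le_suminf) (use elim that in auto)
    then show ?case using elim by simp
  qed
  have int: "integrable M (f i)" for i
  proof (rule Bochner_Integration.integrable_bound[OF g])
    show "AE x in M. norm (f i x) \<le> norm (g x)"
      using part[of "{i}"] by (auto elim!: eventually_mono)
  qed simp
  have "(\<Sum>i\<le>n. (\<integral>x. norm (f i x) \<partial>M)) \<le> integral\<^sup>L M g" for n
  proof -
    have "(\<Sum>i\<le>n. (\<integral>x. norm (f i x) \<partial>M)) = (\<integral>x. (\<Sum>i\<le>n. norm (f i x)) \<partial>M)"
      by (rule Bochner_Integration.integral_sum[symmetric]) (simp add: int)
    also have "\<dots> \<le> integral\<^sup>L M g"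
      by (rule integral_mono_AE) (use part[of "{..n}"] g int in auto)
    finally show ?thesis .
  qed
  then have "summable (\<lambda>i. \<integral>x. norm (f i x) \<partial>M)"
    by (intro bounded_imp_summable[of _ "integral\<^sup>L M g"]) auto
  then show ?thesis
    by (intro sums_integral int summ)
qed

text \<open>Two successive termwise integrations: for fixed \<open>j\<close> the series in
  \<open>ip w z\<close> is expanded and orthogonality leaves only \<open>l = j\<close>; then the
  series in \<open>ip z w\<close> is expanded. Both are dominated by \<open>g\<close>, a majorant of
  the product of the two absolute series. The coefficients \<open>d\<close> are not conjugated,
  since conjugation already sits in \<open>ip w z\<close>.\<close>

lemma radial_parseval:
  fixes c d :: "nat \<Rightarrow> complex" and w :: "complex ^ 'n"
  assumes [measurable]: "v \<in> borel_measurable borel"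
    and sc: "AE z in radial v. summable (\<lambda>j. norm (c j) * norm (ip z w) ^ j)"
    and sd: "AE z in radial v. summable (\<lambda>j. norm (d j) * norm (ip z w) ^ j)"
    and g: "integrable (radial v) g"
    and le: "AE z in radial v. (\<Sum>j. norm (c j) * norm (ip z w) ^ j) * (\<Sum>j. norm (d j) * norm (ip z w) ^ j) \<le> g z"
  shows "(\<lambda>j. c j * d j * of_real (\<integral>z. norm (ip z w) ^ (2 * j) \<partial>radial v)) sums
           (\<integral>z. (\<Sum>j. c j * ip z w ^ j) * (\<Sum>j. d j * ip w z ^ j) \<partial>radial v)"
proof -
  let ?M = "radial v :: (complex ^ 'n) measure"
  let ?D = "\<lambda>z. \<Sum>l. d l * ip w z ^ l"
  have [simp]: "norm (ip w z) = norm (ip z w)" for z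
    by (metis cnj_ip complex_mod_cnj)
  have D: "AE z in ?M. norm (?D z) \<le> (\<Sum>l. norm (d l) * norm (ip z w) ^ l)"
    using sd
  proof eventually_elim
    case (elim z)
    then show ?case
      using summable_norm[of "\<lambda>l. d l * ip w z ^ l"] by (simp add: norm_mult norm_power)
  qed
  have inner: "(\<integral>z. c j * ip z w ^ j * ?D z \<partial>?M) = c j * d j * of_real (\<integral>z. norm (ip z w) ^ (2 * j) \<partial>?M)" for j
  proof -
    have "(\<lambda>l. \<integral>z. c j * ip z w ^ j * (d l * ip w z ^ l) \<partial>?M) sums
        (\<integral>z. (\<Sum>l. c j * ip z w ^ j * (d l * ip w z ^ l)) \<partial>?M)"
    proof (rule sums_integral_dominated[OF _ g])
      show "AE z in ?M. summable (\<lambda>l. norm (c j * ip z w ^ j * (d l * ip w z ^ l)))"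
        using sd by eventually_elim (simp add: norm_mult norm_power summable_mult)
      show "AE z in ?M. (\<Sum>l. norm (c j * ip z w ^ j * (d l * ip w z ^ l))) \<le> g z"
        using sd sc le
      proof eventually_elim
        case (elim z)
        have "(\<Sum>l. norm (c j * ip z w ^ j * (d l * ip w z ^ l)))
            = norm (c j) * norm (ip z w) ^ j * (\<Sum>l. norm (d l) * norm (ip z w) ^ l)"
          using elim(1) by (simp add: norm_mult norm_power suminf_mult)
        also have "\<dots> \<le> (\<Sum>j. norm (c j) * norm (ip z w) ^ j) * (\<Sum>l. norm (d l) * norm (ip z w) ^ l)"
        proof (rule mult_right_mono)
          show "norm (c j) * norm (ip z w) ^ j \<le> (\<Sum>j. norm (c j) * norm (ip z w) ^ j)"
            using sum_le_suminf[OF elim(2), of "{j}"] by simp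
          show "0 \<le> (\<Sum>l. norm (d l) * norm (ip z w) ^ l)"
            using elim(1) by (intro suminf_nonneg) auto
        qed
        finally show ?case using elim by simp
      qed
    qed measurable
    also have "(\<integral>z. (\<Sum>l. c j * ip z w ^ j * (d l * ip w z ^ l)) \<partial>?M) = (\<integral>z. c j * ip z w ^ j * ?D z \<partial>?M)"
    proof (rule integral_cong_AE)
      show "AE z in ?M. (\<Sum>l. c j * ip z w ^ j * (d l * ip w z ^ l)) = c j * ip z w ^ j * ?D z"
        using sd
      proof eventually_elim
        case (elim z)
        have "summable (\<lambda>l. d l * ip w z ^ l)"
          by (rule summable_norm_cancel) (use elim in \<open>simp add: norm_mult norm_power\<close>)
        then show ?case
          by (rule suminf_mult)
      qed
    qed measurable
    also have "(\<lambda>l. \<integral>z. c j * ip z w ^ j * (d l * ip w z ^ l) \<partial>?M)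
        = (\<lambda>l. if l = j then c j * d j * of_real (\<integral>z. norm (ip z w) ^ (2 * j) \<partial>?M) else 0)"
    proof
      fix l
      have "(\<integral>z. c j * ip z w ^ j * (d l * ip w z ^ l) \<partial>?M) = c j * d l * (\<integral>z. ip z w ^ j * ip w z ^ l \<partial>?M)"
        unfolding integral_mult_right_zero[symmetric] by (rule Bochner_Integration.integral_cong) (simp_all add: mult_ac)
      moreover have "ip z w ^ j * ip w z ^ j = of_real (norm (ip z w) ^ (2 * j))" for z
      proof -
        have "ip w z = cnj (ip z w)"
          by (simp add: cnj_ip)
        then show ?thesis
          by (simp add: power_mult_distrib[symmetric] complex_norm_square[symmetric] power_mult del: cnj_ip)
      qed
      ultimately show "(\<integral>z. c j * ip z w ^ j * (d l * ip w z ^ l) \<partial>?M)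
        = (if l = j then c j * d j * of_real (\<integral>z. norm (ip z w) ^ (2 * j) \<partial>?M) else 0)"
        using radial_orthogonal[of v j l w]
        by (auto simp: integral_complex_of_real simp del: of_real_power)
    qed
    finally have *: "(\<lambda>l. if l = j then c j * d j * of_real (\<integral>z. norm (ip z w) ^ (2 * j) \<partial>?M) else 0) sums
      (\<integral>z. c j * ip z w ^ j * ?D z \<partial>?M)" .
    show ?thesis
      by (rule sums_unique2[OF * sums_single])
  qed
  have "(\<lambda>j. \<integral>z. c j * ip z w ^ j * ?D z \<partial>?M) sums (\<integral>z. (\<Sum>j. c j * ip z w ^ j * ?D z) \<partial>?M)"
  proof (rule sums_integral_dominated[OF _ g])
    show "AE z in ?M. summable (\<lambda>j. norm (c j * ip z w ^ j * ?D z))"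
      using sc by eventually_elim (simp add: norm_mult norm_power summable_mult2)
    show "AE z in ?M. (\<Sum>j. norm (c j * ip z w ^ j * ?D z)) \<le> g z"
      using sc le D
    proof eventually_elim
      case (elim z)
      have "(\<Sum>j. norm (c j * ip z w ^ j * ?D z)) = (\<Sum>j. norm (c j) * norm (ip z w) ^ j) * norm (?D z)"
        using suminf_mult2[OF elim(1), of "norm (?D z)"] by (simp add: norm_mult norm_power)
      also have "\<dots> \<le> (\<Sum>j. norm (c j) * norm (ip z w) ^ j) * (\<Sum>l. norm (d l) * norm (ip z w) ^ l)"
        by (intro mult_left_mono elim suminf_nonneg) auto
      finally show ?case using elim by simp
    qed
  qed measurable
  also have "(\<integral>z. (\<Sum>j. c j * ip z w ^ j * ?D z) \<partial>?M) = (\<integral>z. (\<Sum>j. c j * ip z w ^ j) * ?D z \<partial>?M)"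
  proof (rule integral_cong_AE)
    show "AE z in ?M. (\<Sum>j. c j * ip z w ^ j * ?D z) = (\<Sum>j. c j * ip z w ^ j) * ?D z"
      using sc
    proof eventually_elim
      case (elim z)
      have "summable (\<lambda>l. c l * ip z w ^ l)"
        by (rule summable_norm_cancel) (use elim in \<open>simp add: norm_mult norm_power\<close>)
      then show ?case
        by (rule suminf_mult2[symmetric])
    qed
  qed measurable
  finally show ?thesis
    by (simp add: inner)
qed

subsection \<open>Moments of linear forms on the ball\<close>

lemma ball_in_borel [measurable]: "ball (a :: 'a::metric_space) r \<in> sets borel"
  by simp

lemma nn_integral_lborel_scale:
  fixes F :: "'a::euclidean_space \<Rightarrow> ennreal"
  assumes [measurable]: "F \<in> borel_measurable borel" and "c > 0"
  shows "(\<integral>\<^sup>+z. F z \<partial>lborel) = ennreal (c ^ DIM('a)) * (\<integral>\<^sup>+z. F (c *\<^sub>R z) \<partial>lborel)"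
  using assms(2)
  by (subst lborel_affine[of c 0])
     (auto simp: nn_integral_density nn_integral_distr nn_integral_cmult)

text \<open>Valued in \<open>ennreal\<close>, so that the interchanges of integrals below are for
  nonnegative functions and ask for no integrability.\<close>

definition ball_moment :: "complex ^ 'n \<Rightarrow> nat \<Rightarrow> ennreal" where
  "ball_moment w j = (\<integral>\<^sup>+z. ennreal (norm (ip z w) ^ (2 * j)) * indicator (ball 0 1) z \<partial>lborel)"

text \<open>Homogeneity: the substitution of \<open>sqrt u\<close> times \<open>z\<close>
  contributes u^n from the 2n real dimensions and u^j from the integrand. The domain is written
  through |z|^2 because |z|^2 is the layer variable in \<open>gauss_moment\<close> and
  \<open>distr_ball_moment\<close>.\<close>

lemma ball_moment_scale:
  fixes w :: "complex ^ 'n"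
  assumes "u > 0"
  shows "(\<integral>\<^sup>+z. ennreal (norm (ip z w) ^ (2 * j)) * indicator {..<u} ((norm z)\<^sup>2) \<partial>lborel)
    = ennreal (u ^ (CARD('n) + j)) * ball_moment w j"
proof -
  have "(\<integral>\<^sup>+z. ennreal (norm (ip z w) ^ (2 * j)) * indicator {..<u} ((norm z)\<^sup>2) \<partial>lborel)
    = ennreal (sqrt u ^ DIM(complex ^ 'n)) * (\<integral>\<^sup>+z. ennreal (norm (ip (sqrt u *\<^sub>R z) w) ^ (2 * j)) * indicator {..<u} ((norm (sqrt u *\<^sub>R z))\<^sup>2) \<partial>lborel)"
    by (rule nn_integral_lborel_scale) (use assms in auto)
  also have "(\<integral>\<^sup>+z. ennreal (norm (ip (sqrt u *\<^sub>R z) w) ^ (2 * j)) * indicator {..<u} ((norm (sqrt u *\<^sub>R z))\<^sup>2) \<partial>lborel)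
    = (\<integral>\<^sup>+z. ennreal (u ^ j) * (ennreal (norm (ip z w) ^ (2 * j)) * indicator (ball 0 1) z) \<partial>lborel)"
  proof (rule nn_integral_cong)
    fix z :: "complex ^ 'n"
    have "norm (ip (sqrt u *\<^sub>R z) w) ^ (2 * j) = u ^ j * norm (ip z w) ^ (2 * j)"
      using assms by (simp add: ip_scaleR_left norm_mult power_mult_distrib power_mult)
    moreover have "(norm (sqrt u *\<^sub>R z))\<^sup>2 < u \<longleftrightarrow> z \<in> ball 0 1"
    proof -
      have "(norm (sqrt u *\<^sub>R z))\<^sup>2 = u * (norm z)\<^sup>2"
        using assms by (simp add: power_mult_distrib)
      also have "\<dots> < u \<longleftrightarrow> (norm z)\<^sup>2 < 1"
        using assms by auto
      finally show ?thesis
        by (simp add: abs_square_less_1)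
    qed
    ultimately show "ennreal (norm (ip (sqrt u *\<^sub>R z) w) ^ (2 * j)) * indicator {..<u} ((norm (sqrt u *\<^sub>R z))\<^sup>2)
      = ennreal (u ^ j) * (ennreal (norm (ip z w) ^ (2 * j)) * indicator (ball 0 1) z)"
      using assms by (auto simp: ennreal_mult' split: split_indicator)
  qed
  also have "\<dots> = ennreal (u ^ j) * ball_moment w j"
    unfolding ball_moment_def by (rule nn_integral_cmult) auto
  also have "ennreal (sqrt u ^ DIM(complex ^ 'n)) * (ennreal (u ^ j) * ball_moment w j)
      = ennreal (u ^ (CARD('n) + j)) * ball_moment w j"
    using assms by (simp add: power_add ennreal_mult' mult.assoc power_mult mult.commute[of _ 2])
  finally show ?thesis .
qed

lemma ball_moment_finite: "ball_moment (w :: complex ^ 'n) j < \<infinity>"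
proof -
  have "ball_moment w j \<le> (\<integral>\<^sup>+z. ennreal (norm w ^ (2 * j)) * indicator (ball (0 :: complex ^ 'n) 1) z \<partial>lborel)"
    unfolding ball_moment_def
  proof (rule nn_integral_mono)
    fix z :: "complex ^ 'n"
    show "ennreal (norm (ip z w) ^ (2 * j)) * indicator (ball 0 1) z \<le> ennreal (norm w ^ (2 * j)) * indicator (ball 0 1) z"
    proof (cases "norm z < 1")
      case True
      have "norm (ip z w) \<le> norm z * norm w" by (rule norm_ip_le)
      also have "\<dots> \<le> 1 * norm w" using True by (intro mult_right_mono) auto
      finally show ?thesis by (auto simp: ennreal_leI power_mono split: split_indicator)
    qed auto
  qed
  also have "\<dots> < \<infinity>"
    using emeasure_lborel_ball_finite[of "0 :: complex ^ 'n" 1]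
    by (simp add: nn_integral_cmult_indicator ennreal_mult_less_top)
  finally show ?thesis .
qed

section \<open>Gaussian moments of linear forms\<close>

lemma nn_integral_exp_tail:
  "ennreal (exp (- t)) = (\<integral>\<^sup>+u. ennreal (exp (- u)) * indicator {t<..} u \<partial>lborel)"
proof -
  have "(\<integral>\<^sup>+u. ennreal (exp (- u)) * indicator {t..} u \<partial>lborel) = ennreal (0 - (- exp (- t)))"
  proof (rule nn_integral_FTC_atLeast)
    show "((\<lambda>u::real. - exp (- u)) \<longlongrightarrow> 0) at_top"
      by real_asymp
  qed (auto intro!: derivative_eq_intros)
  moreover have "(\<integral>\<^sup>+u. ennreal (exp (- u)) * indicator {t<..} u \<partial>lborel) = (\<integral>\<^sup>+u. ennreal (exp (- u)) * indicator {t..} u \<partial>lborel)"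
    using AE_lborel_singleton[of t] by (intro nn_integral_cong_AE) (auto split: split_indicator)
  ultimately show ?thesis by simp
qed

lemma nn_integral_power_exp:
  "(\<integral>\<^sup>+u. ennreal (u ^ m * exp (- u)) * indicator {0<..} u \<partial>lborel) = fact m"
proof -
  have "((\<lambda>t. t powr (real (Suc m) - 1) / exp t) has_integral Gamma (real (Suc m))) {0..}"
    by (rule Gamma_integral_real) simp
  then have "integral\<^sup>N lborel (\<lambda>t. indicator {0..} t * (t powr (real (Suc m) - 1) / exp t)) = ennreal (Gamma (real (Suc m)))"
  proof (intro nn_integral_has_integral_lborel)
    have eq: "(\<lambda>t. indicator {0..} t * (t powr (real (Suc m) - 1) / exp t))
      = (\<lambda>t. if t \<in> {0..} then t powr (real (Suc m) - 1) / exp t else 0)"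
      by (auto simp: fun_eq_iff)
    assume "((\<lambda>t. t powr (real (Suc m) - 1) / exp t) has_integral Gamma (real (Suc m))) {0..}"
    then show "((\<lambda>t. indicator {0..} t * (t powr (real (Suc m) - 1) / exp t)) has_integral Gamma (real (Suc m))) UNIV"
      unfolding eq has_integral_restrict_UNIV .
  qed auto
  moreover have "integral\<^sup>N lborel (\<lambda>t. indicator {0..} t * (t powr (real (Suc m) - 1) / exp t))
     = (\<integral>\<^sup>+u. ennreal (u ^ m * exp (- u)) * indicator {0<..} u \<partial>lborel)"
    using AE_lborel_singleton[of 0]
    by (intro nn_integral_cong_AE) (auto split: split_indicator simp: powr_realpow exp_minus field_simps)
  moreover have "Gamma (real (Suc m)) = fact m"
    using Gamma_fact[of m, where 'a=real] by (simp add: add.commute)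
  ultimately show ?thesis
    by (metis ennreal_of_nat_eq_real_of_nat of_nat_fact)
qed

definition gauss :: "real \<Rightarrow> real" where
  "gauss r = exp (- r\<^sup>2)"

lemma borel_measurable_gauss [measurable]: "gauss \<in> borel_measurable borel"
  by (simp add: gauss_def[abs_def])

lemma nn_integral_radial:
  assumes [measurable]: "v \<in> borel_measurable borel" "F \<in> borel_measurable borel"
  shows "(\<integral>\<^sup>+z. F z \<partial>radial v) = (\<integral>\<^sup>+z. ennreal (v (norm z)) * F z \<partial>lborel)"
  unfolding radial_def by (rule nn_integral_density) auto

text \<open>Layer cake: exp(-|z|^2) is the integral of exp(-u) over u > |z|^2. After the interchange
  the inner integral runs over the ball |z|^2 < u, homogeneity extracts u^(n+j), and the remaining
  Gamma integral is the factorial.\<close>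

lemma gauss_moment:
  fixes w :: "complex ^ 'n"
  shows "(\<integral>\<^sup>+z. ennreal (norm (ip z w) ^ (2 * j)) \<partial>radial gauss) = fact (CARD('n) + j) * ball_moment w j"
proof -
  have "(\<integral>\<^sup>+z. ennreal (norm (ip z w) ^ (2 * j)) \<partial>radial gauss)
     = (\<integral>\<^sup>+z. ennreal (norm (ip z w) ^ (2 * j)) * ennreal (exp (- (norm z)\<^sup>2)) \<partial>lborel)"
    by (subst nn_integral_radial) (auto simp: gauss_def mult.commute)
  also have "\<dots> = (\<integral>\<^sup>+z. (\<integral>\<^sup>+u. ennreal (norm (ip z w) ^ (2 * j)) * (ennreal (exp (- u)) * indicator {(norm z)\<^sup>2<..} u) \<partial>lborel) \<partial>lborel)"
    by (subst nn_integral_exp_tail, intro nn_integral_cong nn_integral_cmult[symmetric]) auto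
  also have "\<dots> = (\<integral>\<^sup>+z. (\<integral>\<^sup>+u. (ennreal (norm (ip z w) ^ (2 * j)) * (ennreal (exp (- u)) * indicator {..<u} ((norm z)\<^sup>2))) \<partial>lborel) \<partial>lborel)"
    by (intro nn_integral_cong) (auto split: split_indicator)
  also have "\<dots> = (\<integral>\<^sup>+u. (\<integral>\<^sup>+z. (ennreal (norm (ip z w) ^ (2 * j)) * (ennreal (exp (- u)) * indicator {..<u} ((norm z)\<^sup>2))) \<partial>lborel) \<partial>lborel)"
    by (rule lborel_pair.Fubini'[symmetric]) (auto simp: lessThan_def indicator_def)
  also have "\<dots> = (\<integral>\<^sup>+u. ennreal (u ^ (CARD('n) + j) * exp (- u)) * indicator {0<..} u * ball_moment w j \<partial>lborel)"
  proof (rule nn_integral_cong)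
    fix u :: real
    have "(\<integral>\<^sup>+z. (ennreal (norm (ip z w) ^ (2 * j)) * (ennreal (exp (- u)) * indicator {..<u} ((norm z)\<^sup>2))) \<partial>lborel)
      = (\<integral>\<^sup>+z. ennreal (exp (- u)) * (ennreal (norm (ip z w) ^ (2 * j)) * indicator {..<u} ((norm z)\<^sup>2)) \<partial>lborel)"
      by (simp add: mult_ac)
    also have "\<dots> = ennreal (exp (- u)) * (\<integral>\<^sup>+z. (ennreal (norm (ip z w) ^ (2 * j)) * indicator {..<u} ((norm z)\<^sup>2)) \<partial>lborel)"
      by (rule nn_integral_cmult) auto
    also have "\<dots> = ennreal (u ^ (CARD('n) + j) * exp (- u)) * indicator {0<..} u * ball_moment w j"
    proof (cases "u > 0")
      case True
      then show ?thesis
        unfolding ball_moment_scale[OF True] by (simp add: ennreal_mult' mult_ac)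
    next
      case False
      have "indicator {..<u} ((norm z)\<^sup>2) = (0::ennreal)" for z :: "complex ^ 'n"
        using False by (auto simp: indicator_def) (smt (verit) zero_le_power2)
      then show ?thesis using False by simp
    qed
    finally show "(\<integral>\<^sup>+z. (ennreal (norm (ip z w) ^ (2 * j)) * (ennreal (exp (- u)) * indicator {..<u} ((norm z)\<^sup>2))) \<partial>lborel)
      = ennreal (u ^ (CARD('n) + j) * exp (- u)) * indicator {0<..} u * ball_moment w j" .
  qed
  also have "\<dots> = (\<integral>\<^sup>+u. ennreal (u ^ (CARD('n) + j) * exp (- u)) * indicator {0<..} u \<partial>lborel) * ball_moment w j"
    by (rule nn_integral_multc) auto
  finally show ?thesis
    by (simp only: nn_integral_power_exp)
qed

lemma finite_measure_gauss: "finite_measure (radial gauss :: (complex ^ 'n) measure)"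
proof (rule finite_measureI)
  have "emeasure (radial gauss) (UNIV :: (complex ^ 'n) set) = (\<integral>\<^sup>+z. ennreal (norm (ip z (0 :: complex ^ 'n)) ^ (2 * 0)) \<partial>radial gauss)"
    by simp
  also have "\<dots> < \<infinity>"
    unfolding gauss_moment using ball_moment_finite[of "0 :: complex ^ 'n" 0]
    by (simp add: ennreal_mult_less_top)
       (metis ennreal_less_top ennreal_of_nat_eq_real_of_nat of_nat_fact)
  finally show "emeasure (radial gauss) (space (radial gauss) :: (complex ^ 'n) set) \<noteq> \<infinity>"
    by simp
qed

lemma integrable_exp_norm_gauss:
  "integrable (radial gauss) (\<lambda>z :: complex ^ 'n. exp (a * norm z))"
proof -
  have "(\<integral>\<^sup>+z. ennreal (exp (a * norm z)) \<partial>radial gauss :: (complex ^ 'n) measure)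
      = (\<integral>\<^sup>+z. ennreal (exp (a * norm z - (norm z)\<^sup>2)) \<partial>lborel :: (complex ^ 'n) measure)"
    by (subst nn_integral_radial) (auto simp: gauss_def ennreal_mult'[symmetric] exp_add[symmetric])
  also have "\<dots> \<le> (\<integral>\<^sup>+z. ennreal (exp (a\<^sup>2)) * ennreal (exp (- (norm ((1 / 2) *\<^sub>R z))\<^sup>2)) \<partial>lborel :: (complex ^ 'n) measure)"
  proof (rule nn_integral_mono)
    fix z :: "complex ^ 'n"
    \<comment> \<open>Completing the square absorbs the linear exponent and still leaves exp(-|z|^2
      / 4), a dilated Gaussian.\<close>
    have "0 \<le> (a - norm z / 2)\<^sup>2 + (norm z)\<^sup>2 / 2"
      by simp
    then have "a * norm z - (norm z)\<^sup>2 \<le> a\<^sup>2 - (norm ((1 / 2) *\<^sub>R z))\<^sup>2"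
      by (simp add: power2_eq_square algebra_simps)
    then show "ennreal (exp (a * norm z - (norm z)\<^sup>2)) \<le> ennreal (exp (a\<^sup>2)) * ennreal (exp (- (norm ((1 / 2) *\<^sub>R z))\<^sup>2))"
      by (simp add: ennreal_mult'[symmetric] exp_add[symmetric] del: norm_scaleR)
  qed
  also have "\<dots> = ennreal (exp (a\<^sup>2)) * (\<integral>\<^sup>+z. ennreal (exp (- (norm ((1 / 2) *\<^sub>R z))\<^sup>2)) \<partial>lborel :: (complex ^ 'n) measure)"
    by (rule nn_integral_cmult) auto
  also have "\<dots> < \<infinity>"
  proof -
    have "ennreal ((1 / 2) ^ DIM(complex ^ 'n)) * (\<integral>\<^sup>+z. ennreal (exp (- (norm ((1 / 2) *\<^sub>R z))\<^sup>2)) \<partial>lborel :: (complex ^ 'n) measure)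
       = (\<integral>\<^sup>+z. ennreal (exp (- (norm z)\<^sup>2)) \<partial>lborel :: (complex ^ 'n) measure)"
      by (rule nn_integral_lborel_scale[symmetric]) auto
    also have "\<dots> = emeasure (radial gauss) (UNIV :: (complex ^ 'n) set)"
      by (simp add: radial_def emeasure_density gauss_def)
    also have "\<dots> < \<infinity>"
      using finite_measure.emeasure_finite[OF finite_measure_gauss, of "UNIV :: (complex ^ 'n) set"]
      by (simp add: less_top)
    finally show ?thesis
      by (auto simp: ennreal_mult_less_top)
  qed
  finally show ?thesis
    by (simp add: integrable_iff_bounded measurable_cong_sets[OF sets_radial refl])
qed

lemma integrable_radial_iff:
  fixes F :: "complex ^ 'n \<Rightarrow> 'b::{banach, second_countable_topology}"
  assumes [measurable]: "v \<in> borel_measurable borel" "F \<in> borel_measurable borel" and "\<And>r. 0 \<le> v r"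
  shows "integrable (radial v) F \<longleftrightarrow> integrable lborel (\<lambda>z. v (norm z) *\<^sub>R F z)"
  unfolding radial_def by (rule integrable_density) (use assms in auto)

lemma integral_radial:
  fixes F :: "complex ^ 'n \<Rightarrow> 'b::{banach, second_countable_topology}"
  assumes [measurable]: "v \<in> borel_measurable borel" "F \<in> borel_measurable borel" and "\<And>r. 0 \<le> v r"
  shows "integral\<^sup>L (radial v) F = (\<integral>z. v (norm z) *\<^sub>R F z \<partial>lborel)"
  unfolding radial_def by (rule integral_density) (use assms in auto)

text \<open>In terms of \<open>\<zeta> = ip z w\<close>, translating the Gaussian integral of \<open>\<zeta>\<^sup>j exp (cnj \<zeta>)\<close> by \<open>w\<close> gives
  that of \<open>(\<zeta> + \<bar>w\<bar>\<^sup>2)\<^sup>j exp (-\<zeta>)\<close>, whose mean is its value at \<open>0\<close>.\<close>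

lemma gauss_moment_power:
  fixes w :: "complex ^ 'n"
  shows "(\<integral>z. norm (ip z w) ^ (2 * j) \<partial>radial gauss) = fact j * norm w ^ (2 * j) * measure (radial gauss) (UNIV :: (complex ^ 'n) set)"
proof -
  let ?M = "radial gauss :: (complex ^ 'n) measure"
  interpret M: finite_measure ?M by (rule finite_measure_gauss)
  define F where "F z = ip z w ^ j * exp (ip w z)" for z
  define G where "G z = (ip z w + of_real ((norm w)\<^sup>2)) ^ j * exp (- ip z w)" for z
  have [measurable]: "F \<in> borel_measurable borel" "G \<in> borel_measurable borel"
    by (auto simp: F_def[abs_def] G_def[abs_def])
  have nle: "norm (ip z w) \<le> norm w * norm z" "norm (ip w z) \<le> norm w * norm z" for z
    using norm_ip_le[of z w] norm_ip_le[of w z] by (simp_all add: mult.commute)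
  have pe: "x ^ j \<le> fact j * exp x" if "x \<ge> 0" for x :: real
  proof -
    have "(\<Sum>n\<in>{j}. x ^ n /\<^sub>R fact n) \<le> exp x"
      unfolding exp_def by (rule sum_le_suminf) (use that summable_exp_generic[of x] in auto)
    then show ?thesis by (simp add: divide_simps mult.commute)
  qed
  have bd: "norm (ip z w) ^ j * exp (norm (ip z w)) \<le> fact j * exp (2 * norm w * norm z)" for z
  proof -
    have "norm (ip z w) ^ j * exp (norm (ip z w)) \<le> (fact j * exp (norm (ip z w))) * exp (norm (ip z w))"
      by (intro mult_right_mono pe) auto
    also have "\<dots> = fact j * exp (2 * norm (ip z w))"
      by (simp add: exp_add[symmetric])
    also have "\<dots> \<le> fact j * exp (2 * norm w * norm z)"
      using nle[of z] by simp
    finally show ?thesis .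
  qed
  have ib: "integrable ?M (\<lambda>z. fact j * exp (2 * norm w * norm z))"
    using integrable_exp_norm_gauss[of "2 * norm w"] by simp
  have sym: "norm (ip w z) = norm (ip z w)" for z
    by (metis cnj_ip complex_mod_cnj)
  have iF: "integrable ?M F"
  proof (rule Bochner_Integration.integrable_bound[OF ib])
    show "AE z in ?M. norm (F z) \<le> norm (fact j * exp (2 * norm w * norm z) :: real)"
    proof (rule AE_I2)
      fix z
      have "norm (F z) \<le> norm (ip z w) ^ j * exp (norm (ip z w))"
        unfolding F_def norm_mult norm_power using norm_exp[of "ip w z"] by (intro mult_left_mono) (auto simp: sym)
      then show "norm (F z) \<le> norm (fact j * exp (2 * norm w * norm z) :: real)"
        using bd[of z] by simp
    qed
  qed (simp add: measurable_cong_sets[OF sets_radial refl])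
  \<comment> \<open>The coefficients of x^j and of the exponential series. Parseval then collapses
    to the single index \<open>j\<close> and expresses the integral of \<open>F\<close> as the
    moment divided by j!.\<close>
  define cc where "cc = (\<lambda>i. if i = j then (1::complex) else 0)"
  define dd where "dd = (\<lambda>i. complex_of_real (inverse (fact i)))"
  have sc: "(\<lambda>i. norm (cc i) * x ^ i) sums x ^ j" for x :: real
    using sums_single[of j "\<lambda>i. x ^ i"] by (rule back_subst[of "\<lambda>f. f sums _"]) (auto simp: cc_def)
  have sd: "(\<lambda>i. norm (dd i) * x ^ i) sums exp x" for x :: real
    using exp_converges[of x] by (simp add: dd_def norm_inverse)
  have sumc: "(\<Sum>i. cc i * x ^ i) = x ^ j" for x
  proof -
    have "(\<lambda>i. cc i * x ^ i) sums x ^ j"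
      using sums_single[of j "\<lambda>i. x ^ i"] by (rule back_subst[of "\<lambda>f. f sums _"]) (auto simp: cc_def)
    then show ?thesis by (simp add: sums_iff)
  qed
  have sumd: "(\<Sum>i. dd i * x ^ i) = exp x" for x
  proof -
    have "(\<lambda>i. dd i * x ^ i) sums exp x"
      using exp_converges[of x] by (simp add: dd_def scaleR_conv_of_real[where x = "_ :: complex"])
    then show ?thesis by (simp add: sums_iff)
  qed
  have A: "(\<lambda>i. cc i * dd i * of_real (\<integral>z. norm (ip z w) ^ (2 * i) \<partial>?M)) sums
           (\<integral>z. (\<Sum>i. cc i * ip z w ^ i) * (\<Sum>i. dd i * ip w z ^ i) \<partial>?M)"
    by (rule radial_parseval[OF borel_measurable_gauss _ _ ib])
       (use sc sd bd in \<open>auto simp: sums_iff\<close>)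
  have B: "(\<lambda>i. cc i * dd i * of_real (\<integral>z. norm (ip z w) ^ (2 * i) \<partial>?M)) sums
      (dd j * of_real (\<integral>z. norm (ip z w) ^ (2 * j) \<partial>?M))"
    using sums_single[of j "\<lambda>i. dd i * of_real (\<integral>z. norm (ip z w) ^ (2 * i) \<partial>?M)"]
    by (rule back_subst[of "\<lambda>f. f sums _"]) (auto simp: cc_def)
  have 1: "dd j * of_real (\<integral>z. norm (ip z w) ^ (2 * j) \<partial>?M) = (\<integral>z. F z \<partial>?M)"
    using sums_unique2[OF B A] unfolding sumc sumd F_def .
  \<comment> \<open>Completing the square: -|w + z|^2 + ip w (w + z) = -|z|^2 - ip z w. The Gaussian
    returns to its centre and the exponential becomes holomorphic in \<open>z\<close>.\<close>
  have trans: "gauss (norm (w + z)) *\<^sub>R F (w + z) = gauss (norm z) *\<^sub>R G z" for z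
  proof -
    have "complex_of_real ((norm (w + z))\<^sup>2) = of_real ((norm w)\<^sup>2) + of_real ((norm z)\<^sup>2) + ip z w + ip w z"
      unfolding ip_self[symmetric] by (simp add: ip_add_left ip_add_right algebra_simps)
    then have e: "- complex_of_real ((norm (w + z))\<^sup>2) + ip w (w + z) = - of_real ((norm z)\<^sup>2) - ip z w"
      by (simp add: ip_add_right ip_self)
    have gc: "complex_of_real (gauss r) = exp (- of_real (r\<^sup>2))" for r
      by (simp add: gauss_def exp_of_real[symmetric])
    have "gauss (norm (w + z)) *\<^sub>R F (w + z) = ip (w + z) w ^ j * exp (- complex_of_real ((norm (w + z))\<^sup>2) + ip w (w + z))"
      unfolding scaleR_conv_of_real gc F_def exp_add by (simp only: mult_ac)
    also have "\<dots> = (ip z w + of_real ((norm w)\<^sup>2)) ^ j * exp (- of_real ((norm z)\<^sup>2) + - ip z w)"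
      unfolding e by (simp only: ip_add_left ip_self add.commute diff_conv_add_uminus)
    also have "\<dots> = gauss (norm z) *\<^sub>R G z"
      unfolding scaleR_conv_of_real gc G_def exp_add by (simp only: mult_ac)
    finally show ?thesis .
  qed
  have g0: "0 \<le> gauss r" for r by (simp add: gauss_def)
  have "(\<integral>z. F z \<partial>?M) = (\<integral>z. gauss (norm z) *\<^sub>R F z \<partial>distr lborel borel ((+) w))"
    unfolding lborel_distr_plus by (rule integral_radial) (auto simp: g0)
  also have "\<dots> = (\<integral>z. gauss (norm z) *\<^sub>R G z \<partial>lborel)"
    by (subst integral_distr) (auto simp: trans)
  also have "\<dots> = (\<integral>z. G z \<partial>?M)"
    by (rule integral_radial[symmetric]) (auto simp: g0)
  finally have 2: "(\<integral>z. F z \<partial>?M) = (\<integral>z. G z \<partial>?M)" .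
  have iG: "integrable ?M G"
  proof -
    have "integrable (distr lborel borel ((+) w)) (\<lambda>z. gauss (norm z) *\<^sub>R F z)"
      unfolding lborel_distr_plus using iF by (subst (asm) integrable_radial_iff) (auto simp: g0)
    then have "integrable lborel (\<lambda>z. gauss (norm z) *\<^sub>R G z)"
      by (subst (asm) integrable_distr_eq) (auto simp: trans)
    then show ?thesis
      by (subst integrable_radial_iff) (auto simp: g0)
  qed
  have "(\<integral>z. G z \<partial>?M) = (\<integral>z. G (proj 0 z) \<partial>?M)"
  proof (rule rot_mean_value[OF _ iG finite_measure_gauss])
    show "continuous_on (cball 0 1) (\<lambda>c. G (rot 0 c z))" for z
      unfolding G_def by (intro continuous_intros)
    show "(\<lambda>c. G (rot 0 c z)) holomorphic_on ball 0 1" for z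
      unfolding G_def by (simp add: ip_smult_left) (intro holomorphic_intros)
  qed auto
  also have "\<dots> = of_real (norm w ^ (2 * j) * measure ?M UNIV)"
    by (simp add: G_def power_mult scaleR_conv_of_real[where x = "_ :: complex"])
  finally have "dd j * of_real (\<integral>z. norm (ip z w) ^ (2 * j) \<partial>?M) = of_real (norm w ^ (2 * j) * measure ?M UNIV)"
    using 1 2 by simp
  then have "complex_of_real (inverse (fact j) * (\<integral>z. norm (ip z w) ^ (2 * j) \<partial>?M)) = of_real (norm w ^ (2 * j) * measure ?M UNIV)"
    by (simp add: dd_def)
  then have "inverse (fact j) * (\<integral>z. norm (ip z w) ^ (2 * j) \<partial>?M) = norm w ^ (2 * j) * measure ?M UNIV"
    using of_real_eq_iff by blast
  then show ?thesis
    by (simp add: field_simps)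
qed

section \<open>The weighted measures on the ball and their moments\<close>

definition wt :: "real \<Rightarrow> real \<Rightarrow> real" where
  "wt s r = (if \<bar>r\<bar> < 1 then (1 - r\<^sup>2) powr s else 0)"

text \<open>Real exponents are required: the Hoelder argument replaces the integer \<open>k\<close>
  by a slightly smaller real. The condition \<open>s > -1\<close> in what follows guarantees finite
  mass.\<close>

abbreviation W :: "real \<Rightarrow> (complex ^ 'n) measure" where
  "W s \<equiv> radial (wt s)"

lemma wt_nonneg [simp]: "0 \<le> wt s r"
  by (simp add: wt_def)

lemma borel_measurable_wt [measurable]: "wt s \<in> borel_measurable borel"
  unfolding wt_def[abs_def] by measurable

lemma nn_integral_beta_tail:
  assumes "0 \<le> y" "y \<le> 1" "0 < m"
  shows "(\<integral>\<^sup>+u. ennreal (real m * (1 - u) ^ (m - 1)) * indicator {y<..<1} u \<partial>lborel) = ennreal ((1 - y) ^ m)"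
proof -
  have "(\<integral>\<^sup>+u. ennreal (real m * (1 - u) ^ (m - 1)) * indicator {y..1} u \<partial>lborel)
      = ennreal (- ((1 - 1) ^ m) - (- ((1 - y) ^ m)))"
    by (rule nn_integral_FTC_Icc[where F = "\<lambda>u. - ((1 - u) ^ m)"])
       (use assms in \<open>auto intro!: derivative_eq_intros\<close>)
  moreover have "(\<integral>\<^sup>+u. ennreal (real m * (1 - u) ^ (m - 1)) * indicator {y<..<1} u \<partial>lborel)
     = (\<integral>\<^sup>+u. ennreal (real m * (1 - u) ^ (m - 1)) * indicator {y..1} u \<partial>lborel)"
  proof (rule nn_integral_cong_AE)
    show "AE u in lborel. ennreal (real m * (1 - u) ^ (m - 1)) * indicator {y<..<1} u
       = ennreal (real m * (1 - u) ^ (m - 1)) * indicator {y..1} u"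
      using AE_lborel_singleton[of y] AE_lborel_singleton[of 1]
      by eventually_elim (auto split: split_indicator)
  qed
  ultimately show ?thesis
    using assms by simp
qed

text \<open>By homogeneity the part of the ball with |z|^2 < 1 - x carries the fraction (1 - x)^m of
  the moment. This fixes the tails of the image measure, and two measures on the line with equal
  finite tails coincide.\<close>

lemma distr_ball_moment:
  fixes w :: "complex ^ 'n" and j :: nat
  defines "m \<equiv> CARD('n) + j"
  shows "distr (density lborel (\<lambda>z. ennreal (norm (ip z w) ^ (2 * j)) * indicator (ball 0 1) z)) borel (\<lambda>z. 1 - (norm z)\<^sup>2)
    = density lborel (\<lambda>u. ball_moment w j * (ennreal (real m * (1 - u) ^ (m - 1)) * indicator {0<..<1} u))"
    (is "?A = ?B")
proof (rule measure_eqI_lessThan)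
  have m0: "m > 0"
    by (simp add: m_def)
  have A: "emeasure ?A {x<..} = (if x \<ge> 1 then 0 else if x \<ge> 0 then ennreal ((1 - x) ^ m) * ball_moment w j else ball_moment w j)" for x
  proof -
    have "emeasure ?A {x<..} = (\<integral>\<^sup>+z. ennreal (norm (ip z w) ^ (2 * j)) * indicator (ball 0 1) z * indicator {..<1 - x} ((norm z)\<^sup>2) \<partial>lborel)"
    proof -
      have [measurable]: "(\<lambda>z :: complex ^ 'n. 1 - (norm z)\<^sup>2) -` {x<..} \<in> sets borel"
        using measurable_sets_borel[of "\<lambda>z :: complex ^ 'n. 1 - (norm z)\<^sup>2" borel "{x<..}"] by simp
      show ?thesis
        by (subst emeasure_distr)
           (auto simp: emeasure_density intro!: nn_integral_cong split: split_indicator)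
    qed
    also have "\<dots> = (if x \<ge> 1 then 0 else if x \<ge> 0 then ennreal ((1 - x) ^ m) * ball_moment w j else ball_moment w j)"
    proof (cases "x \<ge> 1")
      case True
      then have "indicator {..<1 - x} ((norm z)\<^sup>2) = (0::ennreal)" for z :: "complex ^ 'n"
        by (auto simp: indicator_def) (smt (verit) zero_le_power2)
      then show ?thesis using True by simp
    next
      case False
      have sq: "norm z < 1 \<longleftrightarrow> (norm z)\<^sup>2 < 1" for z :: "complex ^ 'n"
        by (simp add: abs_square_less_1)
      show ?thesis
      proof (cases "x \<ge> 0")
        case True
        have "(\<integral>\<^sup>+z. ennreal (norm (ip z w) ^ (2 * j)) * indicator (ball 0 1) z * indicator {..<1 - x} ((norm z)\<^sup>2) \<partial>lborel)
          = (\<integral>\<^sup>+z. ennreal (norm (ip z w) ^ (2 * j)) * indicator {..<1 - x} ((norm z)\<^sup>2) \<partial>lborel)"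
          using True by (intro nn_integral_cong) (auto simp: sq split: split_indicator)
        then show ?thesis
          using ball_moment_scale[of "1 - x" w j] True \<open>\<not> x \<ge> 1\<close> by (simp add: m_def)
      next
        case False
        then show ?thesis
          unfolding ball_moment_def by (auto simp: sq intro!: nn_integral_cong split: split_indicator)
      qed
    qed
    finally show ?thesis .
  qed
  have B: "emeasure ?B {x<..} = (if x \<ge> 1 then 0 else if x \<ge> 0 then ennreal ((1 - x) ^ m) * ball_moment w j else ball_moment w j)" for x
  proof -
    have "emeasure ?B {x<..} = (\<integral>\<^sup>+u. ball_moment w j * (ennreal (real m * (1 - u) ^ (m - 1)) * indicator {max 0 x<..<1} u) \<partial>lborel)"
      by (auto simp: emeasure_density intro!: nn_integral_cong split: split_indicator)
    also have "\<dots> = ball_moment w j * (\<integral>\<^sup>+u. (ennreal (real m * (1 - u) ^ (m - 1)) * indicator {max 0 x<..<1} u) \<partial>lborel)"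
      by (rule nn_integral_cmult) auto
    also have "\<dots> = (if x \<ge> 1 then 0 else if x \<ge> 0 then ennreal ((1 - x) ^ m) * ball_moment w j else ball_moment w j)"
    proof (cases "x \<ge> 1")
      case False
      then show ?thesis
        using nn_integral_beta_tail[of "max 0 x" m] m0 by (auto simp: mult.commute max_def)
    qed auto
    finally show ?thesis .
  qed
  show "emeasure ?A {x<..} = emeasure ?B {x<..}" for x
    unfolding A B ..
  show "emeasure ?A {x<..} < \<infinity>" for x
    unfolding A using ball_moment_finite[of w j] by (auto simp: ennreal_mult_less_top)
qed simp_all

text \<open>The weight depends on 1 - |z|^2 only, so pushing the measure forward along this function
  reduces the integral to a one-dimensional Beta integral.\<close>

lemma nn_integral_W_power:
  fixes w :: "complex ^ 'n"
  assumes "s > -1"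
  shows "(\<integral>\<^sup>+z. ennreal (norm (ip z w) ^ (2 * j)) \<partial>W s)
    = ennreal (real (CARD('n) + j) * Beta (s + 1) (CARD('n) + j)) * ball_moment w j"
proof -
  define m where "m = CARD('n) + j"
  have m0: "m > 0" by (simp add: m_def)
  let ?A = "density lborel (\<lambda>z. ennreal (norm (ip z w) ^ (2 * j)) * indicator (ball 0 1) z)"
  have "(\<integral>\<^sup>+z. ennreal (norm (ip z w) ^ (2 * j)) \<partial>W s)
    = (\<integral>\<^sup>+z. ennreal (norm (ip z w) ^ (2 * j)) * indicator (ball 0 1) z * ennreal ((1 - (norm z)\<^sup>2) powr s) \<partial>lborel)"
    by (subst nn_integral_radial) (auto simp: wt_def mult.commute intro!: nn_integral_cong split: split_indicator)
  also have "\<dots> = (\<integral>\<^sup>+z. ennreal ((1 - (norm z)\<^sup>2) powr s) \<partial>?A)"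
    by (subst nn_integral_density) auto
  also have "\<dots> = (\<integral>\<^sup>+u. ennreal (u powr s) \<partial>distr ?A borel (\<lambda>z. 1 - (norm z)\<^sup>2))"
    by (subst nn_integral_distr) auto
  also have "\<dots> = (\<integral>\<^sup>+u. ball_moment w j * (ennreal (real m * (1 - u) ^ (m - 1)) * indicator {0<..<1} u) * ennreal (u powr s) \<partial>lborel)"
    unfolding distr_ball_moment m_def[symmetric] by (subst nn_integral_density) auto
  also have "\<dots> = (\<integral>\<^sup>+u. (ball_moment w j * ennreal (real m)) * ennreal (indicator {0..1} u * (u powr (s + 1 - 1) * (1 - u) powr (real m - 1))) \<partial>lborel)"
  proof (rule nn_integral_cong_AE)
    have p: "(1 - u) ^ (m - 1) = (1 - u) powr (real m - 1)" if "u < 1" for u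
      using that m0 by (simp add: powr_realpow[symmetric] of_nat_diff)
    show "AE u in lborel. ball_moment w j * (ennreal (real m * (1 - u) ^ (m - 1)) * indicator {0<..<1} u) * ennreal (u powr s)
       = (ball_moment w j * ennreal (real m)) * ennreal (indicator {0..1} u * (u powr (s + 1 - 1) * (1 - u) powr (real m - 1)))"
      using AE_lborel_singleton[of 0] AE_lborel_singleton[of 1]
      by eventually_elim (auto split: split_indicator simp: ennreal_mult' mult_ac p[simplified])
  qed
  also have "\<dots> = (ball_moment w j * ennreal (real m)) * (\<integral>\<^sup>+u. ennreal (indicator {0..1} u * (u powr (s + 1 - 1) * (1 - u) powr (real m - 1))) \<partial>lborel)"
    by (rule nn_integral_cmult) auto
  also have "(\<integral>\<^sup>+u. ennreal (indicator {0..1} u * (u powr (s + 1 - 1) * (1 - u) powr (real m - 1))) \<partial>lborel) = ennreal (Beta (s + 1) (real m))"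
  proof (rule nn_integral_has_integral_lborel)
    have eq: "(\<lambda>u. indicator {0..1} u * (u powr (s + 1 - 1) * (1 - u) powr (real m - 1)))
      = (\<lambda>u. if u \<in> {0..1} then u powr (s + 1 - 1) * (1 - u) powr (real m - 1) else 0)"
      by (auto simp: fun_eq_iff)
    show "((\<lambda>u. indicator {0..1} u * (u powr (s + 1 - 1) * (1 - u) powr (real m - 1))) has_integral Beta (s + 1) (real m)) UNIV"
      unfolding eq has_integral_restrict_UNIV
      by (rule has_integral_Beta_real) (use assms m0 in auto)
  qed auto
  finally show ?thesis
    by (simp add: m_def ennreal_mult' mult_ac)
qed

lemma finite_measure_W:
  assumes "s > -1"
  shows "finite_measure (W s :: (complex ^ 'n) measure)"
proof (rule finite_measureI)
  have "emeasure (W s) (UNIV :: (complex ^ 'n) set) = (\<integral>\<^sup>+z. ennreal (norm (ip z (0 :: complex ^ 'n)) ^ (2 * 0)) \<partial>W s)"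
    by simp
  also have "\<dots> < \<infinity>"
    unfolding nn_integral_W_power[OF assms] using ball_moment_finite[of "0 :: complex ^ 'n" 0]
    by (simp add: ennreal_mult_less_top)
  finally show "emeasure (W s) (space (W s) :: (complex ^ 'n) set) \<noteq> \<infinity>"
    by simp
qed

text \<open>The two evaluations of the Gaussian moments determine \<open>ball_moment\<close>.\<close>

lemma W_moment_Gamma:
  fixes w :: "complex ^ 'n"
  assumes "s > -1"
  shows "(\<integral>z. norm (ip z w) ^ (2 * j) \<partial>W s)
     = enn2real (ball_moment (0 :: complex ^ 'n) 0) * fact CARD('n) * Gamma (s + 1) * fact j
       / Gamma (real CARD('n) + 1 + s + real j) * norm w ^ (2 * j)"
proof -
  let ?n = "CARD('n)"
  define I0 where "I0 = enn2real (ball_moment (0 :: complex ^ 'n) 0)"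
  define Ij where "Ij = enn2real (ball_moment w j)"
  have int: "integral\<^sup>L M f = enn2real (\<integral>\<^sup>+z. ennreal (f z) \<partial>M)" if "f \<in> borel_measurable M" "\<And>z. 0 \<le> f z" for M :: "(complex ^ 'n) measure" and f
    using that by (intro integral_eq_nn_integral) auto
  have g: "(\<integral>z. norm (ip z w) ^ (2 * j) \<partial>radial gauss) = fact (?n + j) * enn2real (ball_moment w j)" for w :: "complex ^ 'n" and j
  proof -
    have "(\<integral>z. norm (ip z w) ^ (2 * j) \<partial>radial gauss) = enn2real (fact (?n + j) * ball_moment w j)"
      by (subst int) (auto simp: gauss_moment measurable_cong_sets[OF sets_radial refl])
    also have "\<dots> = fact (?n + j) * enn2real (ball_moment w j)"
      by (metis enn2real_ennreal enn2real_mult ennreal_of_nat_eq_real_of_nat of_nat_0_le_iff of_nat_fact)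
    finally show ?thesis .
  qed
  have "measure (radial gauss) (UNIV :: (complex ^ 'n) set) = fact ?n * I0"
    using g[of 0 0] by (simp add: I0_def)
  then have 1: "fact (?n + j) * Ij = fact j * norm w ^ (2 * j) * (fact ?n * I0)"
    using g[where w = w and j = j] gauss_moment_power[of w j] by (simp add: Ij_def)
  have "(\<integral>z. norm (ip z w) ^ (2 * j) \<partial>W s) = enn2real (ennreal (real (?n + j) * Beta (s + 1) (?n + j)) * ball_moment w j)"
    by (subst int) (auto simp: nn_integral_W_power[OF assms] measurable_cong_sets[OF sets_radial refl])
  also have "\<dots> = real (?n + j) * Beta (s + 1) (?n + j) * Ij"
  proof -
    have "0 \<le> Beta (s + 1) (real (?n + j))"
      using assms unfolding Beta_def
      by (intro divide_nonneg_nonneg mult_nonneg_nonneg less_imp_le Gamma_real_pos) (auto simp: add_pos_nonneg add_pos_pos)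
    then show ?thesis
      unfolding Ij_def enn2real_mult by (subst enn2real_ennreal) auto
  qed
  also have "real (?n + j) * Beta (s + 1) (?n + j) = Gamma (s + 1) * fact (?n + j) / Gamma (real ?n + 1 + s + real j)"
  proof -
    have "real (?n + j) * Gamma (real (?n + j)) = fact (?n + j)"
    proof -
      obtain m where m: "?n + j = Suc m"
        by (metis add_gr_0 gr0_implies_Suc zero_less_card_finite)
      show ?thesis
        unfolding m using Gamma_fact[of m, where 'a=real] by simp
    qed
    then show ?thesis
      by (simp add: Beta_def add_ac)
  qed
  also have "Gamma (s + 1) * fact (?n + j) / Gamma (real ?n + 1 + s + real j) * Ij
      = Gamma (s + 1) / Gamma (real ?n + 1 + s + real j) * (fact (?n + j) * Ij)"
    by simp
  finally show ?thesis
    unfolding 1 I0_def by simp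
qed

text \<open>The \<open>itself\<close> argument fixes the dimension, which the type of the real value
  does not record.\<close>

definition vol :: "'n::finite itself \<Rightarrow> real \<Rightarrow> real" where
  "vol _ s = measure (W s) (UNIV :: (complex ^ 'n) set)"

lemma vol_Gamma:
  assumes "s > -1"
  shows "vol TYPE('n::finite) s = enn2real (ball_moment (0 :: complex ^ 'n) 0) * fact CARD('n) * Gamma (s + 1) / Gamma (real CARD('n) + 1 + s)"
  using W_moment_Gamma[OF assms, of "0 :: complex ^ 'n" 0] by (simp add: vol_def)

lemma vol_pos:
  assumes "s > -1"
  shows "vol TYPE('n::finite) s > 0"
proof -
  have "ball_moment (0 :: complex ^ 'n) 0 = emeasure lborel (ball (0 :: complex ^ 'n) 1)"
    by (simp add: ball_moment_def)
  then have "enn2real (ball_moment (0 :: complex ^ 'n) 0) > 0"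
    using ball_moment_finite[of "0 :: complex ^ 'n" 0]
    by (simp add: emeasure_ball enn2real_positive_iff)
  then show ?thesis
    using assms by (simp add: vol_Gamma)
qed

lemma Gamma_weight_pos:
  assumes "s > -1"
  shows "Gamma (real CARD('n::finite) + 1 + s) > 0"
proof (rule Gamma_real_pos)
  have "real CARD('n) \<ge> 0" by simp
  then show "real CARD('n) + 1 + s > 0" using assms by linarith
qed

text \<open>The ratio (s + 1)/(n + 1 + s) is the mean of 1 - |z|^2 under \<open>W s\<close>
  normalised to mass 1. It tends to 1 for large \<open>s\<close>, and this decides the positivity in
  \<open>pball_volume\<close>.\<close>

lemma vol_Suc:
  assumes "s > -1"
  shows "(real CARD('n::finite) + 1 + s) * vol TYPE('n) (s + 1) = (s + 1) * vol TYPE('n) s"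
proof -
  have 1: "Gamma (s + 2) = (s + 1) * Gamma (s + 1)"
    using Gamma_plus1[of "s + 1"] assms by (auto simp: add_ac nonpos_Ints_def)
  have 2: "Gamma (real CARD('n) + 2 + s) = (real CARD('n) + 1 + s) * Gamma (real CARD('n) + 1 + s)"
    using Gamma_plus1[of "real CARD('n) + 1 + s"] assms by (auto simp: add_ac nonpos_Ints_def)
  have "Gamma (real CARD('n) + 1 + s) \<noteq> 0"
    using Gamma_weight_pos[OF assms, where 'n='n] by linarith
  moreover have "real CARD('n) + 1 + s \<noteq> 0"
    using assms by (simp add: add_nonneg_pos less_imp_neq[symmetric])
  ultimately show ?thesis
    using assms by (simp add: vol_Gamma add_ac 1 2[simplified add_ac] divide_simps)
qed

lemma W_moment:
  fixes w :: "complex ^ 'n"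
  assumes "s > -1"
  shows "(\<integral>z. norm (ip z w) ^ (2 * j) \<partial>W s)
     = vol TYPE('n) s * fact j / pochhammer (real CARD('n) + 1 + s) j * norm w ^ (2 * j)"
proof -
  let ?y = "real CARD('n) + 1 + s"
  have "?y \<notin> \<int>\<^sub>\<le>\<^sub>0"
    using assms by (auto simp: nonpos_Ints_def)
  then have "pochhammer ?y j = Gamma (?y + real j) / Gamma ?y"
    by (rule pochhammer_Gamma)
  moreover have "Gamma ?y \<noteq> 0"
    using Gamma_weight_pos[OF assms, where 'n='n] by simp
  ultimately show ?thesis
    unfolding W_moment_Gamma[OF assms] vol_Gamma[OF assms] by simp
qed

subsection \<open>Binomial kernels\<close>

lemma AE_W: "AE z in W s. norm z < 1"
  unfolding radial_def by (subst AE_density) (auto simp: wt_def intro!: AE_I2 split: if_splits)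

lemma binomial_kernel_sums:
  fixes x :: complex
  assumes "norm x < 1"
  shows "(\<lambda>j. of_real (pochhammer m j / fact j) * x ^ j) sums (1 - x) powr (- of_real m)"
proof -
  have "(\<lambda>j. ((- of_real m) gchoose j) * (- x) ^ j) sums (1 + - x) powr (- of_real m)"
    by (rule gen_binomial_complex) (use assms in simp)
  also have "(\<lambda>j. ((- of_real m) gchoose j) * (- x) ^ j) = (\<lambda>j. of_real (pochhammer m j / fact j) * x ^ j)"
    by (simp add: gbinomial_pochhammer power_minus[of x] pochhammer_of_real[symmetric] fun_eq_iff)
  finally show ?thesis by simp
qed

lemma real_binomial_kernel_sums:
  fixes x :: real
  assumes "\<bar>x\<bar> < 1"
  shows "(\<lambda>j. pochhammer m j / fact j * x ^ j) sums (1 - x) powr (- m)"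
proof -
  have "(\<lambda>j. ((- m) gchoose j) * (- x) ^ j) sums (1 + - x) powr (- m)"
    by (rule gen_binomial_real) (use assms in simp)
  also have "(\<lambda>j. ((- m) gchoose j) * (- x) ^ j) = (\<lambda>j. pochhammer m j / fact j * x ^ j)"
    by (simp add: gbinomial_pochhammer power_minus[of x] fun_eq_iff)
  finally show ?thesis by simp
qed

text \<open>Convergence at a slightly larger radius implies absolute convergence at
  \<open>x\<close>, whatever the signs of the Pochhammer symbols.\<close>

lemma binomial_kernel_summable:
  fixes x :: real
  assumes "\<bar>x\<bar> < 1"
  shows "summable (\<lambda>j. norm (complex_of_real (pochhammer m j / fact j)) * \<bar>x\<bar> ^ j)"
proof -
  obtain r where r: "\<bar>x\<bar> < r" "r < 1"
    using assms dense by blast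
  have "summable (\<lambda>j. pochhammer m j / fact j * r ^ j)"
    using real_binomial_kernel_sums[of r m] r by (simp add: sums_iff)
  then have "summable (\<lambda>j. norm (pochhammer m j / fact j * x ^ j))"
    by (rule powser_insidea) (use r in auto)
  then show ?thesis
    by (simp add: abs_mult power_abs norm_divide)
qed

lemma norm_powr_of_real:
  fixes z :: complex
  assumes "z \<noteq> 0"
  shows "norm (z powr of_real a) = norm z powr a"
  using assms by (simp add: powr_def norm_exp_eq_Re)

lemma W_parseval:
  fixes c d :: "nat \<Rightarrow> complex" and w :: "complex ^ 'n"
  assumes "s > -1" and sc: "summable (\<lambda>j. norm (c j) * norm w ^ j)" and sd: "summable (\<lambda>j. norm (d j) * norm w ^ j)"
  shows "(\<lambda>j. c j * d j * of_real (vol TYPE('n) s * fact j / pochhammer (real CARD('n) + 1 + s) j * norm w ^ (2 * j))) sums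
           (\<integral>z. (\<Sum>j. c j * ip z w ^ j) * (\<Sum>j. d j * ip w z ^ j) \<partial>W s)"
proof -
  interpret finite_measure "W s :: (complex ^ 'n) measure"
    by (rule finite_measure_W) fact
  have ip: "norm (ip z w) \<le> norm w" if "norm z < 1" for z
  proof -
    have "norm (ip z w) \<le> norm z * norm w" by (rule norm_ip_le)
    also have "\<dots> \<le> 1 * norm w" using that by (intro mult_right_mono) auto
    finally show ?thesis by simp
  qed
  have term_le: "norm (e j) * norm (ip z w) ^ j \<le> norm (e j) * norm w ^ j" if "norm z < 1" for z j and e :: "nat \<Rightarrow> complex"
    using ip[OF that] by (intro mult_left_mono power_mono) auto
  have summ: "summable (\<lambda>j. norm (e j) * norm (ip z w) ^ j)"
    if "norm z < 1" "summable (\<lambda>j. norm (e j) * norm w ^ j)" for z and e :: "nat \<Rightarrow> complex"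
    by (rule summable_comparison_test[OF _ that(2)]) (use term_le[OF that(1)] in auto)
  show ?thesis
    unfolding W_moment[OF assms(1), symmetric]
  proof (rule radial_parseval)
    show "AE z in W s. summable (\<lambda>j. norm (c j) * norm (ip z w) ^ j)"
      using AE_W by eventually_elim (rule summ[OF _ sc])
    show "AE z in W s. summable (\<lambda>j. norm (d j) * norm (ip z w) ^ j)"
      using AE_W by eventually_elim (rule summ[OF _ sd])
    show "AE z in W s. (\<Sum>j. norm (c j) * norm (ip z w) ^ j) * (\<Sum>j. norm (d j) * norm (ip z w) ^ j)
        \<le> (\<Sum>j. norm (c j) * norm w ^ j) * (\<Sum>j. norm (d j) * norm w ^ j)"
      using AE_W
    proof eventually_elim
      case (elim z)
      show ?case
        by (intro mult_mono suminf_le term_le summ suminf_nonneg sc sd elim) auto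
    qed
  qed auto
qed

lemma norm_one_minus_ip_ge: "norm z \<le> 1 \<Longrightarrow> 1 - norm w \<le> norm (1 - ip z w)"
proof -
  assume z: "norm z \<le> 1"
  have "norm (ip z w) \<le> norm z * norm w" by (rule norm_ip_le)
  also have "\<dots> \<le> 1 * norm w" using z by (intro mult_right_mono) auto
  finally show ?thesis
    using norm_triangle_ineq2[of 1 "ip z w"] by simp
qed

lemma norm_ip_lt_1: "norm z \<le> 1 \<Longrightarrow> norm w < 1 \<Longrightarrow> norm (ip z w) < 1"
proof -
  assume z: "norm z \<le> 1" "norm w < 1"
  have "norm (ip z w) \<le> norm z * norm w" by (rule norm_ip_le)
  also have "\<dots> \<le> 1 * norm w" using z by (intro mult_right_mono) auto
  finally show ?thesis using z by simp
qed

lemma norm_one_minus_ip_comm: "norm (1 - ip w z) = norm (1 - ip z w)"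
  by (metis cnj_ip complex_cnj_diff complex_cnj_one complex_mod_cnj)

lemma norm_kernel_at_le:
  fixes w z :: "complex ^ 'n"
  assumes "norm z \<le> 1" "norm w < 1"
  shows "norm (inverse ((1 - ip w z) ^ m)) \<le> inverse ((1 - norm w) ^ m)"
proof -
  have "1 - norm w \<le> norm (1 - ip w z)"
    using norm_one_minus_ip_ge[of z w] assms by (simp add: norm_one_minus_ip_comm[of w z])
  then show ?thesis
    unfolding norm_inverse norm_power using assms by (intro le_imp_inverse_le power_mono zero_less_power) auto
qed

lemma integrable_mult_kernel:
  fixes f :: "complex ^ 'n \<Rightarrow> complex"
  assumes f: "integrable (W s) f" and w: "norm w < 1"
  shows "integrable (W s) (\<lambda>z. f z * inverse ((1 - ip w z) ^ m))"
proof (rule Bochner_Integration.integrable_bound)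
  have [measurable]: "f \<in> borel_measurable borel"
    using f by (simp add: integrable_iff_bounded measurable_cong_sets[OF sets_radial refl])
  show "(\<lambda>z. f z * inverse ((1 - ip w z) ^ m)) \<in> borel_measurable (W s)"
    by (simp add: measurable_cong_sets[OF sets_radial refl])
  show "integrable (W s) (\<lambda>z. norm (f z) * inverse ((1 - norm w) ^ m))"
    using f by (intro integrable_mult_left integrable_norm)
  show "AE z in W s. norm (f z * inverse ((1 - ip w z) ^ m)) \<le> norm (norm (f z) * inverse ((1 - norm w) ^ m))"
    using AE_W
  proof eventually_elim
    case (elim z)
    have "norm (f z) * norm (inverse ((1 - ip w z) ^ m)) \<le> norm (f z) * inverse ((1 - norm w) ^ m)"
      using elim w by (intro mult_left_mono norm_kernel_at_le) auto
    moreover have "0 \<le> norm (f z) * inverse ((1 - norm w) ^ m)"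
      using w by (intro mult_nonneg_nonneg) auto
    ultimately show ?case
      by (simp only: norm_mult[of "f z" "inverse ((1 - ip w z) ^ m)"] real_norm_def abs_of_nonneg)
  qed
qed

text \<open>The integrand is (1 - ip z w)^(-m) times its conjugate; Parseval is applied to the
  binomial series of both factors. The square of the Pochhammer symbol comes from the two equal
  coefficients, its denominator from the moments.\<close>

lemma kernel_integral_sums:
  fixes w :: "complex ^ 'n"
  assumes "s > -1" "norm w < 1"
  shows "(\<lambda>j. (pochhammer m j)\<^sup>2 * vol TYPE('n) s / (fact j * pochhammer (real CARD('n) + 1 + s) j) * (norm w)\<^sup>2 ^ j) sums
           (\<integral>z. norm (1 - ip z w) powr (- 2 * m) \<partial>W s)"
proof -
  let ?c = "\<lambda>j. complex_of_real (pochhammer m j / fact j)"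
  have summ: "summable (\<lambda>j. norm (?c j) * norm w ^ j)"
    using binomial_kernel_summable[of "norm w" m] assms(2) by simp
  have "(\<integral>z. (\<Sum>j. ?c j * ip z w ^ j) * (\<Sum>j. ?c j * ip w z ^ j) \<partial>W s)
    = (\<integral>z. complex_of_real (norm (1 - ip z w) powr (- 2 * m)) \<partial>W s)"
  proof (rule integral_cong_AE)
    show "AE z in W s. (\<Sum>j. ?c j * ip z w ^ j) * (\<Sum>j. ?c j * ip w z ^ j) = complex_of_real (norm (1 - ip z w) powr (- 2 * m))"
      using AE_W
    proof eventually_elim
      case (elim z)
      have "norm (ip z w) < 1"
        using norm_ip_lt_1[of z w] elim assms(2) by simp
      then have s1: "(\<lambda>j. ?c j * ip z w ^ j) sums (1 - ip z w) powr (- of_real m)"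
        by (rule binomial_kernel_sums)
      then have "(\<lambda>j. cnj (?c j * ip z w ^ j)) sums cnj ((1 - ip z w) powr (- of_real m))"
        by (simp only: sums_cnj)
      then have s2: "(\<lambda>j. ?c j * ip w z ^ j) sums cnj ((1 - ip z w) powr (- of_real m))"
        by (simp add: cnj_ip)
      have nz: "1 - ip z w \<noteq> 0"
        using \<open>norm (ip z w) < 1\<close> by auto
      have "(\<Sum>j. ?c j * ip z w ^ j) * (\<Sum>j. ?c j * ip w z ^ j) = of_real ((norm ((1 - ip z w) powr (of_real (- m))))\<^sup>2)"
        using s1 s2 by (simp add: sums_iff complex_norm_square[symmetric] del: of_real_power)
      also have "\<dots> = of_real (norm (1 - ip z w) powr (- 2 * m))"
        unfolding norm_powr_of_real[OF nz] by (simp add: power2_eq_square powr_add[symmetric])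
      finally show ?case .
    qed
  qed (auto simp: measurable_cong_sets[OF sets_radial refl])
  then have "(\<lambda>j. ?c j * ?c j * of_real (vol TYPE('n) s * fact j / pochhammer (real CARD('n) + 1 + s) j * norm w ^ (2 * j))) sums
    of_real (\<integral>z. norm (1 - ip z w) powr (- 2 * m) \<partial>W s)"
    using W_parseval[OF assms(1) summ summ] by (simp only: integral_complex_of_real)
  then have "(\<lambda>j. of_real (pochhammer m j / fact j * (pochhammer m j / fact j) * (vol TYPE('n) s * fact j / pochhammer (real CARD('n) + 1 + s) j * norm w ^ (2 * j)))) sums
    complex_of_real (\<integral>z. norm (1 - ip z w) powr (- 2 * m) \<partial>W s)"
    by (simp only: of_real_mult)
  then have "(\<lambda>j. (pochhammer m j / fact j * (pochhammer m j / fact j) * (vol TYPE('n) s * fact j / pochhammer (real CARD('n) + 1 + s) j * norm w ^ (2 * j)))) sums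
    (\<integral>z. norm (1 - ip z w) powr (- 2 * m) \<partial>W s)"
    by (simp only: sums_of_real_iff)
  then show ?thesis
    by (rule back_subst[of "\<lambda>f. f sums _"]) (simp add: fun_eq_iff power2_eq_square power_mult power_mult_distrib)
qed

section \<open>Pochhammer inequalities and the Forelli-Rudin estimates\<close>

lemma pochhammer_eq_prod: "pochhammer a n = (\<Prod>i<n. a + of_nat i)"
  by (simp add: pochhammer_prod atLeast0LessThan)

text \<open>The inequality of arithmetic and geometric means in each factor of the products.\<close>

lemma pochhammer_mult_le:
  fixes x y :: real
  assumes "x > 0" "y > 0"
  shows "pochhammer x j * pochhammer y j \<le> (pochhammer ((x + y) / 2) j)\<^sup>2"
proof -
  have "(x + real i) * (y + real i) \<le> ((x + y) / 2 + real i)\<^sup>2" for i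
  proof -
    have "((x + y) / 2 + real i)\<^sup>2 - (x + real i) * (y + real i) = ((x - y) / 2)\<^sup>2"
      by (simp add: power2_eq_square field_simps)
    then show ?thesis by (metis diff_ge_0_iff_ge zero_le_power2)
  qed
  then show ?thesis
    unfolding pochhammer_eq_prod prod.distrib[symmetric] prod_power_distrib
    by (intro prod_mono) (use assms in auto)
qed

text \<open>The converse of \<open>pochhammer_mult_le\<close> up to a constant: the i-th factors
  have ratio 1 + a_i with a_i = O(1/i^2), so the product of the ratios stays below the exponential
  of a convergent sum.\<close>

lemma pochhammer_mult_ge:
  fixes x y :: real
  assumes "x > 0" "y > 0"
  obtains C where "C > 0" "\<And>j. (pochhammer ((x + y) / 2) j)\<^sup>2 \<le> C * (pochhammer x j * pochhammer y j)"
proof -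
  define a where "a i = ((x - y) / 2)\<^sup>2 / ((x + real i) * (y + real i))" for i :: nat
  have a0: "a i \<ge> 0" for i
    using assms by (simp add: a_def)
  have eq: "((x + y) / 2 + real i)\<^sup>2 = (1 + a i) * ((x + real i) * (y + real i))" for i
  proof -
    define p where "p = (x + real i) * (y + real i)"
    have "p \<noteq> 0"
      unfolding p_def using assms by (simp add: add_pos_nonneg less_imp_neq[symmetric])
    moreover have "a i = ((x - y) / 2)\<^sup>2 / p"
      by (simp add: a_def p_def)
    ultimately have "(1 + a i) * p = p + ((x - y) / 2)\<^sup>2"
      by (simp add: distrib_right)
    then have "(1 + a i) * ((x + real i) * (y + real i)) = (x + real i) * (y + real i) + ((x - y) / 2)\<^sup>2"
      by (simp only: p_def)
    also have "\<dots> = ((x + y) / 2 + real i)\<^sup>2"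
      by (simp add: power2_eq_square field_simps)
    finally show ?thesis by simp
  qed
  have "summable (\<lambda>i. ((x - y) / 2)\<^sup>2 * inverse (real i ^ 2))"
    by (intro summable_mult inverse_power_summable) auto
  then have "summable a"
  proof (rule summable_comparison_test[rotated], intro exI allI impI)
    fix i :: nat assume "1 \<le> i"
    then have "real i ^ 2 \<le> (x + real i) * (y + real i)"
      using assms by (auto simp: power2_eq_square intro!: mult_mono)
    then show "norm (a i) \<le> ((x - y) / 2)\<^sup>2 * inverse (real i ^ 2)"
      using \<open>1 \<le> i\<close> assms unfolding a_def divide_inverse real_norm_def abs_mult abs_inverse
      by (intro mult_mono le_imp_inverse_le) (auto simp: abs_mult)
  qed
  show ?thesis
  proof (rule that[of "exp (suminf a)"])
    fix j
    have "(pochhammer ((x + y) / 2) j)\<^sup>2 = (\<Prod>i<j. 1 + a i) * (pochhammer x j * pochhammer y j)"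
      unfolding pochhammer_eq_prod prod.distrib[symmetric] prod_power_distrib
      by (intro prod.cong refl eq)
    also have "\<dots> \<le> exp (suminf a) * (pochhammer x j * pochhammer y j)"
    proof (rule mult_right_mono)
      have "(\<Prod>i<j. 1 + a i) \<le> (\<Prod>i<j. exp (a i))"
        using a0 by (intro prod_mono) (auto simp: exp_ge_add_one_self add_nonneg_nonneg)
      also have "\<dots> = exp (\<Sum>i<j. a i)"
        by (simp add: exp_sum)
      also have "\<dots> \<le> exp (suminf a)"
        using sum_le_suminf[OF \<open>summable a\<close>] a0 by simp
      finally show "(\<Prod>i<j. 1 + a i) \<le> exp (suminf a)" .
      show "0 \<le> pochhammer x j * pochhammer y j"
        using assms by (simp add: pochhammer_nonneg)
    qed
    finally show "(pochhammer ((x + y) / 2) j)\<^sup>2 \<le> exp (suminf a) * (pochhammer x j * pochhammer y j)" .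
  qed simp
qed

lemma weight_dim_pos: "s > -1 \<Longrightarrow> real CARD('n::finite) + 1 + s > 0"
  by (smt (verit) of_nat_0_le_iff)

lemma norm_sq_less_1: "norm w < 1 \<Longrightarrow> (norm w)\<^sup>2 < (1::real)"
  by (simp add: abs_square_less_1)

text \<open>Write y = n + 1 + s. The integral is the series of \<open>kernel_integral_sums\<close>
  with m = (x + y)/2; its coefficients dominate, by \<open>pochhammer_mult_le\<close>, those of the
  binomial series of (1 - |w|^2)^(-x). The upper estimate uses the reverse inequality in the same
  way.\<close>

lemma Forelli_Rudin_lower:
  fixes w :: "complex ^ 'n"
  assumes "s > -1" "x > 0" "norm w < 1"
  shows "vol TYPE('n) s * (1 - (norm w)\<^sup>2) powr (- x) \<le> (\<integral>z. norm (1 - ip z w) powr (- (real CARD('n) + 1 + s + x)) \<partial>W s)"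
proof -
  let ?y = "real CARD('n) + 1 + s"
  have y: "?y > 0" by (rule weight_dim_pos) fact
  have half: "- 2 * ((x + ?y) / 2) = - (?y + x)" by simp
  have s1: "(\<lambda>j. (pochhammer ((x + ?y) / 2) j)\<^sup>2 * vol TYPE('n) s / (fact j * pochhammer ?y j) * (norm w)\<^sup>2 ^ j) sums
           (\<integral>z. norm (1 - ip z w) powr (- (?y + x)) \<partial>W s)"
    using kernel_integral_sums[OF assms(1,3), of "(x + ?y) / 2"] unfolding half .
  have s2: "(\<lambda>j. vol TYPE('n) s * (pochhammer x j / fact j * (norm w)\<^sup>2 ^ j)) sums (vol TYPE('n) s * (1 - (norm w)\<^sup>2) powr (- x))"
    using norm_sq_less_1[OF assms(3)] by (intro sums_mult real_binomial_kernel_sums) simp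
  show ?thesis
  proof (rule sums_le[OF _ s2 s1])
    fix j
    have pos: "pochhammer ?y j > 0"
      using y by (rule pochhammer_pos)
    have "pochhammer x j / fact j = pochhammer x j * pochhammer ?y j / (fact j * pochhammer ?y j)"
      using pos by simp
    also have "\<dots> \<le> (pochhammer ((x + ?y) / 2) j)\<^sup>2 / (fact j * pochhammer ?y j)"
      using pos pochhammer_mult_le[OF assms(2) y, of j] by (intro divide_right_mono) auto
    finally have "vol TYPE('n) s * (pochhammer x j / fact j) * (norm w)\<^sup>2 ^ j
      \<le> vol TYPE('n) s * ((pochhammer ((x + ?y) / 2) j)\<^sup>2 / (fact j * pochhammer ?y j)) * (norm w)\<^sup>2 ^ j"
      using vol_pos[OF assms(1), where 'n='n] by (intro mult_right_mono mult_left_mono) auto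
    then show "vol TYPE('n) s * (pochhammer x j / fact j * (norm w)\<^sup>2 ^ j) \<le> (pochhammer ((x + ?y) / 2) j)\<^sup>2 * vol TYPE('n) s / (fact j * pochhammer ?y j) * (norm w)\<^sup>2 ^ j"
      by (simp add: mult_ac)
  qed
qed

lemma Forelli_Rudin_upper:
  assumes "s > -1" "x > 0"
  obtains C where "C > 0" "\<And>w :: complex ^ 'n. norm w < 1 \<Longrightarrow>
    (\<integral>z. norm (1 - ip z w) powr (- (real CARD('n) + 1 + s + x)) \<partial>W s) \<le> C * (1 - (norm w)\<^sup>2) powr (- x)"
proof -
  let ?y = "real CARD('n) + 1 + s"
  have y: "?y > 0" by (rule weight_dim_pos) fact
  have half: "- 2 * ((x + ?y) / 2) = - (?y + x)" by simp
  obtain C where C: "C > 0" "\<And>j. (pochhammer ((x + ?y) / 2) j)\<^sup>2 \<le> C * (pochhammer x j * pochhammer ?y j)"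
    using pochhammer_mult_ge[OF assms(2) y] by blast
  have V: "vol TYPE('n) s > 0" by (rule vol_pos) fact
  show ?thesis
  proof (rule that[of "C * vol TYPE('n) s"])
    fix w :: "complex ^ 'n" assume w: "norm w < 1"
    have s1: "(\<lambda>j. (pochhammer ((x + ?y) / 2) j)\<^sup>2 * vol TYPE('n) s / (fact j * pochhammer ?y j) * (norm w)\<^sup>2 ^ j) sums
             (\<integral>z. norm (1 - ip z w) powr (- (?y + x)) \<partial>W s)"
      using kernel_integral_sums[OF assms(1) w, of "(x + ?y) / 2"] unfolding half .
    have s2: "(\<lambda>j. C * vol TYPE('n) s * (pochhammer x j / fact j * (norm w)\<^sup>2 ^ j)) sums (C * vol TYPE('n) s * (1 - (norm w)\<^sup>2) powr (- x))"
      using norm_sq_less_1[OF w] by (intro sums_mult real_binomial_kernel_sums) simp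
    show "(\<integral>z. norm (1 - ip z w) powr (- (?y + x)) \<partial>W s) \<le> C * vol TYPE('n) s * (1 - (norm w)\<^sup>2) powr (- x)"
    proof (rule sums_le[OF _ s1 s2])
      fix j
      have pos: "pochhammer ?y j > 0"
        using y by (rule pochhammer_pos)
      have "(pochhammer ((x + ?y) / 2) j)\<^sup>2 / (fact j * pochhammer ?y j) \<le> C * (pochhammer x j * pochhammer ?y j) / (fact j * pochhammer ?y j)"
        using pos C(2)[of j] by (intro divide_right_mono) auto
      also have "\<dots> = C * (pochhammer x j / fact j)"
        using pos by simp
      finally have "vol TYPE('n) s * ((pochhammer ((x + ?y) / 2) j)\<^sup>2 / (fact j * pochhammer ?y j)) * (norm w)\<^sup>2 ^ j
        \<le> vol TYPE('n) s * (C * (pochhammer x j / fact j)) * (norm w)\<^sup>2 ^ j"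
        using V by (intro mult_right_mono mult_left_mono) auto
      then show "(pochhammer ((x + ?y) / 2) j)\<^sup>2 * vol TYPE('n) s / (fact j * pochhammer ?y j) * (norm w)\<^sup>2 ^ j \<le> C * vol TYPE('n) s * (pochhammer x j / fact j * (norm w)\<^sup>2 ^ j)"
        by (simp add: mult_ac)
    qed
  qed (use C V in simp)
qed

text \<open>For x = y the midpoint (x + y)/2 is y itself, the Pochhammer symbols cancel, and the
  comparison of series becomes an identity.\<close>

lemma Forelli_Rudin_exact:
  fixes w :: "complex ^ 'n"
  assumes "s > -1" "norm w < 1"
  defines "y \<equiv> real CARD('n) + 1 + s"
  shows "(\<integral>z. norm (1 - ip z w) powr (- 2 * y) \<partial>W s) = vol TYPE('n) s * (1 - (norm w)\<^sup>2) powr (- y)"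
proof (rule sums_unique2)
  have "pochhammer y j > 0" for j
    unfolding y_def using weight_dim_pos[OF assms(1)] by (rule pochhammer_pos)
  then have nz: "pochhammer y j \<noteq> 0" for j
    by (metis less_irrefl)
  show "(\<lambda>j. vol TYPE('n) s * (pochhammer y j / fact j * (norm w)\<^sup>2 ^ j)) sums (vol TYPE('n) s * (1 - (norm w)\<^sup>2) powr (- y))"
    using norm_sq_less_1[OF assms(2)] by (intro sums_mult real_binomial_kernel_sums) simp
  show "(\<lambda>j. vol TYPE('n) s * (pochhammer y j / fact j * (norm w)\<^sup>2 ^ j)) sums (\<integral>z. norm (1 - ip z w) powr (- 2 * y) \<partial>W s)"
    using kernel_integral_sums[OF assms(1,2), of y, folded y_def]
    by (rule back_subst[of "\<lambda>f. f sums _"]) (simp add: fun_eq_iff power2_eq_square nz)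
qed

subsection \<open>The reproducing kernel\<close>

lemma holomorphic_several_at:
  assumes "holomorphic_several f U" "open U" "z \<in> U"
  obtains D where "(f has_derivative D) (at z)" "\<And>c v. D (c *s v) = c * D v"
  using assms at_within_open[of z U] unfolding holomorphic_several_def by metis

lemma holomorphic_several_continuous_on:
  assumes "holomorphic_several f U"
  shows "continuous_on U f"
  using assms unfolding holomorphic_several_def
  by (meson continuous_on_eq_continuous_within has_derivative_continuous)

lemma holomorphic_several_line:
  fixes f :: "complex ^ 'n \<Rightarrow> complex"
  assumes f: "holomorphic_several f U" "open U" and A: "open A" and sub: "\<And>c. c \<in> A \<Longrightarrow> a + c *s b \<in> U"
  shows "(\<lambda>c. f (a + c *s b)) holomorphic_on A"
proof -
  have "\<exists>d. ((\<lambda>c. f (a + c *s b)) has_field_derivative d) (at c)" if c: "c \<in> A" for c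
  proof -
    obtain D where D: "(f has_derivative D) (at (a + c *s b))" "\<And>c v. D (c *s v) = c * D v"
      using holomorphic_several_at[OF f sub[OF c]] by blast
    have "((\<lambda>c. a + c *s b) has_derivative (\<lambda>h. h *s b)) (at c)"
      by (auto intro!: derivative_eq_intros bounded_linear.has_derivative[OF bounded_linear_smult_left])
    from has_derivative_compose[OF this D(1)]
    have "((\<lambda>c. f (a + c *s b)) has_derivative (\<lambda>h. h * D b)) (at c)"
      by (simp add: D(2))
    moreover have "(\<lambda>h. h * D b) = (*) (D b)"
      by (auto simp: mult.commute)
    ultimately show ?thesis
      unfolding has_field_derivative_def by auto
  qed
  then show ?thesis
    using A by (auto simp: holomorphic_on_open)
qed

lemma vol_integral: "s > -1 \<Longrightarrow> (\<integral>z. c \<partial>W s :: (complex ^ 'n) measure) = of_real (vol TYPE('n) s) * (c :: complex)"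
  by (simp add: vol_def scaleR_conv_of_real[where x = "_ :: complex"])

lemma one_minus_ip_nz: "norm z < 1 \<Longrightarrow> norm w < 1 \<Longrightarrow> 1 - ip z w \<noteq> 0"
  using norm_ip_lt_1[of z w] by auto

text \<open>Rotations fixing \<open>w\<close> leave the kernel unchanged, so the mean value property
  replaces \<open>f\<close> by its values on the complex line through \<open>w\<close>. There
  \<open>f\<close> is a power series in \<open>ip z w\<close>, and Parseval against the binomial
  series of the kernel returns the value at \<open>w\<close>. The dilation makes \<open>f\<close>
  bounded on the closed ball and enlarges the radius of convergence.\<close>

lemma reproducing_dilated:
  fixes f :: "complex ^ 'n \<Rightarrow> complex" and k :: nat
  assumes f: "holomorphic_several f (ball 0 1)" and [measurable]: "f \<in> borel_measurable borel"
    and R: "0 < R" "R < 1" and w: "norm w < 1"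
  defines "N \<equiv> CARD('n) + 1 + k"
  shows "(\<integral>z. f (R *\<^sub>R z) * inverse ((1 - ip w z) ^ N) \<partial>W (real k)) = of_real (vol TYPE('n) (real k)) * f (R *\<^sub>R w)"
proof -
  let ?M = "W (real k) :: (complex ^ 'n) measure"
  have k: "real k > -1" by simp
  interpret finite_measure ?M by (rule finite_measure_W) (rule k)
  define g where "g z = f (R *\<^sub>R z) * inverse ((1 - ip w z) ^ N)" for z
  have [measurable]: "g \<in> borel_measurable borel"
    unfolding g_def by measurable
  have Rb: "R *\<^sub>R z \<in> ball 0 1" if "norm z \<le> 1" for z :: "complex ^ 'n"
    using R that by (simp add: mult_le_one le_less_trans[of "R * norm z" R] mult_left_le)
  have fcont: "continuous_on (ball 0 1) f"
    using f by (rule holomorphic_several_continuous_on)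
  have fRc: "continuous_on (cball 0 1) (\<lambda>z. f (R *\<^sub>R z))"
    by (rule continuous_on_compose2[OF fcont]) (auto intro!: continuous_intros Rb simp del: mem_ball)
  then have "compact ((\<lambda>z. f (R *\<^sub>R z)) ` cball 0 1)"
    by (intro compact_continuous_image) auto
  then have "bounded ((\<lambda>z. f (R *\<^sub>R z)) ` cball 0 1)"
    by (rule compact_imp_bounded)
  then obtain B where "\<forall>x\<in>(\<lambda>z. f (R *\<^sub>R z)) ` cball 0 1. norm x \<le> B"
    unfolding bounded_iff ..
  then have B: "norm (f (R *\<^sub>R z)) \<le> B" if "norm z \<le> 1" for z
    using that by auto
  have kb: "norm (inverse ((1 - ip w z) ^ N)) \<le> inverse ((1 - norm w) ^ N)" if "norm z \<le> 1" for z
    using that w by (rule norm_kernel_at_le)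
  have ig: "integrable ?M g"
  proof (rule integrable_const_bound)
    show "AE z in ?M. norm (g z) \<le> B * inverse ((1 - norm w) ^ N)"
      using AE_W
    proof eventually_elim
      case (elim z)
      then show ?case
        unfolding g_def norm_mult using B[of z] kb[of z] order_trans[OF norm_ge_zero B[of z]]
        by (intro mult_mono) auto
    qed
  qed (simp add: measurable_cong_sets[OF sets_radial refl])
  have "(\<integral>z. g z \<partial>?M) = (\<integral>z. g (proj w z) \<partial>?M)"
  proof (rule rot_mean_value[OF _ ig])
    fix z :: "complex ^ 'n" assume "0 < wt (real k) (norm z)"
    then have z: "norm z < 1" by (auto simp: wt_def split: if_splits)
    have ipw: "ip w (rot w c z) = ip w z" for c
      using ip_rot[of w c z] by (metis cnj_ip)
    have eq: "(\<lambda>c. g (rot w c z)) = (\<lambda>c. f (R *\<^sub>R rot w c z) * inverse ((1 - ip w z) ^ N))"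
      by (simp add: g_def ipw)
    have rb: "norm (rot w c z) \<le> 1" if "c \<in> cball 0 1" for c
      using norm_rot_le[of c w z] that z by simp
    show "continuous_on (cball 0 1) (\<lambda>c. g (rot w c z))"
      unfolding eq
      by (intro continuous_intros continuous_on_compose2[OF fRc]) (auto simp: rb)
    have "(\<lambda>c. f (R *\<^sub>R proj w z + c *s (R *\<^sub>R (z - proj w z)))) holomorphic_on ball 0 1"
    proof (rule holomorphic_several_line[OF f])
      fix c :: complex assume "c \<in> ball 0 1"
      then have "R *\<^sub>R rot w c z \<in> ball 0 1"
        by (intro Rb rb) auto
      then show "R *\<^sub>R proj w z + c *s (R *\<^sub>R (z - proj w z)) \<in> ball 0 1"
        unfolding rot_def by (simp add: scaleR_add_right scaleR_eq_smult vector_smult_assoc mult.commute del: mem_ball vector_ssub_ldistrib)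
    qed auto
    moreover have "R *\<^sub>R proj w z + c *s (R *\<^sub>R (z - proj w z)) = R *\<^sub>R rot w c z" for c
      unfolding rot_def by (simp add: scaleR_add_right scaleR_eq_smult vector_smult_assoc mult.commute del: vector_ssub_ldistrib)
    ultimately show "(\<lambda>c. g (rot w c z)) holomorphic_on ball 0 1"
      unfolding eq by (intro holomorphic_intros) simp
  qed (simp_all add: finite_measure_W)
  also have "\<dots> = of_real (vol TYPE('n) (real k)) * f (R *\<^sub>R w)"
  proof (cases "w = 0")
    case True
    then show ?thesis
      using vol_integral[OF k, where 'n='n] by (simp add: g_def)
  next
    case False
    define b where "b = (norm w)\<^sup>2"
    have b: "b > 0" using False by (simp add: b_def)
    define G where "G \<eta> = f (\<eta> *s (R *\<^sub>R w))" for \<eta> :: complex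
    \<comment> \<open>The coordinate <z, w>/|w|^2 of the projected point can approach 1/|w|. Because
      of the factor R < 1 the disc of holomorphy of \<open>G\<close> is strictly larger than
      that.\<close>
    let ?\<rho> = "1 / (R * norm w)"
    have \<rho>: "?\<rho> > 1 / norm w"
      using R False by (simp add: field_simps)
    have holG: "G holomorphic_on ball 0 ?\<rho>"
    proof -
      have "(\<lambda>\<eta>. f (0 + \<eta> *s (R *\<^sub>R w))) holomorphic_on ball 0 ?\<rho>"
      proof (rule holomorphic_several_line[OF f])
        fix \<eta> :: complex assume "\<eta> \<in> ball 0 ?\<rho>"
        then show "0 + \<eta> *s (R *\<^sub>R w) \<in> ball 0 1"
          using R False by (simp add: norm_smult field_simps)
      qed auto
      then show ?thesis by (simp add: G_def[abs_def])
    qed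
    define a where "a j = (deriv ^^ j) G 0 / fact j" for j
    have asums: "(\<lambda>j. a j * \<eta> ^ j) sums G \<eta>" if "norm \<eta> < ?\<rho>" for \<eta>
      using holomorphic_power_series[OF holG, of \<eta>] that by (simp add: a_def)
    have asumm: "summable (\<lambda>j. norm (a j) * (1 / norm w) ^ j)"
    proof -
      obtain r where r: "1 / norm w < r" "r < ?\<rho>"
        using dense \<rho> by blast
      then have r0: "r > 0" using False by (smt (verit) divide_pos_pos norm_ge_zero zero_less_norm_iff)
      have "summable (\<lambda>j. a j * of_real r ^ j)"
        using asums[of "of_real r"] r r0 by (auto simp: sums_iff)
      then have "summable (\<lambda>j. norm (a j * of_real (1 / norm w) ^ j))"
        by (rule powser_insidea) (use r r0 in \<open>auto simp: norm_divide\<close>)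
      then show ?thesis
        by (simp add: norm_mult norm_power norm_divide)
    qed
    \<comment> \<open>The Taylor coefficients in the variable \<open>ip z w\<close>, whose quotient
      by b = |w|^2 is the coordinate on the line.\<close>
    define c where "c j = a j / of_real b ^ j" for j
    let ?d = "\<lambda>j. complex_of_real (pochhammer (real N) j / fact j)"
    have sc: "summable (\<lambda>j. norm (c j) * norm w ^ j)"
    proof -
      have "norm (c j) * norm w ^ j = norm (a j) * (1 / norm w) ^ j" for j
        using False b by (simp add: c_def norm_divide norm_power norm_mult b_def power2_eq_square field_simps power_mult_distrib)
      then show ?thesis using asumm by simp
    qed
    have sd: "summable (\<lambda>j. norm (?d j) * norm w ^ j)"
      using binomial_kernel_summable[of "norm w" "real N"] w by simp
    have S0: "(\<integral>z. g (proj w z) \<partial>?M) = (\<integral>z. (\<Sum>j. c j * ip z w ^ j) * (\<Sum>j. ?d j * ip w z ^ j) \<partial>?M)"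
    proof (rule integral_cong_AE)
      show "AE z in ?M. g (proj w z) = (\<Sum>j. c j * ip z w ^ j) * (\<Sum>j. ?d j * ip w z ^ j)"
        using AE_W
      proof eventually_elim
        case (elim z)
        have ipw: "ip w (proj w z) = ip w z"
          using ip_proj[of w z] by (metis cnj_ip)
        have pe: "R *\<^sub>R proj w z = (ip z w / of_real b) *s (R *\<^sub>R w)"
          by (simp add: proj_def b_def scaleR_eq_smult vector_smult_assoc mult.commute)
        have "norm (ip z w / of_real b) \<le> 1 / norm w"
        proof -
          have "norm (ip z w) \<le> norm z * norm w" by (rule norm_ip_le)
          also have "\<dots> \<le> norm w" using elim by (simp add: mult_left_le_one_le)
          finally show ?thesis
            using False by (simp add: norm_divide norm_mult b_def power2_eq_square field_simps)
        qed
        then have "(\<lambda>j. a j * (ip z w / of_real b) ^ j) sums G (ip z w / of_real b)"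
          using \<rho> by (intro asums) simp
        then have s1: "(\<Sum>j. c j * ip z w ^ j) = G (ip z w / of_real b)"
          by (simp add: sums_iff c_def power_divide)
        have nip: "norm (ip w z) < 1"
          using norm_ip_lt_1[of z w] elim w by (metis cnj_ip complex_mod_cnj less_imp_le)
        then have "(\<lambda>j. ?d j * ip w z ^ j) sums (1 - ip w z) powr (- of_real (real N))"
          by (rule binomial_kernel_sums)
        moreover have "(1 - ip w z) powr (- of_real (real N)) = inverse ((1 - ip w z) ^ N)"
        proof -
          have "1 - ip w z \<noteq> 0" using nip by auto
          then show ?thesis
            by (simp add: powr_minus powr_nat')
        qed
        ultimately have s2: "(\<Sum>j. ?d j * ip w z ^ j) = inverse ((1 - ip w z) ^ N)"
          by (simp add: sums_iff)
        show ?case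
          unfolding s1 s2 by (simp add: g_def ipw pe G_def)
      qed
      have "proj w \<in> borel_measurable borel"
        by (rule borel_measurable_continuous_onI)
           (auto simp: rot_0[symmetric] simp del: rot_0 intro!: continuous_intros)
      then have [measurable]: "proj w \<in> borel_measurable ?M"
        by (simp add: measurable_cong_sets[OF sets_radial refl])
      show "(\<lambda>z. g (proj w z)) \<in> borel_measurable ?M"
        by measurable
    qed (simp add: measurable_cong_sets[OF sets_radial refl])
    have S1: "(\<lambda>j. of_real (vol TYPE('n) (real k)) * a j) sums
        (\<integral>z. (\<Sum>j. c j * ip z w ^ j) * (\<Sum>j. ?d j * ip w z ^ j) \<partial>?M)"
    proof -
      have pN: "pochhammer (real N) j > 0" for j
        by (rule pochhammer_pos) (simp add: N_def)
      have yN: "real CARD('n) + 1 + real k = real N"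
        by (simp add: N_def)
      \<comment> \<open>The choice N = n + 1 + k matters here: the binomial coefficient is the
        reciprocal of the Pochhammer quotient in the moment, and b^j cancels |w|^(2j). The bare
        Taylor coefficient remains.\<close>
      have "c j * ?d j * of_real (vol TYPE('n) (real k) * fact j / pochhammer (real N) j * norm w ^ (2 * j))
        = of_real (vol TYPE('n) (real k)) * a j" for j
      proof -
        have "complex_of_real (pochhammer (real N) j) \<noteq> 0" "complex_of_real b \<noteq> 0"
          using pN[of j] b by auto
        then show ?thesis
          by (simp add: c_def power_mult b_def[symmetric] divide_simps)
      qed
      then show ?thesis
        using W_parseval[OF k sc sd] unfolding yN by simp
    qed
    have S2: "(\<lambda>j. of_real (vol TYPE('n) (real k)) * a j) sums (of_real (vol TYPE('n) (real k)) * f (R *\<^sub>R w))"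
    proof -
      have "R * norm w < 1" using R w by (smt (verit) mult_left_le norm_ge_zero)
      then have "norm (1::complex) < ?\<rho>"
        using R False by (simp add: field_simps)
      from sums_mult[OF asums[OF this]] show ?thesis
        by (simp add: G_def)
    qed
    show ?thesis
      unfolding S0 by (rule sums_unique2[OF S1 S2])
  qed
  finally show ?thesis
    by (simp add: g_def)
qed

lemma integral_lborel_scale:
  fixes F :: "'a::euclidean_space \<Rightarrow> complex"
  assumes [measurable]: "F \<in> borel_measurable borel" and "c > 0"
  shows "(\<integral>z. F z \<partial>lborel) = of_real (c ^ DIM('a)) * (\<integral>z. F (c *\<^sub>R z) \<partial>lborel)"
  using assms(2)
  by (subst lborel_affine[of c 0])
     (auto simp: integral_density integral_distr scaleR_conv_of_real[where x = "_ :: complex"])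

text \<open>The limit R -> 1 in \<open>reproducing_dilated\<close>. Nothing dominates the dilated
  functions \<open>f (R z)\<close> directly, so a change of variables moves the dilation onto the
  weight and the kernel, where a multiple of |f| times the original weight dominates.\<close>

lemma reproducing:
  fixes f :: "complex ^ 'n \<Rightarrow> complex" and k :: nat
  assumes f: "holomorphic_several f (ball 0 1)" and [measurable]: "f \<in> borel_measurable borel"
    and int: "integrable (W (real k)) f" and w: "norm w < 1"
  defines "N \<equiv> CARD('n) + 1 + k"
  shows "(\<integral>z. f z * inverse ((1 - ip w z) ^ N) \<partial>W (real k)) = of_real (vol TYPE('n) (real k)) * f w"
proof -
  let ?V = "complex_of_real (vol TYPE('n) (real k))"
  define K where "K z = inverse ((1 - ip w z) ^ N)" for z
  have [measurable]: "K \<in> borel_measurable borel"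
    unfolding K_def by measurable
  define R where "R i = 1 - 1 / (real i + 2)" for i :: nat
  have R: "0 < R i" "R i < 1" for i
    by (auto simp: R_def field_simps)
  have Rlim: "R \<longlonglongrightarrow> 1"
    unfolding R_def[abs_def] by real_asymp
  \<comment> \<open>The integrand after the substitution u = R z. Its weight vanishes for |u| \<ge>
    R and elsewhere is at most the original weight, since that weight decreases in the norm.\<close>
  define h where "h i u = wt (real k) (norm u / R i) *\<^sub>R (f u * K ((1 / R i) *\<^sub>R u))" for i u
  have [measurable]: "h i \<in> borel_measurable borel" for i
    unfolding h_def by measurable
  have hi: "(\<integral>u. h i u \<partial>lborel) = of_real (R i ^ DIM(complex ^ 'n)) * (?V * f (R i *\<^sub>R w))" for i
  proof -
    have "(\<integral>u. h i u \<partial>lborel) = of_real (R i ^ DIM(complex ^ 'n)) * (\<integral>z. h i (R i *\<^sub>R z) \<partial>lborel)"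
      by (rule integral_lborel_scale) (auto simp: R)
    also have "(\<integral>z. h i (R i *\<^sub>R z) \<partial>lborel) = (\<integral>z. wt (real k) (norm z) *\<^sub>R (f (R i *\<^sub>R z) * K z) \<partial>lborel)"
      using R(1)[of i] by (intro Bochner_Integration.integral_cong) (simp_all add: h_def less_imp_neq[symmetric])
    also have "\<dots> = (\<integral>z. f (R i *\<^sub>R z) * K z \<partial>W (real k))"
      by (rule integral_radial[symmetric]) auto
    also have "\<dots> = ?V * f (R i *\<^sub>R w)"
      unfolding K_def N_def by (rule reproducing_dilated[OF f _ R w]) simp
    finally show ?thesis .
  qed
  have wN: "inverse ((1 - norm w) ^ N) > 0" using w by simp
  have Kb: "norm (K z) \<le> inverse ((1 - norm w) ^ N)" if "norm z \<le> 1" for z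
    unfolding K_def using that w by (rule norm_kernel_at_le)
  have i2: "integrable lborel (\<lambda>z. wt (real k) (norm z) *\<^sub>R f z)"
    using int by (subst (asm) integrable_radial_iff) auto
  have lim: "(\<lambda>i. \<integral>u. h i u \<partial>lborel) \<longlonglongrightarrow> (\<integral>u. wt (real k) (norm u) *\<^sub>R (f u * K u) \<partial>lborel)"
  proof (rule integral_dominated_convergence)
    show "integrable lborel (\<lambda>z. inverse ((1 - norm w) ^ N) * norm (wt (real k) (norm z) *\<^sub>R f z))"
      using i2 by (intro integrable_mult_right integrable_norm)
    show "AE u in lborel. norm (h i u) \<le> inverse ((1 - norm w) ^ N) * norm (wt (real k) (norm u) *\<^sub>R f u)" for i
    proof (rule AE_I2)
      fix u :: "complex ^ 'n"
      show "norm (h i u) \<le> inverse ((1 - norm w) ^ N) * norm (wt (real k) (norm u) *\<^sub>R f u)"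
      proof (cases "norm u / R i < 1")
        case True
        have le: "norm u \<le> norm u / R i"
          using R[of i] by (simp add: le_divide_eq mult_left_le)
        have "wt (real k) (norm u / R i) \<le> wt (real k) (norm u)"
        proof -
          have "(norm u / R i)\<^sup>2 < 1"
            using True R(1)[of i] by (simp add: abs_square_less_1)
          moreover have "(norm u)\<^sup>2 \<le> (norm u / R i)\<^sup>2"
            using le by (rule power_mono) simp
          ultimately show ?thesis
            using True le R[of i] less_trans[of "norm u" "R i" 1] by (auto simp: wt_def intro!: powr_mono2)
        qed
        moreover have "norm (K ((1 / R i) *\<^sub>R u)) \<le> inverse ((1 - norm w) ^ N)"
          using True R(1)[of i] by (intro Kb) simp
        ultimately have "wt (real k) (norm u / R i) * (norm (f u) * norm (K ((1 / R i) *\<^sub>R u))) \<le> wt (real k) (norm u) * (norm (f u) * inverse ((1 - norm w) ^ N))"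
          by (intro mult_mono) auto
        then show ?thesis
          by (simp add: h_def norm_mult mult_ac)
      next
        case False
        then have "h i u = 0"
          using R(1)[of i] by (simp add: h_def wt_def)
        then show ?thesis
          using wN by simp
      qed
    qed
    show "AE u in lborel. (\<lambda>i. h i u) \<longlonglongrightarrow> wt (real k) (norm u) *\<^sub>R (f u * K u)"
    proof (rule AE_I2)
      fix u :: "complex ^ 'n"
      show "(\<lambda>i. h i u) \<longlonglongrightarrow> wt (real k) (norm u) *\<^sub>R (f u * K u)"
      proof (cases "norm u < 1")
        case True
        have q: "(\<lambda>i. norm u / R i) \<longlonglongrightarrow> norm u / 1"
          by (intro tendsto_divide tendsto_const Rlim) simp
        then have ev: "\<forall>\<^sub>F i in sequentially. norm u / R i < 1"
          using True order_tendstoD(2)[of _ _ _ 1] by simp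
        have sq: "(norm u)\<^sup>2 < 1" using True by (rule norm_sq_less_1)
        have "(\<lambda>i. (1 - (norm u / R i)\<^sup>2) powr real k) \<longlonglongrightarrow> (1 - (norm u / 1)\<^sup>2) powr real k"
          using sq by (intro tendsto_powr tendsto_diff tendsto_const tendsto_power q) simp
        moreover have "\<forall>\<^sub>F i in sequentially. (1 - (norm u / R i)\<^sup>2) powr real k = wt (real k) (norm u / R i)"
          using ev by eventually_elim (use R in \<open>simp add: wt_def less_imp_le\<close>)
        ultimately have "(\<lambda>i. wt (real k) (norm u / R i)) \<longlonglongrightarrow> (1 - (norm u / 1)\<^sup>2) powr real k"
          by (rule Lim_transform_eventually)
        then have wl: "(\<lambda>i. wt (real k) (norm u / R i)) \<longlonglongrightarrow> wt (real k) (norm u)"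
          using True by (simp add: wt_def)
        have "(\<lambda>i. (1 / R i) *\<^sub>R u) \<longlonglongrightarrow> (1 / 1) *\<^sub>R u"
          by (intro tendsto_intros Rlim) simp
        then have "(\<lambda>i. ip w ((1 / R i) *\<^sub>R u)) \<longlonglongrightarrow> ip w u"
          using bounded_linear.tendsto[OF bounded_linear_ip_right] by fastforce
        moreover have "1 - ip w u \<noteq> 0"
          using one_minus_ip_nz[OF w True] .
        ultimately have "(\<lambda>i. K ((1 / R i) *\<^sub>R u)) \<longlonglongrightarrow> K u"
          unfolding K_def by (intro tendsto_intros) simp_all
        then show ?thesis
          unfolding h_def by (intro tendsto_intros wl)
      next
        case False
        have "1 \<le> norm u / R i" for i
          using False R[of i] by (simp add: le_divide_eq)
        then have "wt (real k) (norm u / R i) = 0" for i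
          unfolding wt_def by (metis abs_of_nonneg linorder_not_less order_trans zero_le_one)
        then have "h i u = 0" for i
          by (simp add: h_def)
        then show ?thesis
          using False by (simp add: wt_def)
      qed
    qed
  qed measurable
  have "(\<lambda>i. of_real (R i ^ DIM(complex ^ 'n)) * (?V * f (R i *\<^sub>R w))) \<longlonglongrightarrow> of_real (1 ^ DIM(complex ^ 'n)) * (?V * f (1 *\<^sub>R w))"
  proof (intro tendsto_mult tendsto_of_real tendsto_power Rlim tendsto_const)
    have "isCont f (1 *\<^sub>R w)"
      using holomorphic_several_continuous_on[OF f] w by (simp add: continuous_on_eq_continuous_at)
    then show "(\<lambda>i. f (R i *\<^sub>R w)) \<longlonglongrightarrow> f (1 *\<^sub>R w)"
      by (rule isCont_tendsto_compose) (intro tendsto_intros Rlim)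
  qed
  with lim have "(\<integral>u. wt (real k) (norm u) *\<^sub>R (f u * K u) \<partial>lborel) = ?V * f w"
    unfolding hi by (simp add: LIMSEQ_unique)
  moreover have "(\<integral>z. f z * K z \<partial>W (real k)) = (\<integral>u. wt (real k) (norm u) *\<^sub>R (f u * K u) \<partial>lborel)"
    by (rule integral_radial) auto
  ultimately show ?thesis
    by (simp add: K_def)
qed

subsection \<open>Calculus of holomorphic functions of several variables\<close>

lemma holomorphic_several_cong:
  assumes "holomorphic_several f U" "\<And>z. z \<in> U \<Longrightarrow> f z = g z"
  shows "holomorphic_several g U"
  using assms unfolding holomorphic_several_def
  by (metis (full_types) has_derivative_transform)

lemma holomorphic_several_mult:
  assumes "holomorphic_several f U" "holomorphic_several g U"
  shows "holomorphic_several (\<lambda>z. f z * g z) U"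
  unfolding holomorphic_several_def
proof
  fix z assume z: "z \<in> U"
  obtain D where D: "(f has_derivative D) (at z within U)" "\<And>c v. D (c *s v) = c * D v"
    using assms(1) z unfolding holomorphic_several_def by blast
  obtain E where E: "(g has_derivative E) (at z within U)" "\<And>c v. E (c *s v) = c * E v"
    using assms(2) z unfolding holomorphic_several_def by blast
  have "((\<lambda>z. f z * g z) has_derivative (\<lambda>h. f z * E h + D h * g z)) (at z within U)"
    by (rule has_derivative_mult[OF D(1) E(1)])
  then show "\<exists>D. ((\<lambda>z. f z * g z) has_derivative D) (at z within U) \<and> (\<forall>c v. D (c *s v) = c * D v)"
    by (intro exI conjI) (auto simp: D(2) E(2) algebra_simps)
qed

lemma holomorphic_several_compose_ip:
  assumes "\<And>z. z \<in> U \<Longrightarrow> (g has_field_derivative g' z) (at (ip z a))"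
  shows "holomorphic_several (\<lambda>z. g (ip z a)) U"
  unfolding holomorphic_several_def
proof
  fix z assume z: "z \<in> U"
  have "((\<lambda>z. ip z a) has_derivative (\<lambda>v. ip v a)) (at z within U)"
    by (rule bounded_linear.has_derivative[OF bounded_linear_ip has_derivative_ident])
  from has_derivative_compose[OF this] assms[OF z]
  have "((\<lambda>z. g (ip z a)) has_derivative (\<lambda>v. g' z * ip v a)) (at z within U)"
    unfolding has_field_derivative_def by blast
  then show "\<exists>D. ((\<lambda>z. g (ip z a)) has_derivative D) (at z within U) \<and> (\<forall>c v. D (c *s v) = c * D v)"
    by (intro exI conjI) (auto simp: ip_smult_left)
qed

lemma holomorphic_several_const: "holomorphic_several (\<lambda>z. c) U"
  unfolding holomorphic_several_def
  by (intro ballI exI[of _ "\<lambda>_. 0"]) auto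

lemma has_field_derivative_inverse_power:
  assumes "(1::complex) - x \<noteq> 0"
  shows "((\<lambda>x. inverse ((1 - x) ^ m)) has_field_derivative (of_nat m * inverse ((1 - x) ^ Suc m))) (at x within A)"
proof (cases m)
  case (Suc l)
  have "((\<lambda>x. inverse ((1 - x) ^ m)) has_field_derivative - (- (of_nat m * (1 - x) ^ (m - 1))) * inverse ((1 - x) ^ m * (1 - x) ^ m)) (at x within A)"
    using assms by (auto intro!: derivative_eq_intros simp: power2_eq_square)
  moreover have "- (- (of_nat m * (1 - x) ^ (m - 1))) * inverse ((1 - x) ^ m * (1 - x) ^ m) = of_nat m * inverse ((1 - x) ^ Suc m)"
  proof -
    have "- (- (c * u ^ (m - 1))) * inverse (u ^ m * u ^ m) = c * inverse (u ^ Suc m)" if "u \<noteq> 0" for c u :: complex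
      using that by (simp add: Suc field_simps)
    then show ?thesis using assms by blast
  qed
  ultimately show ?thesis by (simp only:)
qed simp

lemma holomorphic_several_ip_kernel:
  fixes a :: "complex ^ 'n"
  assumes "norm a < 1"
  shows "holomorphic_several (\<lambda>z. inverse ((1 - ip z a) ^ m)) (ball 0 1)"
proof (rule holomorphic_several_compose_ip, rule has_field_derivative_inverse_power)
  fix z :: "complex ^ 'n" assume "z \<in> ball 0 1"
  then show "1 - ip z a \<noteq> 0"
    using assms by (intro one_minus_ip_nz) auto
qed

lemma borel_measurable_ball_supported:
  fixes f :: "complex ^ 'n \<Rightarrow> complex"
  assumes "holomorphic_several f (ball 0 1)" "\<And>z. z \<notin> ball 0 1 \<Longrightarrow> f z = 0"
  shows "f \<in> borel_measurable borel"
proof -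
  have "(\<lambda>z. indicator (ball 0 1) z *\<^sub>R f z) \<in> borel_measurable borel"
    by (rule borel_measurable_continuous_on_indicator) (auto intro: holomorphic_several_continuous_on assms)
  also have "(\<lambda>z. indicator (ball 0 1) z *\<^sub>R f z) = f"
    using assms(2) by (auto simp: fun_eq_iff split: split_indicator)
  finally show ?thesis .
qed

text \<open>A second-order Taylor bound for \<open>(1 - \<zeta>)\<^sup>-\<^sup>N\<close>, uniform for \<open>\<bar>\<zeta>\<bar> \<le> r < 1\<close>, allows
  differentiation under the integral sign.\<close>

lemma transform_holomorphic:
  fixes F :: "complex ^ 'n \<Rightarrow> complex"
  assumes F: "integrable (W s) F"
  shows "holomorphic_several (\<lambda>w. \<integral>z. F z * inverse ((1 - ip w z) ^ N) \<partial>W s) (ball 0 1)"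
  unfolding holomorphic_several_def
proof
  fix w :: "complex ^ 'n" assume "w \<in> ball 0 1"
  then have w: "norm w < 1" by simp
  have [measurable]: "F \<in> borel_measurable borel"
    using F by (simp add: integrable_iff_bounded measurable_cong_sets[OF sets_radial refl])
  \<comment> \<open>\<open>g i\<close> is the i-th derivative of (1 - x)^(-N), in the form in which
    the Taylor estimate asks for derivatives.\<close>
  define g :: "nat \<Rightarrow> complex \<Rightarrow> complex" where
    "g i x = pochhammer (of_nat N) i * inverse ((1 - x) ^ (N + i))" for i x
  define r where "r = (1 + norm w) / 2"
  have r: "norm w < r" "r < 1" using w by (auto simp: r_def)
  have nz: "1 - x \<noteq> 0" if "x \<in> cball 0 r" for x :: complex
    using that r by auto
  have inv_bound: "norm (inverse ((1 - x) ^ m)) \<le> inverse ((1 - r) ^ m)" if "x \<in> cball 0 r" for x :: complex and m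
  proof -
    have "1 - r \<le> norm (1 - x)"
      using norm_triangle_ineq2[of 1 x] that by simp
    then show ?thesis
      using r by (simp add: norm_inverse norm_power le_imp_inverse_le power_mono)
  qed
  define B where "B i = norm (pochhammer (of_nat N) i :: complex) * inverse ((1 - r) ^ (N + i))" for i
  have gB: "norm (g i x) \<le> B i" if "x \<in> cball 0 r" for i x
    unfolding g_def B_def norm_mult using inv_bound[OF that] by (intro mult_left_mono) auto
  have B0: "B i \<ge> 0" for i
    using r by (simp add: B_def)
  have taylor: "norm (g 0 x - g 0 y - g 1 y * (x - y)) \<le> B 2 * norm (x - y) ^ 2"
    if "x \<in> cball 0 r" "y \<in> cball 0 r" for x y
  proof -
    have "cmod (g 0 x - (\<Sum>i\<le>1. g i y * (x - y) ^ i / fact i)) \<le> B 2 * cmod (x - y) ^ Suc 1 / fact 1"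
    proof (rule complex_Taylor[of "cball 0 r"])
      fix i and x :: complex assume x: "x \<in> cball 0 r"
      have "(g i has_field_derivative pochhammer (of_nat N) i * (of_nat (N + i) * inverse ((1 - x) ^ Suc (N + i)))) (at x within cball 0 r)"
        unfolding g_def[abs_def] by (intro DERIV_cmult has_field_derivative_inverse_power nz x)
      then show "(g i has_field_derivative g (Suc i) x) (at x within cball 0 r)"
        by (simp add: g_def pochhammer_Suc mult_ac)
    next
      fix x :: complex assume "x \<in> cball 0 r"
      then show "cmod (g (Suc 1) x) \<le> B 2"
        using gB[of x 2] by (simp add: numeral_2_eq_2)
    qed (use that in auto)
    then show ?thesis
      by (simp add: power2_eq_square diff_diff_eq)
  qed
  have ipr: "ip u z \<in> cball 0 r" if "norm u < r" "norm z < 1" for u z :: "complex ^ 'n"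
  proof -
    have "norm (ip u z) \<le> norm u * norm z" by (rule norm_ip_le)
    also have "\<dots> \<le> r * 1" using that r order_trans[OF norm_ge_zero less_imp_le[OF r(1)]] by (intro mult_mono) auto
    finally show ?thesis by simp
  qed
  have gm[measurable]: "(\<lambda>z. g i (ip u z)) \<in> borel_measurable borel" for i u
    unfolding g_def by measurable
  have iFg: "integrable (W s) (\<lambda>z. F z * g i (ip u z))" if "norm u < r" for i and u
  proof (rule Bochner_Integration.integrable_bound)
    show "integrable (W s) (\<lambda>z. B i * norm (F z))"
      using F by (intro integrable_mult_right integrable_norm)
    show "AE z in W s. norm (F z * g i (ip u z)) \<le> norm (B i * norm (F z))"
      using AE_W
    proof eventually_elim
      case (elim z)
      have "norm (F z) * norm (g i (ip u z)) \<le> norm (F z) * B i"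
        by (intro mult_left_mono gB ipr that elim) auto
      then show ?case
        using B0[of i] by (simp add: norm_mult mult.commute)
    qed
  qed (simp add: measurable_cong_sets[OF sets_radial refl])
  \<comment> \<open>The derivative obtained formally under the integral sign; it is complex linear
    because \<open>ip v z\<close> is complex linear in \<open>v\<close>.\<close>
  define D where "D v = (\<integral>z. (F z * g 1 (ip w z)) * ip v z \<partial>W s)" for v
  have iD: "integrable (W s) (\<lambda>z. (F z * g 1 (ip w z)) * ip v z)" for v
  proof (rule Bochner_Integration.integrable_bound)
    show "integrable (W s) (\<lambda>z. norm (F z * g 1 (ip w z)) * norm v)"
      using iFg[OF r(1), of 1] by (intro integrable_mult_left integrable_norm)
    show "AE z in W s. norm ((F z * g 1 (ip w z)) * ip v z) \<le> norm (norm (F z * g 1 (ip w z)) * norm v)"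
      using AE_W
    proof eventually_elim
      case (elim z)
      have "norm (ip v z) \<le> norm v * norm z" by (rule norm_ip_le)
      also have "\<dots> \<le> norm v" using elim by (simp add: mult_left_le)
      finally show ?case
        unfolding norm_mult by (simp add: mult_left_mono)
    qed
  qed (simp add: measurable_cong_sets[OF sets_radial refl])
  have "bounded_linear D"
  proof (rule bounded_linear_intro[of _ "\<integral>z. norm (F z * g 1 (ip w z)) \<partial>W s"])
    show "D (x + y) = D x + D y" for x y
      unfolding D_def using iD by (simp add: ip_add_left distrib_left Bochner_Integration.integral_add)
    show "D (c *\<^sub>R x) = c *\<^sub>R D x" for c x
      unfolding D_def by (simp add: ip_scaleR_left scaleR_conv_of_real[where x = "_ :: complex"] mult.left_commute[of _ "of_real c"])
    show "norm (D x) \<le> norm x * (\<integral>z. norm (F z * g 1 (ip w z)) \<partial>W s)" for x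
    proof -
      have "norm (D x) \<le> (\<integral>z. norm ((F z * g 1 (ip w z)) * ip x z) \<partial>W s)"
        unfolding D_def by (rule integral_norm_bound)
      also have "\<dots> \<le> (\<integral>z. norm x * norm (F z * g 1 (ip w z)) \<partial>W s)"
      proof (rule integral_mono_AE)
        show "AE z in W s. norm ((F z * g 1 (ip w z)) * ip x z) \<le> norm x * norm (F z * g 1 (ip w z))"
          using AE_W
        proof eventually_elim
          case (elim z)
          have "norm (ip x z) \<le> norm x * norm z" by (rule norm_ip_le)
          also have "\<dots> \<le> norm x" using elim by (simp add: mult_left_le)
          finally show ?case
            unfolding norm_mult[of _ "ip x z"] by (subst mult.commute) (simp add: mult_right_mono)
        qed
      qed (use iD iFg[OF r(1), of 1] in auto)
      finally show ?thesis by simp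
    qed
  qed
  moreover have "D (c *s v) = c * D v" for c v
    unfolding D_def by (simp add: ip_smult_left mult.left_commute[of _ c])
  moreover have "((\<lambda>w. \<integral>z. F z * inverse ((1 - ip w z) ^ N) \<partial>W s) has_derivative D) (at w within ball 0 1)"
  proof (rule has_derivativeI_sandwich[where e = "r - norm w" and H = "\<lambda>y. (B 2 * (\<integral>z. norm (F z) \<partial>W s)) * norm (y - w)"])
    fix y :: "complex ^ 'n" assume y: "y \<in> ball 0 1" "y \<noteq> w" "dist y w < r - norm w"
    then have yr: "norm y < r"
      using norm_triangle_ineq2[of y w] by (simp add: dist_norm)
    have eq: "(\<integral>z. F z * inverse ((1 - ip u z) ^ N) \<partial>W s) = (\<integral>z. F z * g 0 (ip u z) \<partial>W s)" for u
      by (simp add: g_def)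
    define E where "E z = F z * g 0 (ip y z) - F z * g 0 (ip w z) - (F z * g 1 (ip w z)) * ip (y - w) z" for z
    have iE: "integrable (W s) E"
      unfolding E_def[abs_def] by (intro Bochner_Integration.integrable_diff iFg iD yr r)
    have E_le: "norm (E z) \<le> B 2 * (norm (y - w))\<^sup>2 * norm (F z)" if z: "norm z < 1" for z
    proof -
      have "E z = F z * (g 0 (ip y z) - g 0 (ip w z) - g 1 (ip w z) * (ip y z - ip w z))"
        unfolding E_def by (simp only: ip_diff_left right_diff_distrib mult.assoc)
      then have "norm (E z) = norm (F z) * norm (g 0 (ip y z) - g 0 (ip w z) - g 1 (ip w z) * (ip y z - ip w z))"
        by (simp only: norm_mult)
      also have "\<dots> \<le> norm (F z) * (B 2 * norm (ip y z - ip w z) ^ 2)"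
        by (intro mult_left_mono taylor ipr yr r z norm_ge_zero)
      also have "\<dots> \<le> norm (F z) * (B 2 * (norm (y - w))\<^sup>2)"
      proof (intro mult_left_mono power_mono)
        have "norm (ip (y - w) z) \<le> norm (y - w) * norm z" by (rule norm_ip_le)
        also have "\<dots> \<le> norm (y - w)" using z by (simp add: mult_left_le)
        finally show "norm (ip y z - ip w z) \<le> norm (y - w)" by (simp add: ip_diff_left)
      qed (auto simp: B0)
      finally show ?thesis by (simp only: mult_ac)
    qed
    have "(\<integral>z. F z * g 0 (ip y z) \<partial>W s) - (\<integral>z. F z * g 0 (ip w z) \<partial>W s) - D (y - w) = integral\<^sup>L (W s) E"
      unfolding D_def E_def[abs_def] using iFg[OF yr, of 0] iFg[OF r(1), of 0] iD[of "y - w"]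
      by (subst Bochner_Integration.integral_diff) (auto simp: Bochner_Integration.integral_diff)
    also have "norm \<dots> \<le> (\<integral>z. norm (E z) \<partial>W s)"
      by (rule integral_norm_bound)
    also have "\<dots> \<le> (\<integral>z. B 2 * (norm (y - w))\<^sup>2 * norm (F z) \<partial>W s)"
    proof (rule integral_mono_AE)
      show "AE z in W s. norm (E z) \<le> B 2 * (norm (y - w))\<^sup>2 * norm (F z)"
        using AE_W by eventually_elim (rule E_le)
      show "integrable (W s) (\<lambda>z. norm (E z))"
        by (rule integrable_norm[OF iE])
      show "integrable (W s) (\<lambda>z. B 2 * (norm (y - w))\<^sup>2 * norm (F z))"
        by (intro integrable_mult_right integrable_norm F)
    qed
    finally show "norm ((\<integral>z. F z * inverse ((1 - ip y z) ^ N) \<partial>W s) - (\<integral>z. F z * inverse ((1 - ip w z) ^ N) \<partial>W s) - D (y - w)) / norm (y - w)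
        \<le> (B 2 * (\<integral>z. norm (F z) \<partial>W s)) * norm (y - w)"
      unfolding eq using y(2) by (simp add: divide_le_eq power2_eq_square mult_ac)
  next
    have "((\<lambda>y. B 2 * (\<integral>z. norm (F z) \<partial>W s) * norm (y - w)) \<longlongrightarrow> B 2 * (\<integral>z. norm (F z) \<partial>W s) * norm (w - w)) (at w within ball 0 1)"
      by (intro tendsto_intros)
    then show "((\<lambda>y. B 2 * (\<integral>z. norm (F z) \<partial>W s) * norm (y - w)) \<longlongrightarrow> 0) (at w within ball 0 1)"
      by simp
  qed (use r \<open>bounded_linear D\<close> in auto)
  ultimately show "\<exists>D. ((\<lambda>w. \<integral>z. F z * inverse ((1 - ip w z) ^ N) \<partial>W s) has_derivative D) (at w within ball 0 1) \<and> (\<forall>c v. D (c *s v) = c * D v)"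
    by blast
qed

section \<open>Bergman spaces and kernels in terms of the weighted measures\<close>

lemma borel_measurable_cnj [measurable]: "cnj \<in> borel_measurable borel"
  by (intro borel_measurable_continuous_onI continuous_intros)

definition ball_const :: "nat \<Rightarrow> real" where
  "ball_const k = (if k = 0 then 1 else real (k + 1) * unit_ball_vol (real (2 * (k + 1))))"

lemma ball_const_pos: "ball_const k > 0"
  by (auto simp: ball_const_def)

text \<open>Passes from a density on a restricted space to the radial density
  \<open>W (real k)\<close> on the whole space, where the invariance and moment results apply. On
  the ball the two differ only by the constant \<open>ball_const k\<close>.\<close>

lemma
  fixes g :: "complex ^ 'n \<Rightarrow> 'b::{banach, second_countable_topology}"
  assumes [measurable]: "g \<in> borel_measurable borel"
  shows integrable_ball_measure: "integrable (ball_measure k) g \<longleftrightarrow> integrable (W (real k)) g"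
    and integral_ball_measure: "integral\<^sup>L (ball_measure k) g = ball_const k *\<^sub>R integral\<^sup>L (W (real k)) g"
proof -
  let ?B = "ball (0 :: complex ^ 'n) 1"
  define \<phi> where "\<phi> z = (if k = 0 then 1 else real (k + 1) * unit_ball_vol (real (2 * (k + 1))) * (1 - (norm z)\<^sup>2) ^ k)" for z :: "complex ^ 'n"
  have [measurable]: "\<phi> \<in> borel_measurable borel"
    unfolding \<phi>_def[abs_def] by measurable
  have \<phi>_eq: "\<phi> z = ball_const k * (1 - (norm z)\<^sup>2) ^ k" for z
    by (simp add: \<phi>_def ball_const_def)
  have bm: "ball_measure k = density (restrict_space lborel ?B) (\<lambda>z. ennreal (\<phi> z))"
    unfolding ball_measure_def \<phi>_def ..
  have m1: "\<phi> \<in> borel_measurable (restrict_space lborel ?B)" "g \<in> borel_measurable (restrict_space lborel ?B)"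
    by (rule measurable_restrict_space1; simp)+
  have m2: "(\<lambda>z. \<phi> z *\<^sub>R g z) \<in> borel_measurable (restrict_space lborel ?B)"
    using m1 by (rule borel_measurable_scaleR)
  have \<phi>0: "AE z in restrict_space lborel ?B. 0 \<le> \<phi> z"
  proof (rule AE_I2)
    fix z assume "z \<in> space (restrict_space lborel ?B)"
    then have "norm z < 1" by (simp add: space_restrict_space)
    then show "0 \<le> \<phi> z"
      using norm_sq_less_1[of z] ball_const_pos[of k] by (simp add: \<phi>_eq)
  qed
  have key: "indicator ?B z *\<^sub>R (\<phi> z *\<^sub>R g z) = ball_const k *\<^sub>R (wt (real k) (norm z) *\<^sub>R g z)" for z
    using norm_sq_less_1[of z] by (auto simp: \<phi>_eq wt_def powr_realpow split: split_indicator)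
  have "integrable (ball_measure k) g \<longleftrightarrow> integrable (restrict_space lborel ?B) (\<lambda>z. \<phi> z *\<^sub>R g z)"
    unfolding bm by (rule integrable_density[OF m1(2,1) \<phi>0])
  also have "\<dots> \<longleftrightarrow> integrable lborel (\<lambda>z. indicator ?B z *\<^sub>R (\<phi> z *\<^sub>R g z))"
    by (subst integrable_restrict_space) (auto simp: set_integrable_def)
  also have "\<dots> \<longleftrightarrow> integrable lborel (\<lambda>z. wt (real k) (norm z) *\<^sub>R g z)"
    unfolding key
  proof
    assume i: "integrable lborel (\<lambda>z. ball_const k *\<^sub>R (wt (real k) (norm z) *\<^sub>R g z))"
    have "integrable lborel (\<lambda>z. inverse (ball_const k) *\<^sub>R (ball_const k *\<^sub>R (wt (real k) (norm z) *\<^sub>R g z)))"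
      by (rule integrable_scaleR_right) (rule i)
    moreover have "inverse (ball_const k) *\<^sub>R (ball_const k *\<^sub>R x) = x" for x :: 'b
      using ball_const_pos[of k] by simp
    ultimately show "integrable lborel (\<lambda>z. wt (real k) (norm z) *\<^sub>R g z)"
      by (simp only:)
  qed (rule integrable_scaleR_right)
  also have "\<dots> \<longleftrightarrow> integrable (W (real k)) g"
    by (rule integrable_radial_iff[symmetric]) auto
  finally show "integrable (ball_measure k) g \<longleftrightarrow> integrable (W (real k)) g" .
  have "integral\<^sup>L (ball_measure k) g = integral\<^sup>L (restrict_space lborel ?B) (\<lambda>z. \<phi> z *\<^sub>R g z)"
    unfolding bm by (rule integral_density[OF m1(2,1) \<phi>0])
  also have "\<dots> = (\<integral>z. indicator ?B z *\<^sub>R (\<phi> z *\<^sub>R g z) \<partial>lborel)"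
    by (subst integral_restrict_space) auto
  also have "\<dots> = ball_const k *\<^sub>R (\<integral>z. wt (real k) (norm z) *\<^sub>R g z \<partial>lborel)"
    unfolding key by (rule integral_scaleR_right)
  also have "(\<integral>z. wt (real k) (norm z) *\<^sub>R g z \<partial>lborel) = integral\<^sup>L (W (real k)) g"
    by (rule integral_radial[symmetric]) auto
  finally show "integral\<^sup>L (ball_measure k) g = ball_const k *\<^sub>R integral\<^sup>L (W (real k)) g" .
qed

lemma bergman_space_real:
  fixes f :: "complex ^ 'n \<Rightarrow> complex"
  assumes "0 \<le> p"
  shows "f \<in> bergman_space k (ennreal p) \<longleftrightarrow> holomorphic_several f (ball 0 1) \<and> (\<forall>z. z \<notin> ball 0 1 \<longrightarrow> f z = 0) \<and>
    integrable (W (real k)) (\<lambda>z. norm (f z) powr p)"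
proof -
  have "integrable (ball_measure k) (\<lambda>z. norm (f z) powr p) \<longleftrightarrow> integrable (W (real k)) (\<lambda>z. norm (f z) powr p)"
    if "holomorphic_several f (ball 0 1)" "\<forall>z. z \<notin> ball 0 1 \<longrightarrow> f z = 0"
  proof -
    have [measurable]: "f \<in> borel_measurable borel"
      using that by (intro borel_measurable_ball_supported) auto
    show ?thesis by (rule integrable_ball_measure) measurable
  qed
  then show ?thesis
    using assms unfolding bergman_space_def by auto
qed

lemma bergman_space_measurable:
  "f \<in> bergman_space k p \<Longrightarrow> f \<in> borel_measurable borel"
  unfolding bergman_space_def by (auto intro: borel_measurable_ball_supported)

lemma bergman_norm_real:
  assumes "0 \<le> p" and [measurable]: "f \<in> borel_measurable borel"
  shows "bergman_norm k (ennreal p) f = (ball_const k * (\<integral>z. norm (f z) powr p \<partial>W (real k))) powr (1 / p)"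
  using assms(1) unfolding bergman_norm_def by (subst integral_ball_measure) auto

lemma bergman_space_integrable:
  fixes f :: "complex ^ 'n \<Rightarrow> complex"
  assumes "1 \<le> p" and f: "f \<in> bergman_space k (ennreal p)"
  shows "integrable (W (real k)) f"
proof -
  interpret finite_measure "W (real k) :: (complex ^ 'n) measure"
    by (rule finite_measure_W) simp
  have [measurable]: "f \<in> borel_measurable borel"
    by (rule bergman_space_measurable[OF f])
  have i: "integrable (W (real k)) (\<lambda>z. norm (f z) powr p)"
    using assms by (simp add: bergman_space_real)
  show ?thesis
  proof (rule Bochner_Integration.integrable_bound)
    show "integrable (W (real k)) (\<lambda>z. 1 + norm (f z) powr p)"
      using i by simp
    show "AE z in W (real k). norm (f z) \<le> norm (1 + norm (f z) powr p)"
    proof (rule AE_I2)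
      fix z
      show "norm (f z) \<le> norm (1 + norm (f z) powr p)"
      proof (cases "norm (f z) \<le> 1")
        case False
        then have "norm (f z) powr 1 \<le> norm (f z) powr p"
          using assms(1) by (intro powr_mono) auto
        then show ?thesis using False by simp
      qed (simp add: add_nonneg_nonneg add_increasing2)
    qed
  qed (simp add: measurable_cong_sets[OF sets_radial refl])
qed

text \<open>Cut off outside the ball to follow the convention of \<open>bergman_space\<close>.
  Natural exponents avoid any choice of a branch.\<close>

definition ip_kernel :: "nat \<Rightarrow> complex ^ 'n \<Rightarrow> complex ^ 'n \<Rightarrow> complex" where
  "ip_kernel m a z = (if norm z < 1 then inverse ((1 - ip z a) ^ m) else 0)"

lemma holomorphic_several_kernel:
  fixes a :: "complex ^ 'n"
  assumes "norm a < 1"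
  shows "holomorphic_several (ip_kernel m a) (ball 0 1)"
  by (rule holomorphic_several_cong[OF holomorphic_several_ip_kernel[OF assms, of m]]) (simp add: ip_kernel_def)

lemma borel_measurable_kernel [measurable]: "ip_kernel m a \<in> borel_measurable borel"
  unfolding ip_kernel_def[abs_def] by measurable

lemma norm_kernel_le:
  assumes "norm a < 1"
  shows "norm (ip_kernel m a z) \<le> inverse ((1 - norm a) ^ m)"
proof (cases "norm z < 1")
  case True
  then have "1 - norm a \<le> norm (1 - ip z a)"
    by (intro norm_one_minus_ip_ge) simp
  then show ?thesis
    using assms by (simp add: ip_kernel_def norm_inverse norm_power le_imp_inverse_le power_mono)
qed (use assms in \<open>simp add: ip_kernel_def\<close>)

lemma kernel_in_bergman_space:
  fixes a :: "complex ^ 'n"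
  assumes "norm a < 1" "0 \<le> p"
  shows "(\<lambda>z. c * ip_kernel m a z) \<in> bergman_space k (ennreal p)"
  unfolding bergman_space_real[OF assms(2)]
proof (intro conjI allI impI)
  interpret finite_measure "W (real k) :: (complex ^ 'n) measure"
    by (rule finite_measure_W) simp
  show "holomorphic_several (\<lambda>z. c * ip_kernel m a z) (ball 0 1)"
    by (intro holomorphic_several_mult holomorphic_several_const holomorphic_several_kernel assms)
  show "integrable (W (real k)) (\<lambda>z. norm (c * ip_kernel m a z) powr p)"
  proof (rule integrable_const_bound)
    show "AE z in W (real k). norm (norm (c * ip_kernel m a z) powr p) \<le> (norm c * inverse ((1 - norm a) ^ m)) powr p"
      using assms by (intro AE_I2) (auto simp: norm_mult intro!: powr_mono2 mult_left_mono norm_kernel_le)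
  qed (simp add: measurable_cong_sets[OF sets_radial refl])
qed (simp add: ip_kernel_def)

text \<open>The inverse of the total mass of the ball measure: reproducing the constant function 1
  at the origin forces this value.\<close>

definition kernel_const :: "'n::finite itself \<Rightarrow> nat \<Rightarrow> real" where
  "kernel_const _ k = inverse (ball_const k * vol TYPE('n) (real k))"

lemma kernel_const_pos: "kernel_const TYPE('n::finite) k > 0"
  using ball_const_pos[of k] vol_pos[of "real k", where 'n='n] by (simp add: kernel_const_def)

lemma bergman_reproducing:
  fixes f :: "complex ^ 'n \<Rightarrow> complex"
  assumes f: "holomorphic_several f (ball 0 1)" and [measurable]: "f \<in> borel_measurable borel"
    and int: "integrable (W (real k)) f" and w: "norm w < 1"
  shows "f w = (\<integral>z. f z * cnj (of_real (kernel_const TYPE('n) k) * ip_kernel (CARD('n) + 1 + k) w z) \<partial>ball_measure k)"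
proof -
  let ?N = "CARD('n) + 1 + k"
  have "(\<integral>z. f z * cnj (of_real (kernel_const TYPE('n) k) * ip_kernel ?N w z) \<partial>ball_measure k)
    = of_real (ball_const k) * (\<integral>z. f z * cnj (of_real (kernel_const TYPE('n) k) * ip_kernel ?N w z) \<partial>W (real k))"
    by (subst integral_ball_measure) (auto simp: scaleR_conv_of_real[where x = "_ :: complex"])
  also have "(\<integral>z. f z * cnj (of_real (kernel_const TYPE('n) k) * ip_kernel ?N w z) \<partial>W (real k))
    = (\<integral>z. of_real (kernel_const TYPE('n) k) * (f z * inverse ((1 - ip w z) ^ ?N)) \<partial>W (real k))"
  proof (rule integral_cong_AE)
    show "AE z in W (real k). f z * cnj (of_real (kernel_const TYPE('n) k) * ip_kernel ?N w z) = of_real (kernel_const TYPE('n) k) * (f z * inverse ((1 - ip w z) ^ ?N))"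
      using AE_W by eventually_elim (simp add: ip_kernel_def cnj_ip)
  qed (simp_all add: measurable_cong_sets[OF sets_radial refl])
  also have "\<dots> = of_real (kernel_const TYPE('n) k) * (of_real (vol TYPE('n) (real k)) * f w)"
    by (subst integral_mult_right_zero, subst reproducing[OF f _ int w]) simp_all
  also have "of_real (ball_const k) * \<dots> = f w"
    using ball_const_pos[of k] vol_pos[of "real k", where 'n='n]
    by (simp add: kernel_const_def)
  finally show ?thesis ..
qed

text \<open>Uniqueness in the definite description: let \<open>b\<close> reproduce at
  \<open>a\<close> and let K_w be the explicit kernel. Reproducing \<open>b\<close> with K_w and
  then K_w with \<open>b\<close> gives b(w) = cnj(K_w(a)) = K_a(w).\<close>

lemma bergman_kernel_eq:
  fixes a :: "complex ^ 'n"
  assumes a: "norm a < 1"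
  shows "bergman_kernel k a = (\<lambda>z. of_real (kernel_const TYPE('n) k) * ip_kernel (CARD('n) + 1 + k) a z)"
proof -
  let ?K = "\<lambda>a z :: complex ^ 'n. of_real (kernel_const TYPE('n) k) * ip_kernel (CARD('n) + 1 + k) a z"
  have two: "(2::ennreal) = ennreal 2" by simp
  have K: "?K w \<in> bergman_space k 2" if "norm w < 1" for w
    unfolding two by (rule kernel_in_bergman_space) (use that in auto)
  have rep: "f w = (\<integral>z. f z * cnj (?K w z) \<partial>ball_measure k)" if "f \<in> bergman_space k 2" "norm w < 1" for f w
  proof (rule bergman_reproducing)
    show "integrable (W (real k)) f"
      using bergman_space_integrable[of 2 f k] that by simp
    show "f \<in> borel_measurable borel"
      using that(1) by (rule bergman_space_measurable)
  qed (use that in \<open>auto simp: bergman_space_def\<close>)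
  show ?thesis
    unfolding bergman_kernel_def
  proof (rule the_equality)
    show "?K a \<in> bergman_space k 2 \<and> (\<forall>f\<in>bergman_space k 2. f a = (\<integral>z. f z * cnj (?K a z) \<partial>ball_measure k))"
      using K rep a by blast
    fix b assume b: "b \<in> bergman_space k 2 \<and> (\<forall>f\<in>bergman_space k 2. f a = (\<integral>z. f z * cnj (b z) \<partial>ball_measure k))"
    show "b = ?K a"
    proof
      fix w
      show "b w = ?K a w"
      proof (cases "norm w < 1")
        case True
        have "b w = (\<integral>z. b z * cnj (?K w z) \<partial>ball_measure k)"
          using rep[OF _ True] b by blast
        also have "\<dots> = cnj (\<integral>z. ?K w z * cnj (b z) \<partial>ball_measure k)"
          by (simp add: Bochner_Integration.integral_cnj[symmetric] mult_ac del: Bochner_Integration.integral_cnj)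
        also have "\<dots> = cnj (?K w a)"
          using b K[OF True] by metis
        also have "\<dots> = ?K a w"
          using a True by (simp add: ip_kernel_def cnj_ip)
        finally show ?thesis .
      next
        case False
        then show ?thesis
          using b by (auto simp: bergman_space_def ip_kernel_def)
      qed
    qed
  qed
qed

subsection \<open>Norms of the kernels\<close>

text \<open>Stated with positive upper bounds \<open>F\<close> and \<open>G\<close> in place of the
  integrals themselves, so that the normalisation in Young's inequality never divides by zero.
  Young's inequality also supplies the integrable majorant.\<close>

lemma Holder_integral:
  fixes u v :: "'a \<Rightarrow> real"
  assumes [measurable]: "u \<in> borel_measurable M" "v \<in> borel_measurable M"
    and nn: "\<And>x. 0 \<le> u x" "\<And>x. 0 \<le> v x"
    and p: "1 < p" "1 < r" "1 / p + 1 / r = 1"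
    and iu: "integrable M (\<lambda>x. u x powr p)" and iv: "integrable M (\<lambda>x. v x powr r)"
    and F: "(\<integral>x. u x powr p \<partial>M) \<le> F" "0 < F" and G: "(\<integral>x. v x powr r \<partial>M) \<le> G" "0 < G"
  shows "integrable M (\<lambda>x. u x * v x)"
    and "(\<integral>x. u x * v x \<partial>M) \<le> F powr (1 / p) * G powr (1 / r)"
proof -
  define K where "K = F powr (1 / p) * G powr (1 / r)"
  have K: "K > 0" using F G by (simp add: K_def)
  define Y where "Y x = K * (u x powr p / (F * p) + v x powr r / (G * r))" for x
  have young: "u x * v x \<le> Y x" for x
  proof -
    have "u x / F powr (1 / p) * (v x / G powr (1 / r)) \<le> (u x / F powr (1 / p)) powr p / p + (v x / G powr (1 / r)) powr r / r"
      by (rule Youngs_inequality) (use p nn F G in auto)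
    also have "\<dots> = u x powr p / (F * p) + v x powr r / (G * r)"
      using p F G nn[of x] by (simp add: powr_divide powr_powr)
    finally have "K * (u x / F powr (1 / p) * (v x / G powr (1 / r))) \<le> Y x"
      unfolding Y_def using K by (intro mult_left_mono) auto
    also have "K * (u x / F powr (1 / p) * (v x / G powr (1 / r))) = u x * v x"
      using F G by (simp add: K_def)
    finally show ?thesis .
  qed
  have iY: "integrable M Y"
    unfolding Y_def[abs_def] using iu iv by (intro integrable_mult_right Bochner_Integration.integrable_add integrable_divide)
  show i: "integrable M (\<lambda>x. u x * v x)"
  proof (rule Bochner_Integration.integrable_bound[OF iY])
    show "AE x in M. norm (u x * v x) \<le> norm (Y x)"
      using young nn by (intro AE_I2) (auto intro: order_trans[OF _ abs_ge_self])
  qed simp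
  have "(\<integral>x. u x * v x \<partial>M) \<le> integral\<^sup>L M Y"
    by (rule integral_mono[OF i iY]) (rule young)
  also have "integral\<^sup>L M Y = K * ((\<integral>x. u x powr p \<partial>M) / (F * p) + (\<integral>x. v x powr r \<partial>M) / (G * r))"
    unfolding Y_def[abs_def] using iu iv by simp
  also have "\<dots> \<le> K * (F / (F * p) + G / (G * r))"
    using K F G p by (intro mult_left_mono add_mono divide_right_mono) auto
  also have "\<dots> = K"
    using p F G by simp
  finally show "(\<integral>x. u x * v x \<partial>M) \<le> F powr (1 / p) * G powr (1 / r)"
    by (simp add: K_def)
qed

lemma norm_one_minus_ip_pos:
  assumes "norm z \<le> 1" "norm w < 1"
  shows "norm (1 - ip z w) > 0"
  using norm_one_minus_ip_ge[OF assms(1), of w] assms(2) by linarith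

lemma one_minus_norm_sq:
  assumes "norm w < (1::real)"
  shows "0 < 1 - (norm w)\<^sup>2" "1 - (norm w)\<^sup>2 \<le> 2 * (1 - norm w)" "1 - (norm w)\<^sup>2 \<le> 1"
proof -
  have "1 - (norm w)\<^sup>2 = (1 - norm w) * (1 + norm w)"
    by (simp add: power2_eq_square algebra_simps)
  also have "\<dots> \<le> (1 - norm w) * 2"
    using assms by (intro mult_left_mono) auto
  finally show "1 - (norm w)\<^sup>2 \<le> 2 * (1 - norm w)" by simp
qed (use norm_sq_less_1[OF assms] in auto)

lemma integrable_ip_powr:
  fixes a :: "complex ^ 'n"
  assumes "s > -1" "norm a < 1" "0 \<le> e"
  shows "integrable (W s) (\<lambda>z. norm (1 - ip z a) powr (- e))"
proof -
  interpret finite_measure "W s :: (complex ^ 'n) measure"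
    by (rule finite_measure_W) fact
  show ?thesis
  proof (rule integrable_const_bound)
    show "AE z in W s. norm (norm (1 - ip z a) powr (- e)) \<le> (1 - norm a) powr (- e)"
      using AE_W
    proof eventually_elim
      case (elim z)
      then show ?case
        using norm_one_minus_ip_ge[of z a] assms by (simp add: powr_mono2')
    qed
  qed (simp add: measurable_cong_sets[OF sets_radial refl])
qed

lemma conj_exponent_real:
  assumes "1 < q"
  shows "conj_exponent (ennreal q) = ennreal (q / (q - 1))"
proof -
  have "1 - inverse (ennreal q) = ennreal (1 - inverse q)"
    using assms by (simp add: inverse_ennreal ennreal_1[symmetric] ennreal_minus del: ennreal_1)
  moreover have "1 - inverse q > 0"
    using assms by (simp add: inverse_less_1_iff)
  ultimately show ?thesis
    using assms by (simp add: conj_exponent_def inverse_ennreal field_simps)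
qed

lemma bergman_norm_kernel:
  fixes a :: "complex ^ 'n"
  assumes "norm a < 1" "0 < r"
  shows "bergman_norm k (ennreal r) (bergman_kernel k a) =
    (ball_const k * kernel_const TYPE('n) k powr r *
      (\<integral>z. norm (1 - ip z a) powr (- (real (CARD('n) + 1 + k) * r)) \<partial>W (real k))) powr (1 / r)"
proof -
  let ?N = "CARD('n) + 1 + k" and ?c = "kernel_const TYPE('n) k"
  have c: "?c > 0" by (rule kernel_const_pos)
  have "bergman_norm k (ennreal r) (bergman_kernel k a)
    = (ball_const k * (\<integral>z. norm (of_real ?c * ip_kernel ?N a z) powr r \<partial>W (real k))) powr (1 / r)"
    unfolding bergman_kernel_eq[OF assms(1)] using assms(2) by (subst bergman_norm_real) auto
  also have "(\<integral>z. norm (of_real ?c * ip_kernel ?N a z) powr r \<partial>W (real k))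
    = (\<integral>z. ?c powr r * norm (1 - ip z a) powr (- (real ?N * r)) \<partial>W (real k))"
  proof (rule integral_cong_AE)
    show "AE z in W (real k). norm (of_real ?c * ip_kernel ?N a z) powr r = ?c powr r * norm (1 - ip z a) powr (- (real ?N * r))"
      using AE_W
    proof eventually_elim
      case (elim z)
      have pos: "norm (1 - ip z a) > 0"
        using elim assms by (intro norm_one_minus_ip_pos) auto
      have "inverse (norm (1 - ip z a) ^ ?N) = norm (1 - ip z a) powr (- real ?N)"
        using pos by (simp only: powr_minus powr_realpow)
      then have "norm (of_real ?c * ip_kernel ?N a z) = ?c * norm (1 - ip z a) powr (- real ?N)"
        using elim c by (simp add: ip_kernel_def norm_mult norm_inverse norm_power del: of_nat_add)
      moreover have "(u * b powr (- n)) powr r = u powr r * b powr (- (n * r))" if "0 \<le> u" for u b n :: real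
        using that by (simp add: powr_mult powr_powr)
      ultimately show ?case
        using c by (simp only: less_imp_le)
    qed
  qed (simp_all add: measurable_cong_sets[OF sets_radial refl])
  finally show ?thesis by (simp add: mult_ac)
qed

text \<open>For q = 1 the conjugate exponent is infinite and the supremum is bounded through 1 -
  |a|^2 \<le> 2(1 - |a|). Otherwise put r = q'; the exponent N r exceeds N by x = N (r - 1), and
  Forelli-Rudin gives the power -x/r = -N/q.\<close>

lemma bergman_kernel_norm_upper:
  assumes "1 \<le> q"
  obtains C where "C > 0" "\<And>a :: complex ^ 'n. norm a < 1 \<Longrightarrow>
    bergman_norm k (conj_exponent (ennreal q)) (bergman_kernel k a) \<le> C * (1 - (norm a)\<^sup>2) powr (- (real (CARD('n) + 1 + k) / q))"
proof (cases "q = 1")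
  case True
  let ?N = "CARD('n) + 1 + k" and ?c = "kernel_const TYPE('n) k"
  have c: "?c > 0" by (rule kernel_const_pos)
  show ?thesis
  proof (rule that[of "?c * 2 ^ ?N"])
    fix a :: "complex ^ 'n" assume a: "norm a < 1"
    have "bergman_norm k (conj_exponent (ennreal q)) (bergman_kernel k a) = (SUP z\<in>ball 0 1. norm (bergman_kernel k a z))"
      using True by (simp add: conj_exponent_1 bergman_norm_def)
    also have "\<dots> \<le> ?c * 2 ^ ?N * (1 - (norm a)\<^sup>2) powr (- (real ?N / q))"
    proof (rule cSUP_least)
      fix z :: "complex ^ 'n" assume "z \<in> ball 0 1"
      have "norm (bergman_kernel k a z) \<le> ?c * inverse ((1 - norm a) ^ ?N)"
        unfolding bergman_kernel_eq[OF a] norm_mult using c a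
        by (intro mult_mono norm_kernel_le) auto
      also have "\<dots> \<le> ?c * (2 ^ ?N * inverse ((1 - (norm a)\<^sup>2) ^ ?N))"
      proof (intro mult_left_mono)
        have "inverse ((2 * (1 - norm a)) ^ ?N) \<le> inverse ((1 - (norm a)\<^sup>2) ^ ?N)"
          using one_minus_norm_sq[OF a] by (intro le_imp_inverse_le power_mono zero_less_power) auto
        then have "2 ^ ?N * inverse ((2 * (1 - norm a)) ^ ?N) \<le> 2 ^ ?N * inverse ((1 - (norm a)\<^sup>2) ^ ?N)"
          by (rule mult_left_mono) simp
        then show "inverse ((1 - norm a) ^ ?N) \<le> 2 ^ ?N * inverse ((1 - (norm a)\<^sup>2) ^ ?N)"
          unfolding power_mult_distrib by (simp add: mult.assoc[symmetric] del: power_Suc power_add)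
      qed (use c in simp)
      also have "inverse ((1 - (norm a)\<^sup>2) ^ ?N) = (1 - (norm a)\<^sup>2) powr (- (real ?N / q))"
        using one_minus_norm_sq(1)[OF a] True by (simp only: powr_minus powr_realpow div_by_1)
      finally show "norm (bergman_kernel k a z) \<le> ?c * 2 ^ ?N * (1 - (norm a)\<^sup>2) powr (- (real ?N / q))"
        by (simp only: mult.assoc)
    qed auto
    finally show "bergman_norm k (conj_exponent (ennreal q)) (bergman_kernel k a) \<le> ?c * 2 ^ ?N * (1 - (norm a)\<^sup>2) powr (- (real ?N / q))" .
  qed (use c in simp)
next
  case False
  let ?N = "CARD('n) + 1 + k" and ?c = "kernel_const TYPE('n) k"
  define r where "r = q / (q - 1)"
  have q: "q > 1" using assms False by simp
  have r: "r > 1" "r - 1 = r / q" using q by (auto simp: r_def field_simps)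
  define x where "x = real ?N * (r - 1)"
  have x: "x > 0" unfolding x_def using r(1) by (intro mult_pos_pos) auto
  have yx: "real CARD('n) + 1 + real k + x = real ?N * r"
    by (simp add: x_def algebra_simps)
  obtain C where C: "C > 0" "\<And>w :: complex ^ 'n. norm w < 1 \<Longrightarrow>
    (\<integral>z. norm (1 - ip z w) powr (- (real ?N * r)) \<partial>W (real k)) \<le> C * (1 - (norm w)\<^sup>2) powr (- x)"
    using Forelli_Rudin_upper[of "real k" x, where 'n = 'n] x unfolding yx by auto
  have c: "?c > 0" by (rule kernel_const_pos)
  define K where "K = ball_const k * ?c powr r"
  have K: "K > 0" using ball_const_pos[of k] c by (simp add: K_def)
  show ?thesis
  proof (rule that[of "(K * C) powr (1 / r)"])
    fix a :: "complex ^ 'n" assume a: "norm a < 1"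
    have "bergman_norm k (conj_exponent (ennreal q)) (bergman_kernel k a)
      = (K * (\<integral>z. norm (1 - ip z a) powr (- (real ?N * r)) \<partial>W (real k))) powr (1 / r)"
      using bergman_norm_kernel[OF a, of r] r by (simp add: conj_exponent_real[OF q] r_def[symmetric] K_def)
    also have "\<dots> \<le> (K * (C * (1 - (norm a)\<^sup>2) powr (- x))) powr (1 / r)"
      using K r by (intro powr_mono2 mult_left_mono C a) auto
    also have "\<dots> = (K * C) powr (1 / r) * (1 - (norm a)\<^sup>2) powr (- x / r)"
      using K C by (simp add: powr_mult powr_powr mult_ac)
    also have "- x / r = - (real ?N / q)"
      unfolding x_def r(2) using r by simp
    finally show "bergman_norm k (conj_exponent (ennreal q)) (bergman_kernel k a) \<le> (K * C) powr (1 / r) * (1 - (norm a)\<^sup>2) powr (- (real ?N / q))" .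
  qed (use K C in simp)
qed

text \<open>Lower bounds serve the dual system: its diagonal values are kernel norms, and dividing
  by them must keep the system bounded.\<close>

lemma bergman_kernel_norm_lower:
  assumes "1 < p"
  obtains c where "c > 0" "\<And>a :: complex ^ 'n. norm a < 1 \<Longrightarrow>
    c * (1 - (norm a)\<^sup>2) powr (- (real (CARD('n) + 1 + k) / p)) \<le> bergman_norm k (conj_exponent (ennreal p)) (bergman_kernel k a)"
proof -
  let ?N = "CARD('n) + 1 + k" and ?c = "kernel_const TYPE('n) k"
  define r where "r = p / (p - 1)"
  have r: "r > 1" "r - 1 = r / p" using assms by (auto simp: r_def field_simps)
  define x where "x = real ?N * (r - 1)"
  have x: "x > 0" unfolding x_def using r(1) by (intro mult_pos_pos) auto
  have yx: "real CARD('n) + 1 + real k + x = real ?N * r"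
    by (simp add: x_def algebra_simps)
  have V: "vol TYPE('n) (real k) > 0" by (rule vol_pos) simp
  have c: "?c > 0" by (rule kernel_const_pos)
  define K where "K = ball_const k * ?c powr r"
  have K: "K > 0" using ball_const_pos[of k] c by (simp add: K_def)
  show ?thesis
  proof (rule that[of "(K * vol TYPE('n) (real k)) powr (1 / r)"])
    fix a :: "complex ^ 'n" assume a: "norm a < 1"
    have "(K * vol TYPE('n) (real k)) powr (1 / r) * (1 - (norm a)\<^sup>2) powr (- x / r)
      = (K * (vol TYPE('n) (real k) * (1 - (norm a)\<^sup>2) powr (- x))) powr (1 / r)"
      using K V by (simp add: powr_mult powr_powr mult_ac)
    also have "\<dots> \<le> (K * (\<integral>z. norm (1 - ip z a) powr (- (real ?N * r)) \<partial>W (real k))) powr (1 / r)"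
      using Forelli_Rudin_lower[of "real k" x a] K r V x a unfolding yx
      by (intro powr_mono2 mult_left_mono) auto
    also have "\<dots> = bergman_norm k (conj_exponent (ennreal p)) (bergman_kernel k a)"
      using bergman_norm_kernel[OF a, of r] r by (simp add: conj_exponent_real[OF assms] r_def[symmetric] K_def)
    also have "- x / r = - (real ?N / p)"
      unfolding x_def r(2) using r by simp
    finally show "(K * vol TYPE('n) (real k)) powr (1 / r) * (1 - (norm a)\<^sup>2) powr (- (real ?N / p)) \<le> bergman_norm k (conj_exponent (ennreal p)) (bergman_kernel k a)" .
  qed (use K V in simp)
qed

text \<open>The case p' = 1. The crude estimate |1 - <z, a>| \<le> 2 bounds the integral of the
  kernel from below uniformly in \<open>a\<close>.\<close>

lemma bergman_kernel_norm_lower_1: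
  obtains c where "c > 0" "\<And>a :: complex ^ 'n. norm a < 1 \<Longrightarrow>
    c \<le> bergman_norm k (conj_exponent \<infinity>) (bergman_kernel k a)"
proof -
  let ?N = "CARD('n) + 1 + k" and ?c = "kernel_const TYPE('n) k"
  have V: "vol TYPE('n) (real k) > 0" by (rule vol_pos) simp
  have c: "?c > 0" by (rule kernel_const_pos)
  have b: "ball_const k > 0" by (rule ball_const_pos)
  interpret finite_measure "W (real k) :: (complex ^ 'n) measure"
    by (rule finite_measure_W) simp
  show ?thesis
  proof (rule that[of "ball_const k * ?c * (2 powr (- real ?N) * vol TYPE('n) (real k))"])
    fix a :: "complex ^ 'n" assume a: "norm a < 1"
    have "2 powr (- real ?N) * vol TYPE('n) (real k) = (\<integral>z. 2 powr (- real ?N) \<partial>W (real k) :: (complex ^ 'n) measure)"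
      by (simp add: vol_def)
    also have "\<dots> \<le> (\<integral>z. norm (1 - ip z a) powr (- real ?N) \<partial>W (real k))"
    proof (rule integral_mono_AE)
      show "AE z in W (real k). 2 powr (- real ?N) \<le> norm (1 - ip z a) powr (- real ?N)"
        using AE_W
      proof eventually_elim
        case (elim z)
        have "norm (1 - ip z a) \<le> 2"
          using norm_triangle_ineq4[of 1 "ip z a"] norm_ip_lt_1[of z a] elim a by simp
        then show ?case
          using norm_one_minus_ip_pos[of z a] elim a by (intro powr_mono2') auto
      qed
      show "integrable (W (real k)) (\<lambda>z. norm (1 - ip z a) powr (- real ?N))"
        using a by (intro integrable_ip_powr) auto
    qed simp
    finally have "ball_const k * ?c * (2 powr (- real ?N) * vol TYPE('n) (real k)) \<le> ball_const k * ?c * (\<integral>z. norm (1 - ip z a) powr (- real ?N) \<partial>W (real k))"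
      using b c by (intro mult_left_mono) auto
    also have "\<dots> = bergman_norm k (conj_exponent \<infinity>) (bergman_kernel k a)"
    proof -
      have "0 \<le> ball_const k * ?c * (\<integral>z. norm (1 - ip z a) powr (- real ?N) \<partial>W (real k))"
        using b c by (intro mult_nonneg_nonneg integral_nonneg_AE) auto
      then show ?thesis
        using bergman_norm_kernel[OF a, of 1 k] c by (simp add: conj_exponent_top mult.assoc del: infinity_ennreal_def)
    qed
    finally show "ball_const k * ?c * (2 powr (- real ?N) * vol TYPE('n) (real k)) \<le> bergman_norm k (conj_exponent \<infinity>) (bergman_kernel k a)" .
  qed (use b c V in simp)
qed

lemma integral_W_shift:
  fixes g :: "complex ^ 'n \<Rightarrow> real"
  assumes [measurable]: "g \<in> borel_measurable borel"
  shows "integrable (W s) (\<lambda>z. (1 - (norm z)\<^sup>2) powr t * g z) \<longleftrightarrow> integrable (W (s + t)) g"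
    and "(\<integral>z. (1 - (norm z)\<^sup>2) powr t * g z \<partial>W s) = (\<integral>z. g z \<partial>W (s + t))"
proof -
  have eq: "wt s (norm z) *\<^sub>R ((1 - (norm z)\<^sup>2) powr t * g z) = wt (s + t) (norm z) *\<^sub>R g z" for z
    by (simp add: wt_def powr_add)
  show "integrable (W s) (\<lambda>z. (1 - (norm z)\<^sup>2) powr t * g z) \<longleftrightarrow> integrable (W (s + t)) g"
    by (subst (1 2) integrable_radial_iff) (auto simp: eq simp del: real_scaleR_def)
  show "(\<integral>z. (1 - (norm z)\<^sup>2) powr t * g z \<partial>W s) = (\<integral>z. g z \<partial>W (s + t))"
    by (subst (1 2) integral_radial) (auto simp: eq simp del: real_scaleR_def)
qed

subsection \<open>Pseudohyperbolic balls\<close>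

text \<open>The ball of pseudohyperbolic radius \<open>sqrt \<delta>\<close>: for the involutive automorphism \<open>\<phi>\<^sub>a\<close> of the
  unit ball, \<open>1 - \<bar>\<phi>\<^sub>a w\<bar>\<^sup>2 = (1 - \<bar>a\<bar>\<^sup>2) (1 - \<bar>w\<bar>\<^sup>2) / \<bar>1 - ip w a\<bar>\<^sup>2\<close>.\<close>

definition pball :: "real \<Rightarrow> complex ^ 'n \<Rightarrow> (complex ^ 'n) set" where
  "pball \<delta> a = {w. norm w < 1 \<and> (1 - \<delta>) * (norm (1 - ip w a))\<^sup>2 < (1 - (norm a)\<^sup>2) * (1 - (norm w)\<^sup>2)}"

lemma pball_borel [measurable]: "pball \<delta> a \<in> sets borel"
  unfolding pball_def by measurable

text \<open>Comes from expanding |w - a|^2. It measures |1 - <w, a>| against the mean of the two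
  weights, so that \<open>pball\<close> can be analysed as a case of near equality between the two
  means.\<close>

lemma two_Re_one_minus_ip:
  "2 * Re (1 - ip w a) = (1 - (norm a)\<^sup>2) + (1 - (norm w)\<^sup>2) + (norm (w - a))\<^sup>2"
  by (simp add: Re_ip power2_norm_eq_inner inner_diff_left inner_diff_right inner_commute)

lemma one_minus_ip_ge_mean:
  "(1 - (norm a)\<^sup>2) + (1 - (norm w)\<^sup>2) \<le> 2 * norm (1 - ip w a)"
proof -
  have "(1 - (norm a)\<^sup>2) + (1 - (norm w)\<^sup>2) \<le> 2 * Re (1 - ip w a)"
    unfolding two_Re_one_minus_ip by simp
  also have "\<dots> \<le> 2 * norm (1 - ip w a)"
    using complex_Re_le_cmod[of "1 - ip w a"] by simp
  finally show ?thesis .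
qed

lemma weights_mult_le:
  assumes "norm a < 1" "norm w < 1"
  shows "(1 - (norm a)\<^sup>2) * (1 - (norm w)\<^sup>2) \<le> (norm (1 - ip w a))\<^sup>2"
proof -
  define A B where "A = 1 - (norm a)\<^sup>2" and "B = 1 - (norm w)\<^sup>2"
  have AB: "A > 0" "B > 0"
    using one_minus_norm_sq(1) assms by (auto simp: A_def B_def)
  have "(A + B) / 2 \<le> norm (1 - ip w a)"
    using one_minus_ip_ge_mean[of a w] by (simp add: A_def B_def)
  then have "((A + B) / 2)\<^sup>2 \<le> (norm (1 - ip w a))\<^sup>2"
    using AB by (intro power_mono) auto
  moreover have "A * B \<le> ((A + B) / 2)\<^sup>2"
    using zero_le_power2[of "A - B"] by (simp add: power2_eq_square field_simps)
  ultimately show ?thesis by (simp add: A_def B_def)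
qed

text \<open>Elementary substitutes for the automorphisms. With A, B the weights at a, w and X = 1 -
  <w, a>, one has AB \<le> ((A+B)/2)^2 \<le> |X|^2, and on \<open>pball\<close> these are equal up
  to a factor 1 + O(\<delta>). Hence A and B are comparable, X is close to B, and |w - a|^2 is small
  against B.\<close>

lemma
  fixes a w z :: "complex ^ 'n"
  assumes \<delta>: "0 < \<delta>" "\<delta> \<le> 1 / 2" and a: "norm a < 1" and w: "w \<in> pball \<delta> a"
  shows pball_weight_le: "1 - (norm a)\<^sup>2 \<le> 8 * (1 - (norm w)\<^sup>2)"
    and pball_close: "norm z < 1 \<Longrightarrow> norm (ip z (w - a)) \<le> 14 * sqrt \<delta> * norm (1 - ip z w)"
proof -
  define A B X where "A = 1 - (norm a)\<^sup>2" and "B = 1 - (norm w)\<^sup>2" and "X = 1 - ip w a"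
  have w1: "norm w < 1" using w by (simp add: pball_def)
  have AB: "A > 0" "B > 0"
    using one_minus_norm_sq(1) a w1 by (auto simp: A_def B_def)
  have n1: "(1 - \<delta>) * (norm X)\<^sup>2 < A * B"
    using w by (simp add: pball_def A_def B_def X_def)
  \<comment> \<open>For \<delta> \<le> 1/2 the factor 1/(1 - \<delta>) is at most 1 + 2\<delta>;
    this removes the quotient from the condition defining \<open>pball\<close>.\<close>
  have "1 \<le> (1 + 2 * \<delta>) * (1 - \<delta>)"
    using mult_left_mono[of "2 * \<delta>" 1 \<delta>] \<delta> by (simp add: algebra_simps)
  then have "1 * (norm X)\<^sup>2 \<le> (1 + 2 * \<delta>) * (1 - \<delta>) * (norm X)\<^sup>2"
    by (intro mult_right_mono) auto
  also have "\<dots> \<le> (1 + 2 * \<delta>) * (A * B)"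
    unfolding mult.assoc using n1 \<delta> by (intro mult_left_mono) auto
  finally have n2: "(norm X)\<^sup>2 \<le> (1 + 2 * \<delta>) * (A * B)" by simp
  have R: "2 * Re X = A + B + (norm (w - a))\<^sup>2"
    unfolding A_def B_def X_def by (rule two_Re_one_minus_ip)
  have X1: "A + B \<le> 2 * norm X"
    unfolding A_def B_def X_def by (rule one_minus_ip_ge_mean)
  have "(A + B)\<^sup>2 \<le> (2 * norm X)\<^sup>2"
    using AB X1 by (intro power_mono) auto
  also have "\<dots> \<le> 4 * ((1 + 2 * \<delta>) * (A * B))"
    using n2 by (simp add: power_mult_distrib)
  also have "\<dots> \<le> 4 * (2 * (A * B))"
    using \<delta> AB by (intro mult_left_mono mult_right_mono) auto
  finally have "(A + B)\<^sup>2 \<le> 8 * (A * B)" by simp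
  moreover have "A * A \<le> (A + B)\<^sup>2"
    using AB by (simp add: power2_eq_square algebra_simps)
  ultimately have "A * A \<le> A * (8 * B)" by simp
  then have A8: "A \<le> 8 * B" using AB by simp
  then show "1 - (norm a)\<^sup>2 \<le> 8 * (1 - (norm w)\<^sup>2)"
    by (simp add: A_def B_def)
  \<comment> \<open>In |X|^2 - B (2 Re X) + B^2 the bounds |X|^2 \<le> (1 + 2\<delta>) AB and 2 Re X
    \<ge> A + B cancel all but 2\<delta> AB, which is at most 16 \<delta> B^2 because A \<le>
    8B.\<close>
  have XB: "norm (X - of_real B) \<le> 4 * sqrt \<delta> * B"
  proof -
    have "(norm (X - of_real B))\<^sup>2 = (norm X)\<^sup>2 - B * (2 * Re X) + B * B"
      unfolding cmod_power2 by (simp add: power2_eq_square algebra_simps)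
    also have "\<dots> \<le> (1 + 2 * \<delta>) * (A * B) - B * (A + B) + B * B"
      using n2 AB R by (intro add_mono diff_mono mult_left_mono) auto
    also have "\<dots> = (2 * \<delta> * B) * A" by (simp add: algebra_simps)
    also have "\<dots> \<le> (2 * \<delta> * B) * (8 * B)"
      using A8 \<delta> AB by (intro mult_left_mono) auto
    also have "\<dots> = (4 * sqrt \<delta> * B)\<^sup>2"
      using \<delta> by (simp add: power_mult_distrib power2_eq_square)
    finally show ?thesis
      using \<delta> AB by (subst (asm) power2_le_iff_abs_le) auto
  qed
  \<comment> \<open>|w - a|^2 is exactly 2 Re X - (A + B), and |X| exceeds (A + B)/2 by a factor of
    at most 1 + \<delta>.\<close>
  have wa: "(norm (w - a))\<^sup>2 \<le> 9 * \<delta> * B"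
  proof -
    have "(norm X)\<^sup>2 \<le> (1 + 2 * \<delta>) * ((A + B) / 2)\<^sup>2"
    proof (rule order_trans[OF n2], rule mult_left_mono)
      show "A * B \<le> ((A + B) / 2)\<^sup>2"
        using zero_le_power2[of "A - B"] by (simp add: power2_eq_square field_simps)
    qed (use \<delta> in simp)
    also have "\<dots> \<le> (1 + \<delta>)\<^sup>2 * ((A + B) / 2)\<^sup>2"
    proof (rule mult_right_mono)
      show "1 + 2 * \<delta> \<le> (1 + \<delta>)\<^sup>2"
        by (simp add: power2_eq_square algebra_simps)
    qed simp
    also have "\<dots> = ((1 + \<delta>) * ((A + B) / 2))\<^sup>2"
      by (simp only: power_mult_distrib)
    finally have "norm X \<le> (1 + \<delta>) * ((A + B) / 2)"
      using \<delta> AB by (subst (asm) power2_le_iff_abs_le) auto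
    moreover have "(norm (w - a))\<^sup>2 \<le> 2 * norm X - (A + B)"
      using R complex_Re_le_cmod[of X] by simp
    ultimately have "(norm (w - a))\<^sup>2 \<le> \<delta> * (A + B)"
      by (simp add: algebra_simps)
    also have "\<dots> \<le> \<delta> * (9 * B)"
      using A8 \<delta> by (intro mult_left_mono) auto
    finally show ?thesis by simp
  qed
  show "norm (ip z (w - a)) \<le> 14 * sqrt \<delta> * norm (1 - ip z w)" if z: "norm z < 1"
  proof -
    define y where "y = norm (1 - ip z w)"
    have By: "B \<le> 2 * y"
      using one_minus_norm_sq(2)[OF w1] norm_one_minus_ip_ge[of z w] z by (simp add: B_def y_def)
    have "(norm (z - w))\<^sup>2 \<le> 2 * Re (1 - ip z w)"
      unfolding two_Re_one_minus_ip using one_minus_norm_sq(1)[OF z] one_minus_norm_sq(1)[OF w1] by simp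
    also have "\<dots> \<le> 2 * y"
      using complex_Re_le_cmod[of "1 - ip z w"] by (simp add: y_def)
    finally have zw: "(norm (z - w))\<^sup>2 \<le> 2 * y" .
    have "(norm (z - w) * norm (w - a))\<^sup>2 \<le> (2 * y) * (9 * \<delta> * B)"
      unfolding power_mult_distrib using zw wa by (intro mult_mono) (auto simp: y_def)
    also have "\<dots> \<le> (2 * y) * (9 * \<delta> * (2 * y))"
      using By \<delta> by (intro mult_left_mono) (auto simp: y_def)
    also have "\<dots> = (6 * sqrt \<delta> * y)\<^sup>2"
      using \<delta> by (simp add: power_mult_distrib power2_eq_square)
    finally have 1: "norm (z - w) * norm (w - a) \<le> 6 * sqrt \<delta> * y"
      using \<delta> by (subst (asm) power2_le_iff_abs_le) (auto simp: y_def)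
    \<comment> \<open>X - B equals <w, w - a>. The constant 14 is 6 from the first summand plus 4
      times 2 from the second, the 2 coming from B \<le> 2|1 - <z, w>|.\<close>
    have e: "ip z (w - a) = ip (z - w) (w - a) + (X - of_real B)"
      by (simp add: ip_diff_left ip_diff_right X_def B_def ip_self)
    have "norm (ip z (w - a)) \<le> norm (ip (z - w) (w - a)) + norm (X - of_real B)"
      unfolding e by (rule norm_triangle_ineq)
    also have "\<dots> \<le> 6 * sqrt \<delta> * y + 4 * sqrt \<delta> * B"
      using norm_ip_le[of "z - w" "w - a"] 1 XB by (intro add_mono) auto
    also have "\<dots> \<le> 6 * sqrt \<delta> * y + 4 * sqrt \<delta> * (2 * y)"
      using By \<delta> by (intro add_mono mult_left_mono) auto
    finally show ?thesis by (simp add: y_def)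
  qed
qed

text \<open>With \<open>u = (1 - \<bar>a\<bar>\<^sup>2) (1 - \<bar>w\<bar>\<^sup>2) / \<bar>1 - ip w a\<bar>\<^sup>2\<close>, the integral of \<open>u\<^sup>M (u - (1 - \<delta>))\<close>
  against the invariant measure does not depend on \<open>a\<close> by the exact Forelli-Rudin formula; it is
  positive for large \<open>M\<close>, and the integrand is at most \<open>1\<close>, and positive only on \<open>pball \<delta> a\<close>.\<close>

lemma pball_volume:
  assumes \<delta>: "0 < \<delta>" "\<delta> \<le> 1 / 2"
  obtains c where "c > 0" "\<And>a :: complex ^ 'n. norm a < 1 \<Longrightarrow>
    c * (1 - (norm a)\<^sup>2) ^ (CARD('n) + 1) \<le> measure (W 0) (pball \<delta> a)"
proof -
  let ?n = "CARD('n)"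
  \<comment> \<open>With M = n + 1 + m the mean of 1 - |z|^2 under the normalised \<open>W m\<close>
    is (m + 1)/M = 1 - n/M. It exceeds 1 - \<delta> exactly when \<delta> M > n.\<close>
  obtain M where M: "real ?n / \<delta> < real M"
    using reals_Archimedean2 by blast
  then have M1: "real ?n < \<delta> * real M"
    using \<delta> by (simp add: field_simps)
  also have "\<dots> \<le> real M" using \<delta> by (simp add: mult_left_le_one_le)
  finally have "?n < M" by simp
  then obtain m where m: "M = ?n + 1 + m"
    using less_imp_add_positive[of ?n M] by (metis Suc_eq_plus1 add.assoc add.commute gr0_implies_Suc)
  have V: "vol TYPE('n) (real m) > 0"
    by (rule vol_pos) simp
  define c0 where "c0 = vol TYPE('n) (real m + 1) - (1 - \<delta>) * vol TYPE('n) (real m)"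
  have "real M * vol TYPE('n) (real m + 1) = (real m + 1) * vol TYPE('n) (real m)"
    using vol_Suc[of "real m", where 'n = 'n] by (simp add: m add_ac)
  moreover have "real m + 1 > (1 - \<delta>) * real M"
    using M1 by (simp add: m algebra_simps)
  ultimately have "real M * vol TYPE('n) (real m + 1) > ((1 - \<delta>) * real M) * vol TYPE('n) (real m)"
    using V by (metis mult_strict_right_mono)
  then have "real M * ((1 - \<delta>) * vol TYPE('n) (real m)) < real M * vol TYPE('n) (real m + 1)"
    by (simp add: mult_ac)
  then have c0: "c0 > 0"
    unfolding c0_def using \<open>?n < M\<close> by (simp add: mult_less_cancel_left)
  show ?thesis
  proof (rule that[of "c0 / 8 ^ (?n + 1)"])
    fix a :: "complex ^ 'n" assume a: "norm a < 1"
    define A where "A = 1 - (norm a)\<^sup>2"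
    have A: "A > 0" using one_minus_norm_sq(1)[OF a] by (simp add: A_def)
    define x where "x w = norm (1 - ip w a)" for w
    have [measurable]: "x \<in> borel_measurable borel" unfolding x_def[abs_def] by measurable
    \<comment> \<open>\<open>E1 - E2\<close> against \<open>W (real m)\<close> stands for u^M (u -
      (1 - \<delta>)) against the invariant density (1 - |w|^2)^(-n-1): of the power (1 - |w|^2)^M
      in u^M the exponent m = M - n - 1 survives and is the weight.\<close>
    define E1 where "E1 w = A ^ (M + 1) * ((1 - (norm w)\<^sup>2) powr 1 * x w powr (- 2 * (real M + 1)))" for w
    define E2 where "E2 w = (1 - \<delta>) * A ^ M * x w powr (- 2 * real M)" for w
    have i1: "integrable (W (real m)) E1" and e1: "(\<integral>w. E1 w \<partial>W (real m)) = vol TYPE('n) (real m + 1)"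
    proof -
      have i: "integrable (W (real m + 1)) (\<lambda>w. x w powr (- 2 * (real M + 1)))"
        using integrable_ip_powr[of "real m + 1" a "2 * (real M + 1)"] a by (simp add: x_def)
      then show "integrable (W (real m)) E1"
        unfolding E1_def[abs_def] by (intro integrable_mult_right, subst integral_W_shift) simp_all
      have y: "real ?n + 1 + (real m + 1) = real M + 1" by (simp add: m)
      have "(\<integral>w. E1 w \<partial>W (real m)) = A ^ (M + 1) * (\<integral>w. (1 - (norm w)\<^sup>2) powr 1 * x w powr (- 2 * (real M + 1)) \<partial>W (real m))"
        unfolding E1_def by (rule integral_mult_right_zero)
      also have "(\<integral>w. (1 - (norm w)\<^sup>2) powr 1 * x w powr (- 2 * (real M + 1)) \<partial>W (real m)) = (\<integral>w. x w powr (- 2 * (real M + 1)) \<partial>W (real m + 1))"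
        by (rule integral_W_shift) simp
      also have "\<dots> = vol TYPE('n) (real m + 1) * A powr (- (real M + 1))"
        using Forelli_Rudin_exact[of "real m + 1" a] a unfolding y by (simp add: x_def A_def)
      also have "A powr (- (real M + 1)) = inverse (A ^ (M + 1))"
        unfolding powr_minus using A powr_realpow[of A "M + 1"] by (simp add: add.commute)
      finally have "(\<integral>w. E1 w \<partial>W (real m)) = A ^ (M + 1) * (vol TYPE('n) (real m + 1) * inverse (A ^ (M + 1)))" .
      moreover have "b * (v * inverse b) = v" if "b \<noteq> 0" for b v :: real
        using that by simp
      moreover have "A ^ (M + 1) \<noteq> 0"
        using A by simp
      ultimately show "(\<integral>w. E1 w \<partial>W (real m)) = vol TYPE('n) (real m + 1)"
        by (simp only: not_False_eq_True)
    qed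
    have i2: "integrable (W (real m)) E2" and e2: "(\<integral>w. E2 w \<partial>W (real m)) = (1 - \<delta>) * vol TYPE('n) (real m)"
    proof -
      show "integrable (W (real m)) E2"
        unfolding E2_def[abs_def] using integrable_ip_powr[of "real m" a "2 * real M"] a
        by (intro integrable_mult_right) (simp add: x_def)
      have y: "real ?n + 1 + real m = real M" by (simp add: m)
      have "(\<integral>w. E2 w \<partial>W (real m)) = (1 - \<delta>) * A ^ M * (\<integral>w. x w powr (- 2 * real M) \<partial>W (real m))"
        unfolding E2_def by (rule integral_mult_right_zero)
      also have "(\<integral>w. x w powr (- 2 * real M) \<partial>W (real m)) = vol TYPE('n) (real m) * A powr (- real M)"
        using Forelli_Rudin_exact[of "real m" a] a unfolding y by (simp add: x_def A_def)
      also have "A powr (- real M) = inverse (A ^ M)"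
        using A powr_realpow[of A "M"] by (simp add: powr_minus)
      finally show "(\<integral>w. E2 w \<partial>W (real m)) = (1 - \<delta>) * vol TYPE('n) (real m)"
        using A by simp
    qed
    define g :: "complex ^ 'n \<Rightarrow> real" where "g = indicator (pball \<delta> a)"
    have [measurable]: "g \<in> borel_measurable borel" unfolding g_def by simp
    have ig: "integrable (W 0) g"
    proof -
      interpret finite_measure "W 0 :: (complex ^ 'n) measure" by (rule finite_measure_W) simp
      show ?thesis unfolding g_def by (simp add: emeasure_finite less_top[symmetric])
    qed
    have ig': "integrable (W (real m)) (\<lambda>w. (1 - (norm w)\<^sup>2) powr (- real m) * g w)"
      using ig by (subst integral_W_shift) simp_all
    have le: "E1 w - E2 w \<le> (8 / A) ^ (?n + 1) * ((1 - (norm w)\<^sup>2) powr (- real m) * g w)" if w: "norm w < 1" for w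
    proof -
      define B where "B = 1 - (norm w)\<^sup>2"
      have B: "B > 0" using one_minus_norm_sq(1)[OF w] by (simp add: B_def)
      have x: "x w > 0" unfolding x_def using w a by (intro norm_one_minus_ip_pos) auto
      define u where "u = A * B / (x w)\<^sup>2"
      have u: "0 < u" "u \<le> 1"
        using A B x weights_mult_le[OF a w] by (auto simp: u_def A_def B_def x_def)
      have p: "x w powr (- 2 * real j) = inverse ((x w)\<^sup>2 ^ j)" for j
        using x powr_realpow[of "x w" "2 * j"] by (simp add: powr_minus power_mult)
      have E: "E1 w - E2 w = (A ^ M * inverse ((x w)\<^sup>2 ^ M)) * (u - (1 - \<delta>))"
      proof -
        have "x w powr (- 2 * (real M + 1)) = inverse ((x w)\<^sup>2 ^ (M + 1))"
          using p[of "M + 1"] by (simp add: add.commute)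
        then show ?thesis
          unfolding E1_def E2_def p using B x by (simp add: u_def B_def[symmetric] field_simps)
      qed
      show ?thesis
      proof (cases "w \<in> pball \<delta> a")
        case True
        have "A ^ M * inverse ((x w)\<^sup>2 ^ M) = u ^ M * inverse (B ^ M)"
          using B x by (simp add: u_def power_divide power_mult_distrib field_simps)
        also have "\<dots> \<le> 1 * inverse (B ^ M)"
          using u B by (intro mult_right_mono power_le_one) auto
        finally have "A ^ M * inverse ((x w)\<^sup>2 ^ M) \<le> inverse (B ^ M)" by simp
        moreover have "1 - \<delta> \<le> u"
          using True x by (simp add: pball_def u_def A_def B_def x_def le_divide_eq)
        ultimately have "(A ^ M * inverse ((x w)\<^sup>2 ^ M)) * (u - (1 - \<delta>)) \<le> inverse (B ^ M) * 1"
          using u \<delta> A x B by (intro mult_mono) auto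
        also have "\<dots> = inverse (B ^ (?n + 1)) * B powr (- real m)"
          using B powr_realpow[of B m] by (simp add: m power_add powr_minus field_simps)
        also have "\<dots> \<le> (8 / A) ^ (?n + 1) * B powr (- real m)"
        proof (rule mult_right_mono)
          \<comment> \<open>On the ball the weights at \<open>w\<close> and \<open>a\<close> are
            comparable, which turns the invariant density into a constant. This produces the power n
            + 1 of 1 - |a|^2 in the volume bound.\<close>
          have "inverse B \<le> 8 / A"
            using pball_weight_le[OF \<delta> a True] A B by (simp add: A_def[symmetric] B_def[symmetric] field_simps)
          then show "inverse (B ^ (?n + 1)) \<le> (8 / A) ^ (?n + 1)"
            unfolding power_inverse[symmetric] using B by (intro power_mono) auto
        qed simp
        finally show ?thesis
          unfolding E using True by (simp add: g_def B_def)
      next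
        case False
        then have "u \<le> 1 - \<delta>"
          using w x by (simp add: pball_def u_def A_def B_def x_def divide_le_eq not_less)
        then have "E1 w - E2 w \<le> 0"
          unfolding E using A x by (intro mult_nonneg_nonpos) auto
        then show ?thesis using False by (simp add: g_def)
      qed
    qed
    have "c0 = (\<integral>w. E1 w - E2 w \<partial>W (real m))"
      using i1 i2 e1 e2 by (simp add: c0_def)
    also have "\<dots> \<le> (\<integral>w. (8 / A) ^ (?n + 1) * ((1 - (norm w)\<^sup>2) powr (- real m) * g w) \<partial>W (real m))"
    proof (rule integral_mono_AE)
      show "AE w in W (real m). E1 w - E2 w \<le> (8 / A) ^ (?n + 1) * ((1 - (norm w)\<^sup>2) powr (- real m) * g w)"
        using AE_W by eventually_elim (rule le)
    qed (use i1 i2 ig' in \<open>auto simp del: power_Suc\<close>)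
    also have "\<dots> = (8 / A) ^ (?n + 1) * measure (W 0) (pball \<delta> a)"
      using integral_W_shift(2)[of g "real m" "- real m"] by (simp add: g_def)
    finally show "c0 / 8 ^ (?n + 1) * (1 - (norm a)\<^sup>2) ^ (?n + 1) \<le> measure (W 0) (pball \<delta> a)"
      using A unfolding A_def[symmetric] power_divide by (simp add: field_simps del: power_Suc)
  qed (use c0 in simp)
qed

text \<open>By \<open>pball_close\<close> the two kernels below differ by a factor \<open>1 + O(sqrt \<delta>)\<close>.\<close>

lemma kernel_diff:
  fixes a w z :: "complex ^ 'n"
  assumes \<delta>: "0 < \<delta>" "14 * sqrt \<delta> \<le> 1 / 2" and a: "norm a < 1" and w: "w \<in> pball \<delta> a" and z: "norm z < 1"
  shows "norm (inverse ((1 - ip a z) ^ N) - inverse ((1 - ip w z) ^ N)) \<le> real N * 2 ^ N * (14 * sqrt \<delta>) * inverse (norm (1 - ip a z) ^ N)"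
proof -
  define x y where "x = 1 - ip a z" and "y = 1 - ip w z"
  \<comment> \<open>The quotient of the two bases is 1 + O(sqrt \<delta>); the difference of inverse
    powers is (1 - u^N) / x^N, and 1 - u^N has the factor u - 1.\<close>
  define u where "u = x / y"
  have w1: "norm w < 1" using w by (simp add: pball_def)
  have nz: "x \<noteq> 0" "y \<noteq> 0"
    unfolding x_def y_def using one_minus_ip_nz a w1 z by auto
  have "sqrt \<delta> \<le> sqrt (1 / 4)"
    using \<delta> by (simp add: real_sqrt_divide)
  then have \<delta>2: "\<delta> \<le> 1 / 2"
    by (simp only: real_sqrt_le_iff)
  have "norm (x - y) = norm (ip z (w - a))"
    by (metis cnj_ip complex_mod_cnj diff_diff_eq2 diff_add_cancel x_def y_def ip_diff_left add_diff_cancel_left diff_diff_add minus_diff_eq norm_minus_commute)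
  also have "\<dots> \<le> 14 * sqrt \<delta> * norm (1 - ip z w)"
    by (rule pball_close[OF \<delta>(1) \<delta>2 a w z])
  also have "norm (1 - ip z w) = norm y"
    unfolding y_def by (rule norm_one_minus_ip_comm)
  finally have xy: "norm (x - y) \<le> 14 * sqrt \<delta> * norm y" .
  have "u - 1 = (x - y) / y"
    using nz by (simp add: u_def diff_divide_distrib)
  then have u1: "norm (u - 1) \<le> 14 * sqrt \<delta>"
    using xy nz by (simp add: norm_divide divide_le_eq)
  have u2: "norm u \<le> 2"
    using norm_triangle_ineq[of "u - 1" 1] u1 \<delta> by simp
  have "norm (1 - u ^ N) = norm (u - 1) * norm (\<Sum>i<N. u ^ i)"
    using power_diff_1_eq[of u N] by (simp add: norm_mult norm_minus_commute[of 1 "u ^ N"])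
  also have "\<dots> \<le> (14 * sqrt \<delta>) * (real N * 2 ^ N)"
  proof (rule mult_mono)
    have "norm (\<Sum>i<N. u ^ i) \<le> (\<Sum>i<N. 2 ^ N)"
    proof (rule sum_norm_le)
      fix i assume "i \<in> {..<N}"
      have "norm (u ^ i) \<le> 2 ^ i" unfolding norm_power using u2 by (intro power_mono) auto
      also have "(2::real) ^ i \<le> 2 ^ N" using \<open>i \<in> {..<N}\<close> by (intro power_increasing) auto
      finally show "norm (u ^ i) \<le> 2 ^ N" .
    qed
    then show "norm (\<Sum>i<N. u ^ i) \<le> real N * 2 ^ N" by simp
  qed (use u1 \<delta> in auto)
  finally have d: "norm (1 - u ^ N) \<le> real N * 2 ^ N * (14 * sqrt \<delta>)" by (simp add: mult_ac)
  have "inverse (x ^ N) - inverse (y ^ N) = (1 - u ^ N) * inverse (x ^ N)"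
    using nz by (simp add: u_def power_divide field_simps)
  then have "norm (inverse (x ^ N) - inverse (y ^ N)) = norm (1 - u ^ N) * inverse (norm x ^ N)"
    by (simp add: norm_mult norm_inverse norm_power)
  also have "\<dots> \<le> real N * 2 ^ N * (14 * sqrt \<delta>) * inverse (norm x ^ N)"
    using d by (rule mult_right_mono) simp
  finally show ?thesis by (simp add: x_def y_def)
qed

text \<open>The reproducing formulas at \<open>a\<close> and \<open>w\<close> are subtracted. By
  \<open>kernel_diff\<close> the kernel difference is sqrt \<delta> times the modulus of the kernel
  at \<open>a\<close>; Hoelder and Forelli-Rudin then give the size of a point evaluation at
  \<open>a\<close>.\<close>

lemma bergman_oscillation:
  assumes p: "1 < p"
  obtains C where "C > 0"
    "\<And>f \<delta> a (w :: complex ^ 'n) F. holomorphic_several f (ball 0 1) \<Longrightarrow> f \<in> borel_measurable borel \<Longrightarrow>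
      integrable (W (real k)) f \<Longrightarrow> integrable (W (real k)) (\<lambda>z. norm (f z) powr p) \<Longrightarrow>
      (\<integral>z. norm (f z) powr p \<partial>W (real k)) \<le> F \<Longrightarrow> 0 < F \<Longrightarrow> 0 < \<delta> \<Longrightarrow> 14 * sqrt \<delta> \<le> 1 / 2 \<Longrightarrow>
      norm a < 1 \<Longrightarrow> w \<in> pball \<delta> a \<Longrightarrow>
      norm (f a - f w) \<le> C * sqrt \<delta> * F powr (1 / p) * (1 - (norm a)\<^sup>2) powr (- (real (CARD('n) + 1 + k) / p))"
proof -
  let ?N = "CARD('n) + 1 + k"
  define r where "r = p / (p - 1)"
  have r: "r > 1" "r - 1 = r / p" "1 / p + 1 / r = 1" using p by (auto simp: r_def field_simps)
  define x where "x = real ?N * (r - 1)"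
  have x: "x > 0" unfolding x_def using r(1) by (intro mult_pos_pos) auto
  have yx: "real CARD('n) + 1 + real k + x = real ?N * r"
    by (simp add: x_def algebra_simps)
  obtain G where G: "G > 0" "\<And>w :: complex ^ 'n. norm w < 1 \<Longrightarrow>
    (\<integral>z. norm (1 - ip z w) powr (- (real ?N * r)) \<partial>W (real k)) \<le> G * (1 - (norm w)\<^sup>2) powr (- x)"
    using Forelli_Rudin_upper[of "real k" x, where 'n = 'n] x unfolding yx by auto
  define V where "V = vol TYPE('n) (real k)"
  have V: "V > 0" unfolding V_def by (rule vol_pos) simp
  define L where "L = real ?N * 2 ^ ?N * 14"
  have L: "L > 0" by (simp add: L_def)
  show ?thesis
  proof (rule that[of "L / V * G powr (1 / r)"])
    fix f :: "complex ^ 'n \<Rightarrow> complex" and \<delta> F :: real and a w :: "complex ^ 'n"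
    assume f: "holomorphic_several f (ball 0 1)" and [measurable]: "f \<in> borel_measurable borel"
      and i1: "integrable (W (real k)) f" and ip: "integrable (W (real k)) (\<lambda>z. norm (f z) powr p)"
      and F: "(\<integral>z. norm (f z) powr p \<partial>W (real k)) \<le> F" "0 < F"
      and \<delta>: "0 < \<delta>" "14 * sqrt \<delta> \<le> 1 / 2" and a: "norm a < 1" and w: "w \<in> pball \<delta> a"
    have w1: "norm w < 1" using w by (simp add: pball_def)
    define v where "v z = norm (1 - ip z a) powr (- real ?N)" for z
    have [measurable]: "v \<in> borel_measurable borel" unfolding v_def[abs_def] by measurable
    have vr: "v z powr r = norm (1 - ip z a) powr (- (real ?N * r))" for z
    proof -
      have "(b powr (- n)) powr r = b powr (- (n * r))" for b n :: real
        by (simp add: powr_powr)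
      then show ?thesis unfolding v_def .
    qed
    define A where "A = 1 - (norm a)\<^sup>2"
    have A: "A > 0" using one_minus_norm_sq(1)[OF a] by (simp add: A_def)
    have iv: "integrable (W (real k)) (\<lambda>z. v z powr r)"
      unfolding vr using a r by (intro integrable_ip_powr) auto
    have bv: "(\<integral>z. v z powr r \<partial>W (real k)) \<le> G * A powr (- x)"
      unfolding vr A_def by (rule G(2)[OF a])
    have GA: "0 < G * A powr (- x)" using G A by simp
    note H = Holder_integral[of "\<lambda>z. norm (f z)" "W (real k)" v p r F "G * A powr (- x)"]
    have m: "(\<lambda>z. norm (f z)) \<in> borel_measurable (W (real k))" "v \<in> borel_measurable (W (real k))"
      by (simp_all add: measurable_cong_sets[OF sets_radial refl])
    have v0: "0 \<le> v z" for z by (simp add: v_def)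
    have ifv: "integrable (W (real k)) (\<lambda>z. norm (f z) * v z)"
      and bfv: "(\<integral>z. norm (f z) * v z \<partial>W (real k)) \<le> F powr (1 / p) * (G * A powr (- x)) powr (1 / r)"
      using H[OF m norm_ge_zero v0 p r(1) r(3) ip iv F bv GA] by auto
    have iK: "integrable (W (real k)) (\<lambda>z. f z * inverse ((1 - ip u z) ^ ?N))" if "norm u < 1" for u
      using i1 that by (rule integrable_mult_kernel)
    have "of_real V * (f a - f w) = (\<integral>z. f z * inverse ((1 - ip a z) ^ ?N) \<partial>W (real k)) - (\<integral>z. f z * inverse ((1 - ip w z) ^ ?N) \<partial>W (real k))"
    proof -
      have "(\<integral>z. f z * inverse ((1 - ip u z) ^ ?N) \<partial>W (real k)) = of_real V * f u" if "norm u < 1" for u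
        unfolding V_def by (rule reproducing[OF f _ i1 that]) simp
      then show ?thesis
        by (simp only: a w1 right_diff_distrib)
    qed
    also have "\<dots> = (\<integral>z. f z * inverse ((1 - ip a z) ^ ?N) - f z * inverse ((1 - ip w z) ^ ?N) \<partial>W (real k))"
      by (rule Bochner_Integration.integral_diff[symmetric]) (intro iK a w1)+
    finally have e: "of_real V * (f a - f w) = \<dots>" .
    have "V * norm (f a - f w) = norm (of_real V * (f a - f w))"
      using V by (simp add: norm_mult)
    also have "\<dots> \<le> (\<integral>z. norm (f z * inverse ((1 - ip a z) ^ ?N) - f z * inverse ((1 - ip w z) ^ ?N)) \<partial>W (real k))"
      unfolding e by (rule integral_norm_bound)
    also have "\<dots> \<le> (\<integral>z. L * sqrt \<delta> * (norm (f z) * v z) \<partial>W (real k))"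
    proof (rule integral_mono_AE)
      show "AE z in W (real k). norm (f z * inverse ((1 - ip a z) ^ ?N) - f z * inverse ((1 - ip w z) ^ ?N)) \<le> L * sqrt \<delta> * (norm (f z) * v z)"
        using AE_W
      proof eventually_elim
        case (elim z)
        have vz: "inverse (norm (1 - ip a z) ^ ?N) = v z"
          unfolding v_def norm_one_minus_ip_comm[of a z] using norm_one_minus_ip_pos[of z a] elim a
          by (simp only: powr_minus powr_realpow less_imp_le)
        have "norm (f z * inverse ((1 - ip a z) ^ ?N) - f z * inverse ((1 - ip w z) ^ ?N))
          = norm (f z) * norm (inverse ((1 - ip a z) ^ ?N) - inverse ((1 - ip w z) ^ ?N))"
          by (simp only: right_diff_distrib[symmetric] norm_mult)
        also have "\<dots> \<le> norm (f z) * (real ?N * 2 ^ ?N * (14 * sqrt \<delta>) * v z)"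
          unfolding vz[symmetric] by (intro mult_left_mono kernel_diff \<delta> a w elim) auto
        finally show ?case by (simp only: L_def mult_ac)
      qed
    qed (intro integrable_norm Bochner_Integration.integrable_diff iK a w1 integrable_mult_right ifv)+
    also have "\<dots> = L * sqrt \<delta> * (\<integral>z. norm (f z) * v z \<partial>W (real k))"
      by (rule integral_mult_right_zero)
    also have "\<dots> \<le> L * sqrt \<delta> * (F powr (1 / p) * (G * A powr (- x)) powr (1 / r))"
      using bfv L \<delta> by (intro mult_left_mono) auto
    also have "(G * A powr (- x)) powr (1 / r) = G powr (1 / r) * A powr (- (real ?N / p))"
    proof -
      have "- x / r = - (real ?N / p)" unfolding x_def r(2) using r by simp
      then show ?thesis using G A by (simp only: powr_mult powr_powr less_imp_le powr_ge_zero) (simp add: field_simps)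
    qed
    finally have "V * norm (f a - f w) \<le> V * (L / V * G powr (1 / r) * sqrt \<delta> * F powr (1 / p) * A powr (- (real ?N / p)))"
      using V by (simp add: mult_ac)
    then show "norm (f a - f w) \<le> L / V * G powr (1 / r) * sqrt \<delta> * F powr (1 / p) * (1 - (norm a)\<^sup>2) powr (- (real ?N / p))"
      unfolding A_def using V by (simp only: mult_le_cancel_left_pos)
  qed (use L V G in simp)
qed

text \<open>The factor (1 - |a|^2)^(n+1) is at most a constant times the volume of
  \<open>pball \<delta> a\<close>, and the kernel varies there by a bounded factor. So each term is
  bounded by an integral over its ball, and disjointness bounds the sum by one Forelli-Rudin
  integral.\<close>

lemma separated_sum_bound:
  assumes \<delta>: "0 < \<delta>" "14 * sqrt \<delta> \<le> 1 / 2" and e: "0 < e"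
  obtains C where "C > 0"
    "\<And>(F :: (complex ^ 'n) set) z. finite F \<Longrightarrow> F \<subseteq> ball 0 1 \<Longrightarrow> disjoint_family_on (pball \<delta>) F \<Longrightarrow> norm z < 1 \<Longrightarrow>
      (\<Sum>a\<in>F. (1 - (norm a)\<^sup>2) ^ (CARD('n) + 1) * norm (1 - ip z a) powr (- (real CARD('n) + 1 + e))) \<le> C * (1 - (norm z)\<^sup>2) powr (- e)"
proof -
  let ?n = "CARD('n)"
  define \<beta> where "\<beta> = real ?n + 1 + e"
  have \<beta>: "\<beta> > 0" using e by (simp add: \<beta>_def add_nonneg_pos)
  have "sqrt \<delta> \<le> sqrt (1 / 4)"
    using \<delta> by (simp add: real_sqrt_divide)
  then have \<delta>2: "\<delta> \<le> 1 / 2"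
    by (simp only: real_sqrt_le_iff)
  obtain c where c: "c > 0" "\<And>a :: complex ^ 'n. norm a < 1 \<Longrightarrow> c * (1 - (norm a)\<^sup>2) ^ (?n + 1) \<le> measure (W 0) (pball \<delta> a)"
    using pball_volume[OF \<delta>(1) \<delta>2] by blast
  obtain K where K: "K > 0" "\<And>w :: complex ^ 'n. norm w < 1 \<Longrightarrow>
    (\<integral>z. norm (1 - ip z w) powr (- \<beta>) \<partial>W 0) \<le> K * (1 - (norm w)\<^sup>2) powr (- e)"
    using Forelli_Rudin_upper[of 0 e, where 'n = 'n] e by (auto simp: \<beta>_def)
  interpret finite_measure "W 0 :: (complex ^ 'n) measure" by (rule finite_measure_W) simp
  show ?thesis
  proof (rule that[of "2 powr \<beta> * K / c"])
    fix F :: "(complex ^ 'n) set" and z :: "complex ^ 'n"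
    assume F: "finite F" "F \<subseteq> ball 0 1" "disjoint_family_on (pball \<delta>) F" and z: "norm z < 1"
    define y where "y w = norm (1 - ip w z) powr (- \<beta>)" for w
    have iy: "integrable (W 0) y"
      unfolding y_def[abs_def] using z \<beta> by (intro integrable_ip_powr) auto
    have iI: "integrable (W 0) (\<lambda>w. indicator (pball \<delta> a) w * y w)" for a
      using integrable_real_mult_indicator[OF _ iy, of "pball \<delta> a"] by (simp add: mult.commute)
    have each: "c * ((1 - (norm a)\<^sup>2) ^ (?n + 1) * norm (1 - ip z a) powr (- \<beta>)) \<le> 2 powr \<beta> * (\<integral>w. indicator (pball \<delta> a) w * y w \<partial>W 0)"
      if "a \<in> F" for a
    proof -
      have a: "norm a < 1" using that F by auto
      have "c * (1 - (norm a)\<^sup>2) ^ (?n + 1) * norm (1 - ip z a) powr (- \<beta>) \<le> measure (W 0) (pball \<delta> a) * norm (1 - ip z a) powr (- \<beta>)"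
        by (intro mult_right_mono c a) auto
      also have "\<dots> = (\<integral>w. indicator (pball \<delta> a) w * norm (1 - ip z a) powr (- \<beta>) \<partial>W 0)"
        by simp
      also have "\<dots> \<le> (\<integral>w. 2 powr \<beta> * (indicator (pball \<delta> a) w * y w) \<partial>W 0)"
      proof (rule integral_mono)
        show "integrable (W 0) (\<lambda>w. indicator (pball \<delta> a) w * norm (1 - ip z a) powr (- \<beta>))"
          by (intro integrable_mult_left) (simp add: emeasure_finite less_top[symmetric])
        show "integrable (W 0) (\<lambda>w. 2 powr \<beta> * (indicator (pball \<delta> a) w * y w))"
          by (intro integrable_mult_right iI)
        fix w
        show "indicator (pball \<delta> a) w * norm (1 - ip z a) powr (- \<beta>) \<le> 2 powr \<beta> * (indicator (pball \<delta> a) w * y w)"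
        proof (cases "w \<in> pball \<delta> a")
          case True
          have w1: "norm w < 1" using True by (simp add: pball_def)
          \<comment> \<open>Moving \<open>a\<close> to \<open>w\<close> changes 1 - <z, a> by at
            most half of |1 - <z, w>|, which accounts for the factor 2^\<beta>.\<close>
          have d: "1 - ip z a = (1 - ip z w) + ip z (w - a)"
            by (simp add: ip_diff_right)
          have "norm (1 - ip z w) - norm (ip z (w - a)) \<le> norm (1 - ip z a)"
            unfolding d by (rule norm_diff_ineq)
          moreover have "norm (ip z (w - a)) \<le> 1 / 2 * norm (1 - ip z w)"
            using pball_close[OF \<delta>(1) \<delta>2 a True z] mult_right_mono[OF \<delta>(2), of "norm (1 - ip z w)"] by simp
          ultimately have h: "norm (1 - ip z w) / 2 \<le> norm (1 - ip z a)"
            by simp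
          have "norm (1 - ip z a) powr (- \<beta>) \<le> (norm (1 - ip z w) / 2) powr (- \<beta>)"
            using h norm_one_minus_ip_pos[of z w] z w1 \<beta> by (intro powr_mono2') auto
          also have "\<dots> = 2 powr \<beta> * y w"
          proof -
            have "(t / 2) powr (- \<beta>) = 2 powr \<beta> * t powr (- \<beta>)" if "0 \<le> t" for t :: real
              using that by (simp add: powr_divide powr_minus_divide)
            then show ?thesis
              unfolding y_def norm_one_minus_ip_comm[of w z] by (simp only: norm_ge_zero)
          qed
          finally show ?thesis using True by simp
        qed simp
      qed
      finally show ?thesis by (simp add: mult.assoc)
    qed
    have "c * (\<Sum>a\<in>F. (1 - (norm a)\<^sup>2) ^ (?n + 1) * norm (1 - ip z a) powr (- \<beta>)) \<le> (\<Sum>a\<in>F. 2 powr \<beta> * (\<integral>w. indicator (pball \<delta> a) w * y w \<partial>W 0))"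
      unfolding sum_distrib_left by (intro sum_mono each)
    also have "\<dots> = 2 powr \<beta> * (\<integral>w. (\<Sum>a\<in>F. indicator (pball \<delta> a) w * y w) \<partial>W 0)"
      unfolding sum_distrib_left[symmetric] by (simp add: Bochner_Integration.integral_sum iI)
    also have "\<dots> \<le> 2 powr \<beta> * (\<integral>w. y w \<partial>W 0)"
    proof (intro mult_left_mono integral_mono)
      show "integrable (W 0) (\<lambda>w. \<Sum>a\<in>F. indicator (pball \<delta> a) w * y w)"
        by (intro Bochner_Integration.integrable_sum iI)
      fix w
      have "(\<Sum>a\<in>F. indicator (pball \<delta> a) w) = (indicator (\<Union>a\<in>F. pball \<delta> a) w :: real)"
        by (rule indicator_UN_disjoint[symmetric]) (rule F)+
      then have "(\<Sum>a\<in>F. indicator (pball \<delta> a) w * y w) = indicator (\<Union>a\<in>F. pball \<delta> a) w * y w"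
        by (simp add: sum_distrib_right[symmetric])
      also have "\<dots> \<le> y w" by (auto simp: y_def split: split_indicator)
      finally show "(\<Sum>a\<in>F. indicator (pball \<delta> a) w * y w) \<le> y w" .
    qed (use iy in auto)
    also have "\<dots> \<le> 2 powr \<beta> * (K * (1 - (norm z)\<^sup>2) powr (- e))"
      unfolding y_def by (intro mult_left_mono K z) auto
    finally have "(\<Sum>a\<in>F. (1 - (norm a)\<^sup>2) ^ (?n + 1) * norm (1 - ip z a) powr (- \<beta>)) \<le> 2 powr \<beta> * K / c * (1 - (norm z)\<^sup>2) powr (- e)"
      using c by (simp add: field_simps del: power_Suc)
    then show "(\<Sum>a\<in>F. (1 - (norm a)\<^sup>2) ^ (?n + 1) * norm (1 - ip z a) powr (- (real ?n + 1 + e))) \<le> 2 powr \<beta> * K / c * (1 - (norm z)\<^sup>2) powr (- e)"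
      by (simp only: \<beta>_def)
  qed (use K c in simp)
qed

subsection \<open>The extension operator\<close>

lemma weighted_power_sum:
  fixes x k :: "'a \<Rightarrow> real"
  assumes "finite G" and x: "\<And>a. a \<in> G \<Longrightarrow> 0 \<le> x a" and k: "\<And>a. a \<in> G \<Longrightarrow> 0 < k a" and q: "1 \<le> q"
  shows "(\<Sum>a\<in>G. x a) powr q \<le> (\<Sum>a\<in>G. x a powr q * k a powr (- (q - 1))) * (\<Sum>a\<in>G. k a) powr (q - 1)"
proof -
  define F where "F = (\<Sum>a\<in>G. x a powr q * k a powr (- (q - 1)))"
  have F0: "F \<ge> 0" unfolding F_def by (intro sum_nonneg) auto
  \<comment> \<open>The cases q = 1 and F = 0 lie outside \<open>Holder_integral\<close>. The empty
    index set is separated from q = 1 because \<open>0 powr 0 = 0\<close>.\<close>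
  consider "q = 1" "G \<noteq> {}" | "G = {}" | "q > 1" "F = 0" | "q > 1" "F > 0" "G \<noteq> {}"
    using q F0 by fastforce
  then show ?thesis
  proof cases
    case 1
    have "(\<Sum>a\<in>G. k a) > 0" using k 1 assms(1) by (intro sum_pos) auto
    moreover have "(\<Sum>a\<in>G. x a) = (\<Sum>a\<in>G. x a powr q * k a powr (- (q - 1)))"
      using x k 1 by (intro sum.cong) (auto simp: less_imp_neq[symmetric])
    moreover have "(\<Sum>a\<in>G. x a) \<ge> 0" using x by (rule sum_nonneg)
    ultimately show ?thesis using 1 by (simp add: abs_of_nonneg)
  next
    case 3
    have "x a = 0" if "a \<in> G" for a
    proof -
      have "x a powr q * k a powr (- (q - 1)) = 0"
        using 3(2) sum_nonneg_eq_0_iff[OF assms(1), of "\<lambda>a. x a powr q * k a powr (- (q - 1))"] that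
        unfolding F_def by auto
      then show ?thesis using k[OF that] by auto
    qed
    then have "(\<Sum>a\<in>G. x a) = 0" by simp
    then show ?thesis unfolding F_def[symmetric] using F0 by simp
  next
    case 4
    define r where "r = q / (q - 1)"
    have r: "1 < r" "1 / q + 1 / r = 1" "1 / r = (q - 1) / q" using 4 by (auto simp: r_def field_simps)
    define u where "u a = (if a \<in> G then x a * k a powr (- (1 / r)) else 0)" for a
    define v where "v a = (if a \<in> G then k a powr (1 / r) else 0)" for a
    have K: "(\<Sum>a\<in>G. k a) > 0" using k 4 assms(1) by (intro sum_pos) auto
    have uq: "(\<Sum>a\<in>G. u a powr q) = F"
      unfolding F_def
    proof (rule sum.cong[OF refl])
      fix a assume a: "a \<in> G"
      have "- (1 / r) * q = - (q - 1)" using 4 unfolding r(3) by simp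
      then show "u a powr q = x a powr q * k a powr (- (q - 1))"
        using a x[OF a] by (simp only: u_def if_True powr_mult powr_powr powr_ge_zero)
    qed
    have vr: "(\<Sum>a\<in>G. v a powr r) = (\<Sum>a\<in>G. k a)"
      using r(1) k by (intro sum.cong) (auto simp: v_def powr_powr less_imp_le)
    have uv: "(\<Sum>a\<in>G. u a * v a) = (\<Sum>a\<in>G. x a)"
    proof (rule sum.cong[OF refl])
      fix a assume a: "a \<in> G"
      have "k a powr (- (1 / r)) * k a powr (1 / r) = 1"
        using k[OF a] by (simp add: powr_add[symmetric])
      then show "u a * v a = x a" using a by (simp add: u_def v_def mult.assoc)
    qed
    have "(\<integral>a. u a * v a \<partial>count_space G) \<le> F powr (1 / q) * (\<Sum>a\<in>G. k a) powr (1 / r)"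
    proof (rule Holder_integral(2))
      show "u \<in> borel_measurable (count_space G)" "v \<in> borel_measurable (count_space G)"
        by simp_all
      show "0 \<le> u a" "0 \<le> v a" for a
        using x by (simp_all add: u_def v_def)
      show "integrable (count_space G) (\<lambda>a. u a powr q)" "integrable (count_space G) (\<lambda>a. v a powr r)"
        by (rule integrable_count_space[OF assms(1)])+
      show "(\<integral>a. u a powr q \<partial>count_space G) \<le> F" "(\<integral>a. v a powr r \<partial>count_space G) \<le> (\<Sum>a\<in>G. k a)"
        by (simp_all only: lebesgue_integral_count_space_finite[OF assms(1)] uq vr)
    qed (use 4 r K in simp_all)
    then have "(\<Sum>a\<in>G. x a) \<le> F powr (1 / q) * (\<Sum>a\<in>G. k a) powr (1 / r)"
      by (simp only: lebesgue_integral_count_space_finite[OF assms(1)] uv)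
    then have "(\<Sum>a\<in>G. x a) powr q \<le> (F powr (1 / q) * (\<Sum>a\<in>G. k a) powr (1 / r)) powr q"
      using 4 x by (intro powr_mono2 sum_nonneg) auto
    also have "\<dots> = F * (\<Sum>a\<in>G. k a) powr (q - 1)"
      using 4 K by (simp add: powr_mult powr_powr r(3))
    finally show ?thesis by (simp only: F_def)
  qed auto
qed

text \<open>The term of index \<open>a\<close> after the weighted Hoelder inequality: the second factor is the weight,
  and the third comes from \<open>separated_sum_bound\<close>.\<close>

definition extension_term ::
    "real \<Rightarrow> real \<Rightarrow> nat \<Rightarrow> real \<Rightarrow> complex ^ 'n \<Rightarrow> (complex ^ 'n \<Rightarrow> complex) \<Rightarrow> complex ^ 'n \<Rightarrow> real" where
  "extension_term q s M \<epsilon> a f z =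
     (norm (f z) * ((1 - (norm a)\<^sup>2) powr (real M - s) * norm (1 - ip z a) powr (- real M))) powr q *
     ((1 - (norm a)\<^sup>2) ^ (CARD('n) + 1) * norm (1 - ip z a) powr (- (real CARD('n) + 1 + \<epsilon>))) powr (- (q - 1)) *
     (1 - (norm z)\<^sup>2) powr (- \<epsilon> * (q - 1))"

text \<open>Hoelder with exponents P = p/q on |\<rho>|^q and Q = p/(p - q) on all the rest. With r =
  q Q one has N/q - N/p = N/r, and a Forelli-Rudin integral controls the second factor uniformly in
  \<open>a\<close>.\<close>

lemma weighted_term_bound:
  fixes k :: nat and p q F :: real
  assumes q: "1 \<le> q" "q < p" and F: "0 < F"
  defines "N \<equiv> real (CARD('n::finite) + 1 + k)"
  obtains M :: nat and \<epsilon> C :: real where "0 < \<epsilon>" "0 < C"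
    "\<And>(\<rho> :: complex ^ 'n \<Rightarrow> complex) a. norm a < 1 \<Longrightarrow> \<rho> \<in> borel_measurable borel \<Longrightarrow>
      integrable (W (real k)) (\<lambda>z. norm (\<rho> z) powr p) \<Longrightarrow> (\<integral>z. norm (\<rho> z) powr p \<partial>W (real k)) \<le> F \<Longrightarrow>
      integrable (W (real k)) (extension_term q (N / q - N / p) M \<epsilon> a \<rho>) \<and>
      integral\<^sup>L (W (real k)) (extension_term q (N / q - N / p) M \<epsilon> a \<rho>) \<le> C"
proof -
  let ?n = "CARD('n)"
  have p0: "p > 0" "q > 0" using q by auto
  define P where "P = p / q"
  define Q where "Q = p / (p - q)"
  have PQ: "1 < P" "1 < Q" "1 / P + 1 / Q = 1"
    using q p0 by (auto simp: P_def Q_def field_simps)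
  define r where "r = q * Q"
  have r: "r > 0" using p0 PQ by (simp add: r_def)
  have Nr: "(N / q - N / p) * r = N"
  proof -
    have "(1 / q - 1 / p) * r = 1" using q p0 by (simp add: r_def Q_def field_simps)
    then have "N * ((1 / q - 1 / p) * r) = N" by simp
    then show ?thesis by (simp add: algebra_simps)
  qed
  \<comment> \<open>The exponent of the summation weights after raising to the power Q. They lower
    the exponent of 1 - |z|^2 by \<epsilon> D, and the choice of \<epsilon> keeps s = k - \<epsilon>
    D above -1.\<close>
  define D where "D = (q - 1) * Q"
  have D: "D \<ge> 0" using q PQ by (simp add: D_def)
  define \<epsilon> where "\<epsilon> = 1 / (2 * (D + 1))"
  have \<epsilon>: "\<epsilon> > 0" using D by (simp add: \<epsilon>_def)
  have sD: "\<epsilon> * D < 1" using D by (simp add: \<epsilon>_def field_simps)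
  define s where "s = real k - \<epsilon> * D"
  have s: "s > -1" using sD by (simp add: s_def)
  obtain M :: nat where M: "(N + (real ?n + 1) * D) / r < real M"
    using reals_Archimedean2 by blast
  \<comment> \<open>The net power of 1 - |a|^2 in the second Hoelder factor. Forelli-Rudin returns
    the power -X, so the dependence on \<open>a\<close> cancels; M is large enough to make X
    positive.\<close>
  define X where "X = real M * r - N - (real ?n + 1) * D"
  have X: "X > 0" using M r by (simp add: X_def field_simps)
  have yX: "real ?n + 1 + s + X = real M * r - (real ?n + 1 + \<epsilon>) * D"
    by (simp add: X_def s_def N_def algebra_simps)
  obtain G where G: "G > 0" "\<And>w :: complex ^ 'n. norm w < 1 \<Longrightarrow>
    (\<integral>z. norm (1 - ip z w) powr (- (real M * r - (real ?n + 1 + \<epsilon>) * D)) \<partial>W s) \<le> G * (1 - (norm w)\<^sup>2) powr (- X)"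
    using Forelli_Rudin_upper[OF s X, where 'n = 'n] unfolding yX by blast
  show ?thesis
  proof (rule that[of \<epsilon> "F powr (1 / P) * G powr (1 / Q)" M])
    fix \<rho> :: "complex ^ 'n \<Rightarrow> complex" and a :: "complex ^ 'n"
    assume a: "norm a < 1" and [measurable]: "\<rho> \<in> borel_measurable borel"
      and i\<rho>: "integrable (W (real k)) (\<lambda>z. norm (\<rho> z) powr p)" and b\<rho>: "(\<integral>z. norm (\<rho> z) powr p \<partial>W (real k)) \<le> F"
    define A where "A = 1 - (norm a)\<^sup>2"
    have A: "A > 0" using one_minus_norm_sq(1)[OF a] by (simp add: A_def)
    define x where "x z = norm (1 - ip z a)" for z
    have [measurable]: "x \<in> borel_measurable borel" unfolding x_def[abs_def] by measurable
    define u where "u z = norm (\<rho> z) powr q" for z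
    define v where "v z = (A powr (real M - (N / q - N / p)) * x z powr (- real M)) powr q *
      (A ^ (?n + 1) * x z powr (- (real ?n + 1 + \<epsilon>))) powr (- (q - 1)) * (1 - (norm z)\<^sup>2) powr (- \<epsilon> * (q - 1))" for z
    have [measurable]: "u \<in> borel_measurable borel" "v \<in> borel_measurable borel"
      unfolding u_def[abs_def] v_def[abs_def] by measurable
    have m: "u \<in> borel_measurable (W (real k))" "v \<in> borel_measurable (W (real k))"
      by (simp_all add: measurable_cong_sets[OF sets_radial refl])
    have uv: "(norm (\<rho> z) * (A powr (real M - (N / q - N / p)) * x z powr (- real M))) powr q *
        (A ^ (?n + 1) * x z powr (- (real ?n + 1 + \<epsilon>))) powr (- (q - 1)) *
        (1 - (norm z)\<^sup>2) powr (- \<epsilon> * (q - 1)) = u z * v z" for z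
      by (simp only: u_def v_def powr_mult norm_ge_zero powr_ge_zero zero_le_mult_iff mult.assoc)
    have uP: "u z powr P = norm (\<rho> z) powr p" for z
      using p0 by (simp add: u_def powr_powr P_def)
    define Y where "Y = real M * r - (real ?n + 1 + \<epsilon>) * D"
    have vQ: "v z powr Q = A powr X * ((1 - (norm z)\<^sup>2) powr (- (\<epsilon> * D)) * x z powr (- Y))" if z: "norm z < 1" for z
    proof -
      have xz: "x z > 0" unfolding x_def using z a by (intro norm_one_minus_ip_pos) auto
      have B: "1 - (norm z)\<^sup>2 > 0" by (rule one_minus_norm_sq(1)[OF z])
      have Ap: "A ^ (?n + 1) = A powr (real ?n + 1)"
        using A powr_realpow[of A "?n + 1"] by (simp add: add.commute)
      have gen: "((A powr \<alpha>1 * xx powr \<alpha>2) powr q * (A powr \<alpha>3 * xx powr \<alpha>4) powr (- (q - 1)) * bb powr \<alpha>5) powr Q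
        = A powr ((\<alpha>1 * q - \<alpha>3 * (q - 1)) * Q) * (bb powr (\<alpha>5 * Q) * xx powr ((\<alpha>2 * q - \<alpha>4 * (q - 1)) * Q))"
        if "xx > 0" "bb > 0" for \<alpha>1 \<alpha>2 \<alpha>3 \<alpha>4 \<alpha>5 xx bb :: real
        using that A by (simp add: powr_mult powr_powr powr_add[symmetric] mult_ac)
          (simp add: powr_add[symmetric] algebra_simps)
      have "(real M - (N / q - N / p)) * q * Q = real M * r - N"
      proof -
        have "(m' - w) * q * Q = m' * (q * Q) - w * (q * Q)" for m' w
          by (simp add: algebra_simps)
        then show ?thesis
          using Nr by (simp only: r_def)
      qed
      then have e1: "((real M - (N / q - N / p)) * q - (real ?n + 1) * (q - 1)) * Q = X"
        by (simp add: X_def D_def left_diff_distrib mult.assoc)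
      have e2: "(- real M * q - - (real ?n + 1 + \<epsilon>) * (q - 1)) * Q = - Y"
        by (simp add: Y_def D_def r_def algebra_simps)
      have e3: "- \<epsilon> * (q - 1) * Q = - (\<epsilon> * D)"
        by (simp add: D_def)
      show ?thesis
        unfolding v_def Ap gen[OF xz B] e1 e2 e3 ..
    qed
    have ae: "AE z in W (real k). v z powr Q = A powr X * ((1 - (norm z)\<^sup>2) powr (- (\<epsilon> * D)) * x z powr (- Y))"
      using AE_W by eventually_elim (rule vQ)
    have sk: "real k + - (\<epsilon> * D) = s" by (simp add: s_def)
    have Y0: "Y \<ge> 0" using yX weight_dim_pos[OF s, where 'n = 'n] X by (simp add: Y_def)
    have iY: "integrable (W s) (\<lambda>z. x z powr (- Y))"
      unfolding x_def using s a Y0 by (rule integrable_ip_powr)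
    have iY': "integrable (W (real k)) (\<lambda>z. (1 - (norm z)\<^sup>2) powr (- (\<epsilon> * D)) * x z powr (- Y))"
      by (subst integral_W_shift(1)) (simp_all only: sk iY, measurable)
    have mvQ: "(\<lambda>z. v z powr Q) \<in> borel_measurable (W (real k))"
      by (simp add: measurable_cong_sets[OF sets_radial refl])
    have mr: "(\<lambda>z. A powr X * ((1 - (norm z)\<^sup>2) powr (- (\<epsilon> * D)) * x z powr (- Y))) \<in> borel_measurable (W (real k))"
      by (simp add: measurable_cong_sets[OF sets_radial refl])
    have iv: "integrable (W (real k)) (\<lambda>z. v z powr Q)"
      by (subst integrable_cong_AE[OF mvQ mr ae]) (intro integrable_mult_right iY')
    have "(\<integral>z. v z powr Q \<partial>W (real k)) = A powr X * (\<integral>z. (1 - (norm z)\<^sup>2) powr (- (\<epsilon> * D)) * x z powr (- Y) \<partial>W (real k))"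
      by (subst integral_cong_AE[OF mvQ mr ae]) (rule integral_mult_right_zero)
    also have "(\<integral>z. (1 - (norm z)\<^sup>2) powr (- (\<epsilon> * D)) * x z powr (- Y) \<partial>W (real k)) = (\<integral>z. x z powr (- Y) \<partial>W s)"
      by (subst integral_W_shift(2)) (simp_all only: sk, measurable)
    also have "\<dots> \<le> G * A powr (- X)"
      unfolding x_def Y_def A_def by (rule G(2)[OF a])
    finally have bv: "(\<integral>z. v z powr Q \<partial>W (real k)) \<le> G"
      using A by (simp add: powr_minus field_simps mult_left_mono)
    have H: "integrable (W (real k)) (\<lambda>z. u z * v z) \<and> (\<integral>z. u z * v z \<partial>W (real k)) \<le> F powr (1 / P) * G powr (1 / Q)"
    proof -
      have n: "0 \<le> u z" "0 \<le> v z" for z by (simp_all add: u_def v_def)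
      have iu: "integrable (W (real k)) (\<lambda>z. u z powr P)" and bu: "(\<integral>z. u z powr P \<partial>W (real k)) \<le> F"
        using i\<rho> b\<rho> by (simp_all only: uP)
      show ?thesis
        using Holder_integral[OF m n PQ iu iv bu F bv G(1)] by blast
    qed
    then show "integrable (W (real k)) (extension_term q (N / q - N / p) M \<epsilon> a \<rho>) \<and>
      integral\<^sup>L (W (real k)) (extension_term q (N / q - N / p) M \<epsilon> a \<rho>) \<le> F powr (1 / P) * G powr (1 / Q)"
      unfolding extension_term_def[abs_def] A_def[symmetric] x_def[symmetric] uv .
  qed (use \<epsilon> F G in simp_all)
qed

lemma bergman_point_bound:
  fixes f :: "complex ^ 'n \<Rightarrow> complex"
  assumes f: "holomorphic_several f (ball 0 1)" and [measurable]: "f \<in> borel_measurable borel"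
    and i: "integrable (W (real k)) f" and w: "norm w < 1"
  shows "norm (f w) \<le> inverse (vol TYPE('n) (real k)) * inverse ((1 - norm w) ^ (CARD('n) + 1 + k)) * (\<integral>z. norm (f z) \<partial>W (real k))"
proof -
  let ?N = "CARD('n) + 1 + k" and ?V = "vol TYPE('n) (real k)"
  have V: "?V > 0" by (rule vol_pos) simp
  have "?V * norm (f w) = norm (of_real ?V * f w)"
    using V by (simp add: norm_mult)
  also have "\<dots> = norm (\<integral>z. f z * inverse ((1 - ip w z) ^ ?N) \<partial>W (real k))"
    by (subst reproducing[OF f _ i w]) simp_all
  also have "\<dots> \<le> (\<integral>z. norm (f z) * inverse ((1 - norm w) ^ ?N) \<partial>W (real k))"
  proof (rule order_trans[OF integral_norm_bound], rule integral_mono_AE')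
    show "AE z in W (real k). norm (f z * inverse ((1 - ip w z) ^ ?N)) \<le> norm (f z) * inverse ((1 - norm w) ^ ?N)"
      using AE_W
    proof eventually_elim
      case (elim z)
      show ?case
        unfolding norm_mult using elim w by (intro mult_left_mono norm_kernel_at_le) auto
    qed
    show "integrable (W (real k)) (\<lambda>z. norm (f z) * inverse ((1 - norm w) ^ ?N))"
      using i by (intro integrable_mult_left integrable_norm)
    show "AE z in W (real k). 0 \<le> norm (f z) * inverse ((1 - norm w) ^ ?N)"
      using w by (intro AE_I2 mult_nonneg_nonneg) auto
  qed
  also have "\<dots> = inverse ((1 - norm w) ^ ?N) * (\<integral>z. norm (f z) \<partial>W (real k))"
    by (simp add: mult.commute)
  finally have "inverse ?V * (?V * norm (f w)) \<le> inverse ?V * (inverse ((1 - norm w) ^ ?N) * (\<integral>z. norm (f z) \<partial>W (real k)))"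
    using V by (intro mult_left_mono) auto
  then show ?thesis
    using V by (simp add: mult.assoc[symmetric])
qed

lemma le_one_plus_powr: "1 \<le> q \<Longrightarrow> 0 \<le> x \<Longrightarrow> x \<le> 1 + x powr q" for x q :: real
proof (cases "x \<le> 1")
  case False
  assume "1 \<le> q" "0 \<le> x"
  then have "x powr 1 \<le> x powr q" using False by (intro powr_mono) auto
  then show ?thesis using False by simp
qed (simp add: add_increasing2)

text \<open>The bounds concern finite sums of absolute values for arbitrary coefficients, so no
  cancellation is exploited. They give pointwise absolute convergence by point evaluation,
  integrability of the limit by monotone convergence, and holomorphy by the reproducing
  formula.\<close>

lemma series_operator:
  fixes e :: "complex ^ 'n \<Rightarrow> complex ^ 'n \<Rightarrow> complex" and S :: "(complex ^ 'n) set" and k :: nat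
  assumes S: "countable S" and q: "1 \<le> q" and K: "0 < K"
    and hol: "\<And>a. a \<in> S \<Longrightarrow> holomorphic_several (e a) (ball 0 1)"
    and zero: "\<And>a z. a \<in> S \<Longrightarrow> z \<notin> ball 0 1 \<Longrightarrow> e a z = 0"
    and ibound: "\<And>G l. finite G \<Longrightarrow> G \<subseteq> S \<Longrightarrow> integrable (W (real k)) (\<lambda>z. (\<Sum>a\<in>G. norm (l a * e a z)) powr q)"
    and bound: "\<And>G l. finite G \<Longrightarrow> G \<subseteq> S \<Longrightarrow>
      (\<integral>z. (\<Sum>a\<in>G. norm (l a * e a z)) powr q \<partial>W (real k)) \<le> K * (\<Sum>a\<in>G. norm (l a) powr q)"
    and l: "l \<in> lq_space (ennreal q) S"
  shows series_operator_summable: "\<And>z. (\<lambda>a. norm (l a * e a z)) summable_on S"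
    and series_operator_mem: "(\<lambda>z. \<Sum>\<^sub>\<infinity>a\<in>S. l a * e a z) \<in> bergman_space k (ennreal q)"
    and series_operator_norm: "bergman_norm k (ennreal q) (\<lambda>z. \<Sum>\<^sub>\<infinity>a\<in>S. l a * e a z)
      \<le> (ball_const k * K) powr (1 / q) * lq_norm (ennreal q) S l"
proof -
  let ?M = "W (real k) :: (complex ^ 'n) measure" and ?N = "CARD('n) + 1 + k"
  interpret finite_measure ?M by (rule finite_measure_W) simp
  define V where "V = vol TYPE('n) (real k)"
  have V: "V > 0" unfolding V_def by (rule vol_pos) simp
  have em[measurable]: "e a \<in> borel_measurable borel" if "a \<in> S" for a
    using hol[OF that] zero[OF that] by (rule borel_measurable_ball_supported)
  define L where "L = (\<Sum>\<^sub>\<infinity>a\<in>S. norm (l a) powr q)"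
  have ls: "(\<lambda>a. norm (l a) powr q) summable_on S"
    using l q by (simp add: lq_space_def)
  have Lle: "(\<Sum>a\<in>G. norm (l a) powr q) \<le> L" if "finite G" "G \<subseteq> S" for G
    unfolding L_def by (rule finite_sum_le_infsum[OF ls that]) simp
  have L0: "L \<ge> 0" using Lle[of "{}"] by simp
  define h where "h G z = (\<Sum>a\<in>G. norm (l a * e a z))" for G z
  have h0: "h G z \<ge> 0" for G z unfolding h_def by (rule sum_nonneg) simp
  have hm: "h G \<in> borel_measurable borel" if "G \<subseteq> S" for G
    unfolding h_def[abs_def] using that by (intro borel_measurable_sum borel_measurable_norm borel_measurable_times em) auto
  have ihq: "integrable ?M (\<lambda>z. h G z powr q)" if "finite G" "G \<subseteq> S" for G
    unfolding h_def by (rule ibound[OF that])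
  have bhq: "(\<integral>z. h G z powr q \<partial>?M) \<le> K * L" if "finite G" "G \<subseteq> S" for G
    unfolding h_def by (rule order_trans[OF bound[OF that]]) (use Lle[OF that] K in simp)
  have ih: "integrable ?M (h G)" if "finite G" "G \<subseteq> S" for G
  proof (rule Bochner_Integration.integrable_bound)
    show "integrable ?M (\<lambda>z. 1 + h G z powr q)"
      using ihq[OF that] by simp
    show "AE z in ?M. norm (h G z) \<le> norm (1 + h G z powr q)"
      using le_one_plus_powr[OF q h0] h0 by (intro AE_I2) (simp add: abs_of_nonneg add_nonneg_nonneg)
  qed (use hm[OF that(2)] in \<open>simp add: measurable_cong_sets[OF sets_radial refl]\<close>)
  have bh: "(\<integral>z. h G z \<partial>?M) \<le> V + K * L" if "finite G" "G \<subseteq> S" for G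
  proof -
    have "(\<integral>z. h G z \<partial>?M) \<le> (\<integral>z. 1 + h G z powr q \<partial>?M)"
      using ihq[OF that] by (intro integral_mono ih that le_one_plus_powr[OF q h0]) auto
    also have "\<dots> = V + (\<integral>z. h G z powr q \<partial>?M)"
      using ihq[OF that] by (simp add: V_def vol_def)
    finally show ?thesis using bhq[OF that] by simp
  qed
  have il: "integrable ?M (\<lambda>z. l a * e a z)" if "a \<in> S" for a
  proof (rule Bochner_Integration.integrable_bound[OF ih[of "{a}"]])
    show "(\<lambda>z. l a * e a z) \<in> borel_measurable ?M"
      using em[OF that] by (simp add: measurable_cong_sets[OF sets_radial refl])
  qed (use that in \<open>auto simp: h_def\<close>)
  define c where "c w = inverse V * inverse ((1 - norm w) ^ ?N)" for w :: "complex ^ 'n"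
  \<comment> \<open>Applying \<open>bergman_point_bound\<close> to each term turns the uniform
    integral bound into a uniform bound on the absolute partial sums at each point.\<close>
  have pw: "h G w \<le> c w * (V + K * L)" if G: "finite G" "G \<subseteq> S" and w: "norm w < 1" for G w
  proof -
    have c0: "c w \<ge> 0" using V w by (simp add: c_def)
    have "h G w \<le> (\<Sum>a\<in>G. c w * (\<integral>z. norm (l a * e a z) \<partial>?M))"
      unfolding h_def
    proof (rule sum_mono)
      fix a assume "a \<in> G"
      then have a: "a \<in> S" using G by auto
      show "norm (l a * e a w) \<le> c w * (\<integral>z. norm (l a * e a z) \<partial>?M)"
        unfolding c_def V_def
        by (rule bergman_point_bound[OF holomorphic_several_mult[OF holomorphic_several_const hol[OF a]] _ il[OF a] w])
           (use em[OF a] in simp)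
    qed
    also have "\<dots> = c w * (\<integral>z. h G z \<partial>?M)"
      unfolding h_def sum_distrib_left[symmetric] using G il by (subst Bochner_Integration.integral_sum) auto
    also have "\<dots> \<le> c w * (V + K * L)"
      by (intro mult_left_mono bh G c0)
    finally show ?thesis .
  qed
  show summ: "(\<lambda>a. norm (l a * e a z)) summable_on S" for z
  proof (cases "norm z < 1")
    case True
    show ?thesis
    proof (rule nonneg_bdd_above_summable_on)
      show "bdd_above (sum (\<lambda>a. norm (l a * e a z)) ` {F. F \<subseteq> S \<and> finite F})"
        using pw[OF _ _ True] unfolding h_def by (intro bdd_aboveI2[of _ _ "c z * (V + K * L)"]) auto
    qed simp
  next
    case False
    then have "(\<lambda>a. norm (l a * e a z)) summable_on S \<longleftrightarrow> (\<lambda>a. 0 :: real) summable_on S"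
      using zero by (intro summable_on_cong) auto
    then show ?thesis by simp
  qed
  define E where "E z = (\<Sum>\<^sub>\<infinity>a\<in>S. l a * e a z)" for z
  define H where "H z = (\<Sum>\<^sub>\<infinity>a\<in>S. norm (l a * e a z))" for z
  \<comment> \<open>Monotone and dominated convergence concern sequences; countability of
    \<open>S\<close> supplies an increasing sequence of finite sets along which the unordered sums
    converge.\<close>
  define Fi where "Fi i = {a \<in> S. to_nat_on S a < i}" for i
  have Fi: "finite (Fi i)" "Fi i \<subseteq> S" for i
  proof -
    have "inj_on (to_nat_on S) (Fi i)"
      by (rule inj_on_subset[OF inj_on_to_nat_on[OF S]]) (auto simp: Fi_def)
    moreover have "to_nat_on S ` Fi i \<subseteq> {..<i}"
      by (auto simp: Fi_def)
    ultimately show "finite (Fi i)"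
      by (meson finite_imageD finite_lessThan finite_subset)
  qed (auto simp: Fi_def)
  have lim: "filterlim Fi (finite_subsets_at_top S) sequentially"
    unfolding filterlim_finite_subsets_at_top
  proof (intro allI impI)
    fix X assume X: "finite X \<and> X \<subseteq> S"
    obtain m where m: "\<And>a. a \<in> X \<Longrightarrow> to_nat_on S a < m"
      using X finite_nat_set_iff_bounded[of "to_nat_on S ` X"] by auto
    show "\<forall>\<^sub>F i in sequentially. finite (Fi i) \<and> X \<subseteq> Fi i \<and> Fi i \<subseteq> S"
      using eventually_ge_at_top[of m]
    proof eventually_elim
      case (elim i)
      have "X \<subseteq> Fi i" using m X elim by (force simp: Fi_def)
      then show ?case using Fi by auto
    qed
  qed
  have limE: "(\<lambda>i. \<Sum>a\<in>Fi i. l a * e a z) \<longlonglongrightarrow> E z" for z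
    unfolding E_def by (rule filterlim_compose[OF infsum_tendsto[OF abs_summable_summable[OF summ]] lim])
  have limH: "(\<lambda>i. h (Fi i) z) \<longlonglongrightarrow> H z" for z
    unfolding H_def h_def by (rule filterlim_compose[OF infsum_tendsto[OF summ] lim])
  have hmono: "incseq (\<lambda>i. h (Fi i) z)" for z
    unfolding h_def by (intro incseq_SucI sum_mono2 Fi) (auto simp: Fi_def)
  have H0: "H z \<ge> 0" for z
    unfolding H_def by (rule infsum_nonneg) simp
  have EH: "norm (E z) \<le> H z" for z
    unfolding E_def H_def by (rule norm_infsum_bound[OF summ])
  have mE[measurable]: "E \<in> borel_measurable borel"
    by (rule borel_measurable_LIMSEQ_metric[OF _ limE])
       (use Fi in \<open>auto intro!: borel_measurable_sum borel_measurable_times em\<close>)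
  have mH[measurable]: "H \<in> borel_measurable borel"
    by (rule borel_measurable_LIMSEQ_metric[OF _ limH]) (rule hm[OF Fi(2)])
  have limHq: "(\<lambda>i. h (Fi i) z powr q) \<longlonglongrightarrow> H z powr q" for z
    using q by (intro tendsto_powr' limH tendsto_const) (auto simp: h0)
  have imono: "incseq (\<lambda>i. \<integral>z. h (Fi i) z powr q \<partial>?M)"
    using q hmono h0 by (intro incseq_SucI integral_mono ihq Fi powr_mono2) (auto simp: incseq_Suc_iff)
  obtain I where I: "(\<lambda>i. \<integral>z. h (Fi i) z powr q \<partial>?M) \<longlonglongrightarrow> I"
    using incseq_convergent[OF imono, of "K * L"] bhq[OF Fi] by blast
  have IK: "I \<le> K * L"
    by (rule LIMSEQ_le_const2[OF I]) (use bhq[OF Fi] in auto)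
  have iHq: "integrable ?M (\<lambda>z. H z powr q)" and bHq: "(\<integral>z. H z powr q \<partial>?M) = I"
  proof -
    have 1: "AE z in ?M. mono (\<lambda>i. h (Fi i) z powr q)"
      using q hmono h0 by (intro AE_I2 incseq_SucI powr_mono2) (auto simp: incseq_Suc_iff)
    have 2: "AE z in ?M. (\<lambda>i. h (Fi i) z powr q) \<longlonglongrightarrow> H z powr q"
      using limHq by simp
    have 3: "(\<lambda>z. H z powr q) \<in> borel_measurable ?M"
      by (simp add: measurable_cong_sets[OF sets_radial refl])
    show "integrable ?M (\<lambda>z. H z powr q)"
      by (rule integrable_monotone_convergence[OF ihq[OF Fi] 1 2 I 3])
    show "(\<integral>z. H z powr q \<partial>?M) = I"
      by (rule integral_monotone_convergence[OF ihq[OF Fi] 1 2 I 3])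
  qed
  have iH: "integrable ?M H"
  proof (rule Bochner_Integration.integrable_bound)
    show "integrable ?M (\<lambda>z. 1 + H z powr q)"
      using iHq by simp
    show "AE z in ?M. norm (H z) \<le> norm (1 + H z powr q)"
      using le_one_plus_powr[OF q H0] H0 by (intro AE_I2) (simp add: abs_of_nonneg add_nonneg_nonneg)
  qed (simp add: measurable_cong_sets[OF sets_radial refl])
  have iE: "integrable ?M E"
    by (rule Bochner_Integration.integrable_bound[OF iH])
       (use EH H0 in \<open>auto simp: measurable_cong_sets[OF sets_radial refl] abs_of_nonneg\<close>)
  have EqH: "norm (E z) powr q \<le> H z powr q" for z
    using EH q by (intro powr_mono2) auto
  have iEq: "integrable ?M (\<lambda>z. norm (E z) powr q)"
    by (rule Bochner_Integration.integrable_bound[OF iHq])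
       (use EqH in \<open>auto simp: measurable_cong_sets[OF sets_radial refl]\<close>)
  \<comment> \<open>The reproducing formula passes to the limit by dominated convergence with
    majorant \<open>H\<close>. It displays \<open>E\<close> as an integral transform, whose
    holomorphy is already established.\<close>
  have rep: "of_real V * E w = (\<integral>z. E z * inverse ((1 - ip w z) ^ ?N) \<partial>?M)" if w: "norm w < 1" for w
  proof -
    have "(\<lambda>i. \<integral>z. (\<Sum>a\<in>Fi i. l a * e a z) * inverse ((1 - ip w z) ^ ?N) \<partial>?M) \<longlonglongrightarrow> (\<integral>z. E z * inverse ((1 - ip w z) ^ ?N) \<partial>?M)"
    proof (rule integral_dominated_convergence)
      show "integrable ?M (\<lambda>z. H z * inverse ((1 - norm w) ^ ?N))"
        using iH by (intro integrable_mult_left)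
      show "AE z in ?M. (\<lambda>i. (\<Sum>a\<in>Fi i. l a * e a z) * inverse ((1 - ip w z) ^ ?N)) \<longlonglongrightarrow> E z * inverse ((1 - ip w z) ^ ?N)"
        by (intro AE_I2 tendsto_mult limE tendsto_const)
      show "AE z in ?M. norm ((\<Sum>a\<in>Fi i. l a * e a z) * inverse ((1 - ip w z) ^ ?N)) \<le> H z * inverse ((1 - norm w) ^ ?N)" for i
        using AE_W
      proof eventually_elim
        case (elim z)
        have "norm (\<Sum>a\<in>Fi i. l a * e a z) \<le> h (Fi i) z"
          unfolding h_def by (rule norm_sum)
        also have "\<dots> \<le> H z"
          by (rule incseq_le[OF hmono limH])
        finally show ?case
          unfolding norm_mult using elim w H0 by (intro mult_mono norm_kernel_at_le) auto
      qed
      show "(\<lambda>z. (\<Sum>a\<in>Fi i. l a * e a z) * inverse ((1 - ip w z) ^ ?N)) \<in> borel_measurable ?M" for i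
      proof -
        have "(\<lambda>z. \<Sum>a\<in>Fi i. l a * e a z) \<in> borel_measurable borel"
          using Fi by (intro borel_measurable_sum borel_measurable_times em) auto
        then show ?thesis
          by (simp add: measurable_cong_sets[OF sets_radial refl])
      qed
    qed (simp add: measurable_cong_sets[OF sets_radial refl])
    moreover have "(\<integral>z. (\<Sum>a\<in>Fi i. l a * e a z) * inverse ((1 - ip w z) ^ ?N) \<partial>?M) = of_real V * (\<Sum>a\<in>Fi i. l a * e a w)" for i
    proof -
      have iK: "integrable ?M (\<lambda>z. l a * e a z * inverse ((1 - ip w z) ^ ?N))" if "a \<in> S" for a
        using il[OF that] w by (rule integrable_mult_kernel)
      have "(\<integral>z. (\<Sum>a\<in>Fi i. l a * e a z) * inverse ((1 - ip w z) ^ ?N) \<partial>?M)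
        = (\<Sum>a\<in>Fi i. (\<integral>z. l a * e a z * inverse ((1 - ip w z) ^ ?N) \<partial>?M))"
        unfolding sum_distrib_right using Fi iK by (subst Bochner_Integration.integral_sum) auto
      also have "\<dots> = (\<Sum>a\<in>Fi i. of_real V * (l a * e a w))"
      proof (rule sum.cong[OF refl])
        fix a assume "a \<in> Fi i"
        then have a: "a \<in> S" using Fi by auto
        show "(\<integral>z. l a * e a z * inverse ((1 - ip w z) ^ ?N) \<partial>?M) = of_real V * (l a * e a w)"
          unfolding V_def
          by (rule reproducing[OF holomorphic_several_mult[OF holomorphic_several_const hol[OF a]] _ il[OF a] w])
             (use em[OF a] in simp)
      qed
      finally show ?thesis by (simp only: sum_distrib_left)
    qed
    ultimately have "(\<lambda>i. of_real V * (\<Sum>a\<in>Fi i. l a * e a w)) \<longlonglongrightarrow> (\<integral>z. E z * inverse ((1 - ip w z) ^ ?N) \<partial>?M)"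
      by (simp only:)
    moreover have "(\<lambda>i. of_real V * (\<Sum>a\<in>Fi i. l a * e a w)) \<longlonglongrightarrow> of_real V * E w"
      by (intro tendsto_mult limE tendsto_const)
    ultimately show ?thesis
      by (rule LIMSEQ_unique[rotated])
  qed
  have holE: "holomorphic_several E (ball 0 1)"
  proof (rule holomorphic_several_cong)
    show "holomorphic_several (\<lambda>w. of_real (inverse V) * (\<integral>z. E z * inverse ((1 - ip w z) ^ ?N) \<partial>?M)) (ball 0 1)"
      by (intro holomorphic_several_mult holomorphic_several_const transform_holomorphic iE)
    fix w :: "complex ^ 'n" assume "w \<in> ball 0 1"
    then have "of_real (inverse V) * (\<integral>z. E z * inverse ((1 - ip w z) ^ ?N) \<partial>?M) = of_real (inverse V) * (of_real V * E w)"
      by (subst rep) auto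
    also have "\<dots> = E w"
      using V by simp
    finally show "of_real (inverse V) * (\<integral>z. E z * inverse ((1 - ip w z) ^ ?N) \<partial>?M) = E w" .
  qed
  have E0: "E z = 0" if "z \<notin> ball 0 1" for z
    unfolding E_def using zero that by (intro infsum_0) auto
  have Emem: "E \<in> bergman_space k (ennreal q)"
    using q holE E0 iEq by (subst bergman_space_real) auto
  then show "(\<lambda>z. \<Sum>\<^sub>\<infinity>a\<in>S. l a * e a z) \<in> bergman_space k (ennreal q)"
    by (simp add: E_def[abs_def])
  have "bergman_norm k (ennreal q) E = (ball_const k * (\<integral>z. norm (E z) powr q \<partial>?M)) powr (1 / q)"
    using q by (intro bergman_norm_real) auto
  also have "\<dots> \<le> (ball_const k * (K * L)) powr (1 / q)"
  proof (intro powr_mono2 mult_left_mono)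
    have "(\<integral>z. norm (E z) powr q \<partial>?M) \<le> (\<integral>z. H z powr q \<partial>?M)"
      by (intro integral_mono iEq iHq EqH)
    then show "(\<integral>z. norm (E z) powr q \<partial>?M) \<le> K * L"
      using bHq IK by simp
  qed (use q ball_const_pos[of k] in \<open>auto intro!: mult_nonneg_nonneg\<close>)
  also have "\<dots> = (ball_const k * K) powr (1 / q) * L powr (1 / q)"
    using ball_const_pos[of k] K L0 by (simp add: powr_mult)
  also have "L powr (1 / q) = lq_norm (ennreal q) S l"
    using q by (simp add: lq_norm_def L_def)
  finally show "bergman_norm k (ennreal q) (\<lambda>z. \<Sum>\<^sub>\<infinity>a\<in>S. l a * e a z)
      \<le> (ball_const k * K) powr (1 / q) * lq_norm (ennreal q) S l"
    by (simp add: E_def[abs_def])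
qed

text \<open>If the balls around \<open>a\<close> and \<open>c\<close> shared a point
  \<open>w\<close>, the function \<rho>_a would fall from its diagonal value at \<open>a\<close> to
  0 at \<open>c\<close> in two short steps through \<open>w\<close>. Its oscillation on small balls
  forbids this.\<close>

lemma dual_system_separated:
  fixes \<rho> :: "complex ^ 'n \<Rightarrow> complex ^ 'n \<Rightarrow> complex" and k :: nat
  assumes p: "1 < p" and F: "0 < F" and S: "S \<subseteq> ball 0 1"
    and hol: "\<And>a. a \<in> S \<Longrightarrow> holomorphic_several (\<rho> a) (ball 0 1)"
    and meas: "\<And>a. a \<in> S \<Longrightarrow> \<rho> a \<in> borel_measurable borel"
    and int: "\<And>a. a \<in> S \<Longrightarrow> integrable (W (real k)) (\<rho> a)"
    and intp: "\<And>a. a \<in> S \<Longrightarrow> integrable (W (real k)) (\<lambda>z. norm (\<rho> a z) powr p)"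
    and le: "\<And>a. a \<in> S \<Longrightarrow> (\<integral>z. norm (\<rho> a z) powr p \<partial>W (real k)) \<le> F"
    and diag: "\<And>a. a \<in> S \<Longrightarrow> \<rho> a a = of_real ((1 - (norm a)\<^sup>2) powr (- (real (CARD('n) + 1 + k) / p)))"
    and off: "\<And>a c. a \<in> S \<Longrightarrow> c \<in> S \<Longrightarrow> a \<noteq> c \<Longrightarrow> \<rho> a c = 0"
  obtains \<delta> where "0 < \<delta>" "14 * sqrt \<delta> \<le> 1 / 2" "disjoint_family_on (pball \<delta>) S"
proof -
  define \<nu> where "\<nu> = real (CARD('n) + 1 + k) / p"
  have \<nu>: "\<nu> \<ge> 0" using p by (simp add: \<nu>_def)
  obtain C where C: "C > 0" and osc:
    "\<And>f \<delta> a (w :: complex ^ 'n) F. holomorphic_several f (ball 0 1) \<Longrightarrow> f \<in> borel_measurable borel \<Longrightarrow>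
      integrable (W (real k)) f \<Longrightarrow> integrable (W (real k)) (\<lambda>z. norm (f z) powr p) \<Longrightarrow>
      (\<integral>z. norm (f z) powr p \<partial>W (real k)) \<le> F \<Longrightarrow> 0 < F \<Longrightarrow> 0 < \<delta> \<Longrightarrow> 14 * sqrt \<delta> \<le> 1 / 2 \<Longrightarrow>
      norm a < 1 \<Longrightarrow> w \<in> pball \<delta> a \<Longrightarrow>
      norm (f a - f w) \<le> C * sqrt \<delta> * F powr (1 / p) * (1 - (norm a)\<^sup>2) powr (- \<nu>)"
    unfolding \<nu>_def using bergman_oscillation[OF p, where 'n = 'n and k = k] by blast
  \<comment> \<open>The steps at \<open>a\<close> and \<open>c\<close> cost multiples of A^(-\<nu>)
    and B^(-\<nu>). Passing through \<open>w\<close> gives A \<le> 8 (8 B), hence the factor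
    64^\<nu>. Below, t \<le> 1/(2K) makes the total oscillation at most half the diagonal
    value.\<close>
  define K where "K = C * F powr (1 / p) * (1 + 64 powr \<nu>)"
  have K: "K > 0" using C F by (simp add: K_def add_pos_pos)
  define t where "t = min (1 / 28) (1 / (2 * K))"
  have t: "0 < t" "14 * t \<le> 1 / 2" using K by (auto simp: t_def)
  have tK: "K * t < 1"
  proof -
    have "K * t \<le> K * (1 / (2 * K))" using K by (intro mult_left_mono) (auto simp: t_def)
    also have "\<dots> < 1" using K by simp
    finally show ?thesis .
  qed
  define \<delta> where "\<delta> = t\<^sup>2"
  have st: "sqrt \<delta> = t" using t by (simp add: \<delta>_def)
  have \<delta>: "0 < \<delta>" "14 * sqrt \<delta> \<le> 1 / 2"
    using t by (simp add: \<delta>_def, simp add: st)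
  have "\<delta> \<le> 1 * (1 / 28)"
    unfolding \<delta>_def power2_eq_square using t by (intro mult_mono) auto
  then have \<delta>2: "\<delta> \<le> 1 / 2" by simp
  have "pball \<delta> a \<inter> pball \<delta> c = {}" if ac: "a \<in> S" "c \<in> S" "a \<noteq> c" for a c
  proof (rule ccontr)
    assume "pball \<delta> a \<inter> pball \<delta> c \<noteq> {}"
    then obtain w where w: "w \<in> pball \<delta> a" "w \<in> pball \<delta> c" by blast
    have a1: "norm a < 1" and c1: "norm c < 1" using ac S by auto
    have w1: "norm w < 1" using w by (simp add: pball_def)
    \<comment> \<open>The condition defining \<open>pball\<close> is symmetric in centre and point,
      so the weight comparison can be chained from \<open>a\<close> to \<open>w\<close> to
      \<open>c\<close>.\<close>
    have cw: "c \<in> pball \<delta> w"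
      using w(2) c1 by (simp add: pball_def norm_one_minus_ip_comm[of c w] mult.commute)
    define A B where "A = 1 - (norm a)\<^sup>2" and "B = 1 - (norm c)\<^sup>2"
    have AB: "A > 0" "B > 0"
      using one_minus_norm_sq(1) a1 c1 by (auto simp: A_def B_def)
    have "A \<le> 64 * B"
      using pball_weight_le[OF \<delta>(1) \<delta>2 a1 w(1)] pball_weight_le[OF \<delta>(1) \<delta>2 w1 cw] by (simp add: A_def B_def)
    then have "(64 * B) powr (- \<nu>) \<le> A powr (- \<nu>)"
      using AB \<nu> by (intro powr_mono2') auto
    then have "64 powr \<nu> * (64 * B) powr (- \<nu>) \<le> 64 powr \<nu> * A powr (- \<nu>)"
      by (intro mult_left_mono) auto
    moreover have "64 powr \<nu> * (64 * B) powr (- \<nu>) = B powr (- \<nu>)"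
    proof -
      have "(64 * B) powr (- \<nu>) = 64 powr (- \<nu>) * B powr (- \<nu>)"
        by (rule powr_mult)
      moreover have "(64::real) powr \<nu> * 64 powr (- \<nu>) = 1"
        by (simp add: powr_add[symmetric])
      ultimately show ?thesis by (simp add: mult.assoc[symmetric])
    qed
    ultimately have BA: "B powr (- \<nu>) \<le> 64 powr \<nu> * A powr (- \<nu>)" by simp
    have o: "norm (\<rho> a b - \<rho> a w) \<le> C * t * F powr (1 / p) * (1 - (norm b)\<^sup>2) powr (- \<nu>)"
      if "norm b < 1" "w \<in> pball \<delta> b" for b
      using osc[OF hol meas int intp le F \<delta> that, of a] ac(1) by (simp add: st)
    have "A powr (- \<nu>) = norm (\<rho> a a - \<rho> a c)"
      using AB ac by (simp add: diag off \<nu>_def A_def)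
    also have "\<dots> \<le> norm (\<rho> a a - \<rho> a w) + norm (\<rho> a c - \<rho> a w)"
      using norm_triangle_ineq4[of "\<rho> a a - \<rho> a w" "\<rho> a c - \<rho> a w"] by simp
    also have "\<dots> \<le> C * t * F powr (1 / p) * A powr (- \<nu>) + C * t * F powr (1 / p) * B powr (- \<nu>)"
      unfolding A_def B_def by (intro add_mono o a1 c1 w)
    also have "\<dots> \<le> C * t * F powr (1 / p) * A powr (- \<nu>) + C * t * F powr (1 / p) * (64 powr \<nu> * A powr (- \<nu>))"
      using BA C t by (intro add_left_mono mult_left_mono) auto
    also have "\<dots> = (K * t) * A powr (- \<nu>)"
      by (simp add: K_def algebra_simps)
    also have "\<dots> < 1 * A powr (- \<nu>)"
      using tK AB by (intro mult_strict_right_mono) auto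
    finally show False by simp
  qed
  then have "disjoint_family_on (pball \<delta>) S"
    by (auto simp: disjoint_family_on_def)
  then show ?thesis
    using \<delta> that by blast
qed

text \<open>The diagonal is an exact power and the prescribed values \<beta> are subject to an upper
  bound only. Kernel norms thus enter through their size alone, and p = \<infinity> reduces to this
  lemma with an auxiliary finite exponent.\<close>

lemma dual_system_extension:
  fixes \<rho> :: "complex ^ 'n \<Rightarrow> complex ^ 'n \<Rightarrow> complex" and k :: nat and \<beta> :: "complex ^ 'n \<Rightarrow> real"
  assumes countS: "countable S" and q: "1 \<le> q" "q < p" and F: "0 < F" and S: "S \<subseteq> ball 0 1"
    and hol: "\<And>a. a \<in> S \<Longrightarrow> holomorphic_several (\<rho> a) (ball 0 1)"
    and zero: "\<And>a z. a \<in> S \<Longrightarrow> z \<notin> ball 0 1 \<Longrightarrow> \<rho> a z = 0"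
    and intp: "\<And>a. a \<in> S \<Longrightarrow> integrable (W (real k)) (\<lambda>z. norm (\<rho> a z) powr p)"
    and le: "\<And>a. a \<in> S \<Longrightarrow> (\<integral>z. norm (\<rho> a z) powr p \<partial>W (real k)) \<le> F"
    and diag: "\<And>a. a \<in> S \<Longrightarrow> \<rho> a a = of_real ((1 - (norm a)\<^sup>2) powr (- (real (CARD('n) + 1 + k) / p)))"
    and off: "\<And>a c. a \<in> S \<Longrightarrow> c \<in> S \<Longrightarrow> a \<noteq> c \<Longrightarrow> \<rho> a c = 0"
    and \<beta>: "0 < C\<beta>" "\<And>a. a \<in> S \<Longrightarrow> \<bar>\<beta> a\<bar> \<le> C\<beta> * (1 - (norm a)\<^sup>2) powr (- (real (CARD('n) + 1 + k) / q))"
  obtains E where "bounded_linear_operator_lq_bergman k (ennreal q) S E"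
    "\<And>l c. l \<in> lq_space (ennreal q) S \<Longrightarrow> c \<in> S \<Longrightarrow> E l c = l c * of_real (\<beta> c)"
proof -
  let ?n = "CARD('n)" and ?M = "W (real k) :: (complex ^ 'n) measure"
  define N where "N = real (?n + 1 + k)"
  have p: "1 < p" "0 < p" using q by auto
  have mem: "\<rho> a \<in> bergman_space k (ennreal p)" if "a \<in> S" for a
    using hol[OF that] zero[OF that] intp[OF that] p by (subst bergman_space_real) auto
  have meas: "\<rho> a \<in> borel_measurable borel" if "a \<in> S" for a
    using mem[OF that] by (rule bergman_space_measurable)
  have int: "integrable ?M (\<rho> a)" if "a \<in> S" for a
    using mem[OF that] p by (intro bergman_space_integrable) auto
  obtain \<delta> where \<delta>: "0 < \<delta>" "14 * sqrt \<delta> \<le> 1 / 2" and disj: "disjoint_family_on (pball \<delta>) S"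
    using dual_system_separated[OF p(1) F S hol meas int intp le diag off] by blast
  obtain M :: nat and \<epsilon> CT where \<epsilon>: "0 < \<epsilon>" and CT: "0 < CT" and wterm:
    "\<And>(\<rho> :: complex ^ 'n \<Rightarrow> complex) a. norm a < 1 \<Longrightarrow> \<rho> \<in> borel_measurable borel \<Longrightarrow>
      integrable (W (real k)) (\<lambda>z. norm (\<rho> z) powr p) \<Longrightarrow> (\<integral>z. norm (\<rho> z) powr p \<partial>W (real k)) \<le> F \<Longrightarrow>
      integrable (W (real k)) (extension_term q (N / q - N / p) M \<epsilon> a \<rho>) \<and>
      integral\<^sup>L (W (real k)) (extension_term q (N / q - N / p) M \<epsilon> a \<rho>) \<le> CT"
    by (rule weighted_term_bound[OF q F, where 'n = 'n and k = k, folded N_def]) (rule that)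
  obtain C2 where C2: "0 < C2" and sumb:
    "\<And>(G :: (complex ^ 'n) set) z. finite G \<Longrightarrow> G \<subseteq> ball 0 1 \<Longrightarrow> disjoint_family_on (pball \<delta>) G \<Longrightarrow> norm z < 1 \<Longrightarrow>
      (\<Sum>a\<in>G. (1 - (norm a)\<^sup>2) ^ (?n + 1) * norm (1 - ip z a) powr (- (real ?n + 1 + \<epsilon>))) \<le> C2 * (1 - (norm z)\<^sup>2) powr (- \<epsilon>)"
    using separated_sum_bound[OF \<delta> \<epsilon>, where 'n = 'n] by blast
  define A where "A a = 1 - (norm a)\<^sup>2" for a :: "complex ^ 'n"
  have A: "A a > 0" if "a \<in> S" for a
    using one_minus_norm_sq(1)[of a] S that by (auto simp: A_def)
  \<comment> \<open>At \<open>a\<close> the dual function contributes A^(-N/p) and the kernel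
    A^(-M), so the prefactor makes \<open>e a a\<close> exactly \<beta> a. Since |\<beta> a| is at
    most a constant times A^(-N/q), the total power of A is bounded by that of \<kappa>_a.\<close>
  define e where "e a z = of_real (\<beta> a * A a powr (N / p + real M)) * (\<rho> a z * ip_kernel M a z)" for a z
  define k2 where "k2 a z = A a ^ (?n + 1) * norm (1 - ip z a) powr (- (real ?n + 1 + \<epsilon>))" for a z
  define y where "y a z = norm (\<rho> a z) * (A a powr (real M - (N / q - N / p)) * norm (1 - ip z a) powr (- real M))" for a z
  define T where "T a z = y a z powr q * k2 a z powr (- (q - 1)) * (1 - (norm z)\<^sup>2) powr (- \<epsilon> * (q - 1))" for a z
  have iT: "integrable ?M (T a)" and bT: "(\<integral>z. T a z \<partial>?M) \<le> CT" if "a \<in> S" for a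
    using wterm[OF _ meas[OF that] intp[OF that] le[OF that], of a] that S
    unfolding T_def[abs_def] y_def k2_def A_def extension_term_def[abs_def] by auto
  have ehol: "holomorphic_several (e a) (ball 0 1)" if "a \<in> S" for a
    unfolding e_def[abs_def] using that S by (intro holomorphic_several_mult holomorphic_several_const hol holomorphic_several_kernel) auto
  have ezero: "e a z = 0" if "a \<in> S" "z \<notin> ball 0 1" for a z
    using zero[OF that] by (simp add: e_def)
  have em: "e a \<in> borel_measurable borel" if "a \<in> S" for a
    using ehol[OF that] ezero[OF that] by (rule borel_measurable_ball_supported)
  have ediag: "e a a = of_real (\<beta> a)" if "a \<in> S" for a
  proof -
    have a1: "norm a < 1" using that S by auto
    have "1 - ip a a = of_real (A a)"
      by (simp add: ip_self A_def)
    then have "ip_kernel M a a = of_real (inverse (A a ^ M))"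
      using a1 by (simp add: ip_kernel_def)
    moreover have "inverse (A a ^ M) = A a powr (- real M)"
      using A[OF that] by (simp add: powr_minus powr_realpow)
    ultimately have k: "ip_kernel M a a = of_real (A a powr (- real M))"
      by (simp only:)
    have d: "\<rho> a a = of_real (A a powr (- (N / p)))"
      by (simp only: diag[OF that] A_def N_def)
    have "e a a = of_real (\<beta> a * (A a powr (N / p + real M) * (A a powr (- (N / p)) * A a powr (- real M))))"
      unfolding e_def k d by (simp only: of_real_mult mult.assoc)
    also have "A a powr (N / p + real M) * (A a powr (- (N / p)) * A a powr (- real M)) = 1"
      using A[OF that] by (simp add: powr_add[symmetric])
    finally show ?thesis by simp
  qed
  have eoff: "e a c = 0" if "a \<in> S" "c \<in> S" "a \<noteq> c" for a c
    by (simp add: e_def off[OF that])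
  have ele: "norm (e a z) \<le> C\<beta> * y a z" if a: "a \<in> S" and z: "norm z < 1" for a z
  proof -
    have a1: "norm a < 1" using a S by auto
    have x: "norm (1 - ip z a) > 0" using z a1 by (intro norm_one_minus_ip_pos) auto
    have "norm (ip_kernel M a z) = norm (1 - ip z a) powr (- real M)"
      using z x by (simp add: ip_kernel_def norm_inverse norm_power powr_minus powr_realpow)
    then have "norm (e a z) = (\<bar>\<beta> a\<bar> * A a powr (N / p + real M)) * (norm (\<rho> a z) * norm (1 - ip z a) powr (- real M))"
      by (simp add: e_def norm_mult abs_mult)
    also have "\<dots> \<le> (C\<beta> * A a powr (- (N / q)) * A a powr (N / p + real M)) * (norm (\<rho> a z) * norm (1 - ip z a) powr (- real M))"
      using \<beta>(2)[OF a] unfolding N_def A_def by (intro mult_right_mono) auto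
    also have "C\<beta> * A a powr (- (N / q)) * A a powr (N / p + real M) = C\<beta> * A a powr (real M - (N / q - N / p))"
      by (simp add: mult.assoc powr_add[symmetric] algebra_simps)
    finally show ?thesis by (simp add: y_def mult_ac)
  qed
  define K where "K = C\<beta> powr q * C2 powr (q - 1) * CT"
  have K: "K > 0" using \<beta> C2 CT by (simp add: K_def)
  have pointwise: "(\<Sum>a\<in>G. norm (l a * e a z)) powr q \<le> (\<Sum>a\<in>G. norm (l a) powr q * (C\<beta> powr q * C2 powr (q - 1)) * T a z)"
    if G: "finite G" "G \<subseteq> S" and z: "norm z < 1" for G z and l :: "complex ^ 'n \<Rightarrow> complex"
  proof -
    have B: "1 - (norm z)\<^sup>2 > 0" by (rule one_minus_norm_sq(1)[OF z])
    have k2: "k2 a z > 0" if "a \<in> S" for a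
    proof -
      have "norm (1 - ip z a) > 0" using z that S by (intro norm_one_minus_ip_pos) auto
      then show ?thesis using A[OF that] by (simp add: k2_def)
    qed
    have "(\<Sum>a\<in>G. norm (l a * e a z)) powr q \<le> (\<Sum>a\<in>G. norm (l a * e a z) powr q * k2 a z powr (- (q - 1))) * (\<Sum>a\<in>G. k2 a z) powr (q - 1)"
      by (rule weighted_power_sum[OF G(1) _ _ q(1)]) (use k2 G in auto)
    also have "\<dots> \<le> (\<Sum>a\<in>G. norm (l a * e a z) powr q * k2 a z powr (- (q - 1))) * (C2 * (1 - (norm z)\<^sup>2) powr (- \<epsilon>)) powr (q - 1)"
    proof (intro mult_left_mono powr_mono2)
      have "disjoint_family_on (pball \<delta>) G" using disj G by (auto simp: disjoint_family_on_def)
      then show "(\<Sum>a\<in>G. k2 a z) \<le> C2 * (1 - (norm z)\<^sup>2) powr (- \<epsilon>)"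
        unfolding k2_def A_def using G S z by (intro sumb) auto
      show "0 \<le> (\<Sum>a\<in>G. k2 a z)" using k2 G by (intro sum_nonneg) (auto intro: less_imp_le)
      show "0 \<le> (\<Sum>a\<in>G. norm (l a * e a z) powr q * k2 a z powr (- (q - 1)))" by (intro sum_nonneg) auto
    qed (use q in auto)
    also have "\<dots> = (\<Sum>a\<in>G. norm (l a * e a z) powr q * (k2 a z powr (- (q - 1)) * (C2 * (1 - (norm z)\<^sup>2) powr (- \<epsilon>)) powr (q - 1)))"
      by (simp only: sum_distrib_right mult.assoc)
    also have "\<dots> \<le> (\<Sum>a\<in>G. (norm (l a) powr q * (C\<beta> powr q * y a z powr q)) * (k2 a z powr (- (q - 1)) * (C2 * (1 - (norm z)\<^sup>2) powr (- \<epsilon>)) powr (q - 1)))"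
    proof (intro sum_mono mult_right_mono)
      fix a assume "a \<in> G"
      then have a: "a \<in> S" using G by auto
      have y0: "0 \<le> y a z" by (simp add: y_def)
      have "norm (l a * e a z) powr q \<le> (norm (l a) * (C\<beta> * y a z)) powr q"
        unfolding norm_mult using q by (intro powr_mono2 mult_left_mono ele a z) auto
      also have "\<dots> = norm (l a) powr q * (C\<beta> powr q * y a z powr q)"
        using y0 \<beta>(1) by (simp add: powr_mult)
      finally show "norm (l a * e a z) powr q \<le> norm (l a) powr q * (C\<beta> powr q * y a z powr q)" .
    qed auto
    also have "\<dots> = (\<Sum>a\<in>G. norm (l a) powr q * (C\<beta> powr q * C2 powr (q - 1)) * T a z)"
    proof (rule sum.cong[OF refl])
      fix a
      have "(C2 * (1 - (norm z)\<^sup>2) powr (- \<epsilon>)) powr (q - 1) = C2 powr (q - 1) * (1 - (norm z)\<^sup>2) powr (- \<epsilon> * (q - 1))"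
        using C2 by (simp add: powr_mult powr_powr)
      then show "(norm (l a) powr q * (C\<beta> powr q * y a z powr q)) * (k2 a z powr (- (q - 1)) * (C2 * (1 - (norm z)\<^sup>2) powr (- \<epsilon>)) powr (q - 1))
        = norm (l a) powr q * (C\<beta> powr q * C2 powr (q - 1)) * T a z"
        unfolding T_def by (simp only: mult_ac)
    qed
    finally show ?thesis .
  qed
  have bi: "integrable ?M (\<lambda>z. (\<Sum>a\<in>G. norm (l a * e a z)) powr q) \<and>
      (\<integral>z. (\<Sum>a\<in>G. norm (l a * e a z)) powr q \<partial>?M) \<le> K * (\<Sum>a\<in>G. norm (l a) powr q)"
    if G: "finite G" "G \<subseteq> S" for G and l :: "complex ^ 'n \<Rightarrow> complex"
  proof -
    let ?u = "\<lambda>z. (\<Sum>a\<in>G. norm (l a * e a z)) powr q"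
    let ?R = "\<lambda>z. \<Sum>a\<in>G. norm (l a) powr q * (C\<beta> powr q * C2 powr (q - 1)) * T a z"
    have iR: "integrable ?M ?R"
      using G iT by (intro Bochner_Integration.integrable_sum integrable_mult_right) auto
    have ae: "AE z in ?M. ?u z \<le> ?R z"
      using AE_W by eventually_elim (rule pointwise[OF G])
    have "(\<lambda>z. \<Sum>a\<in>G. norm (l a * e a z)) \<in> borel_measurable borel"
    proof (rule borel_measurable_sum)
      fix a assume "a \<in> G"
      then have [measurable]: "e a \<in> borel_measurable borel"
        using G em by auto
      show "(\<lambda>z. norm (l a * e a z)) \<in> borel_measurable borel"
        by measurable
    qed
    then have mu: "?u \<in> borel_measurable borel" by measurable
    have iu: "integrable ?M ?u"
    proof (rule Bochner_Integration.integrable_bound[OF iR])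
      show "AE z in ?M. norm (?u z) \<le> norm (?R z)"
        using ae by eventually_elim (use abs_ge_self in \<open>simp add: order_trans[OF _ abs_ge_self]\<close>)
    qed (use mu in \<open>simp add: measurable_cong_sets[OF sets_radial refl]\<close>)
    have "(\<integral>z. ?u z \<partial>?M) \<le> (\<integral>z. ?R z \<partial>?M)"
      by (rule integral_mono_AE[OF iu iR ae])
    also have "\<dots> = (\<Sum>a\<in>G. norm (l a) powr q * (C\<beta> powr q * C2 powr (q - 1)) * (\<integral>z. T a z \<partial>?M))"
      using G iT by (subst Bochner_Integration.integral_sum) auto
    also have "\<dots> \<le> (\<Sum>a\<in>G. norm (l a) powr q * (C\<beta> powr q * C2 powr (q - 1)) * CT)"
      using G bT by (intro sum_mono mult_left_mono) auto
    also have "\<dots> = K * (\<Sum>a\<in>G. norm (l a) powr q)"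
      by (simp add: K_def sum_distrib_left sum_distrib_right mult_ac)
    finally show ?thesis using iu by blast
  qed
  define E where "E l z = (\<Sum>\<^sub>\<infinity>a\<in>S. l a * e a z)" for l z
  note so = countS q(1) K ehol ezero bi[THEN conjunct1] bi[THEN conjunct2]
  have summ: "(\<lambda>a. l a * e a z) summable_on S" if "l \<in> lq_space (ennreal q) S" for l z
    by (rule abs_summable_summable) (rule series_operator_summable[OF so that])
  show ?thesis
  proof (rule that[of E])
    show "bounded_linear_operator_lq_bergman k (ennreal q) S E"
      unfolding bounded_linear_operator_lq_bergman_def
    proof (intro conjI ballI allI)
      show "E ` lq_space (ennreal q) S \<subseteq> bergman_space k (ennreal q)"
        unfolding E_def using series_operator_mem[OF so] by blast
      show "E (\<lambda>a. l a + m a) = (\<lambda>z. E l z + E m z)" if "l \<in> lq_space (ennreal q) S" "m \<in> lq_space (ennreal q) S" for l m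
        unfolding E_def by (simp add: distrib_right infsum_add[OF summ[OF that(1)] summ[OF that(2)]])
      show "E (\<lambda>a. c * l a) = (\<lambda>z. c * E l z)" for c l
        unfolding E_def by (simp add: mult.assoc infsum_cmult_right')
      show "\<exists>K. \<forall>l\<in>lq_space (ennreal q) S. bergman_norm k (ennreal q) (E l) \<le> K * lq_norm (ennreal q) S l"
        unfolding E_def using series_operator_norm[OF so] by blast
    qed
    show "E l c = l c * of_real (\<beta> c)" if "l \<in> lq_space (ennreal q) S" "c \<in> S" for l c
    proof -
      \<comment> \<open>At \<open>c\<close> all terms with \<open>a \<noteq> c\<close> vanish
        because \<rho>_a does.\<close>
      have "E l c = (\<Sum>\<^sub>\<infinity>a\<in>{c}. l a * e a c)"
        unfolding E_def by (rule infsum_cong_neutral) (use that in \<open>auto simp: eoff\<close>)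
      then show ?thesis using that by (simp add: ediag)
    qed
  qed
qed

section \<open>Normalisation of the given dual system and conclusion\<close>

lemma bergman_norm_kernel_nonneg:
  fixes a :: "complex ^ 'n"
  assumes "norm a < 1"
  shows "0 \<le> bergman_norm k p (bergman_kernel k a)"
proof (cases "p = \<infinity>")
  case True
  have "bdd_above ((\<lambda>z. norm (bergman_kernel k a z)) ` ball 0 1)"
    unfolding bergman_kernel_eq[OF assms] norm_mult
    by (rule bdd_aboveI2, rule mult_left_mono, rule norm_kernel_le[OF assms]) simp
  then have "norm (bergman_kernel k a 0) \<le> (SUP z\<in>ball 0 1. norm (bergman_kernel k a z))"
    by (intro cSUP_upper) auto
  then show ?thesis
    using True order_trans[OF norm_ge_zero] by (simp add: bergman_norm_def)
qed (simp add: bergman_norm_def)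

theorem theorem1p7:
  fixes S :: "(complex ^ 'n) set" and k :: nat and p q :: ennreal
  assumes "countable S" and "S \<subseteq> ball 0 1"
    and "1 \<le> p"
    and "dual_bounded k p S"
    and "1 \<le> q" and "q < p"
  shows "interpolating k q S \<and> linear_extension_property k q S"
proof -
  obtain q' where q': "q = ennreal q'" "1 \<le> q'"
  proof (cases q)
    case (real r)
    then show ?thesis using \<open>1 \<le> q\<close> that[of r] by simp
  next
    case top
    then show ?thesis using \<open>q < p\<close> by simp
  qed
  define N where "N = real (CARD('n) + 1 + k)"
  have N: "N > 0" by (simp add: N_def)
  define \<beta> where "\<beta> a = bergman_norm k (conj_exponent q) (bergman_kernel k a)" for a :: "complex ^ 'n"
  obtain C\<beta> where C\<beta>: "C\<beta> > 0" "\<And>a :: complex ^ 'n. norm a < 1 \<Longrightarrow> \<beta> a \<le> C\<beta> * (1 - (norm a)\<^sup>2) powr (- (N / q'))"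
    unfolding \<beta>_def q'(1) N_def using bergman_kernel_norm_upper[OF q'(2), where 'n = 'n and k = k] by blast
  have \<beta>: "\<bar>\<beta> a\<bar> \<le> C\<beta> * (1 - (norm a)\<^sup>2) powr (- (real (CARD('n) + 1 + k) / q'))" if "a \<in> S" for a
    using C\<beta>(2)[of a] bergman_norm_kernel_nonneg[of a k "conj_exponent q"] that assms(2)
    by (auto simp: \<beta>_def N_def simp del: of_nat_add)
  define \<tau> where "\<tau> a = bergman_norm k (conj_exponent p) (bergman_kernel k a)" for a :: "complex ^ 'n"
  obtain C \<rho> where C: "C > 0" and \<rho>: "\<And>a. a \<in> S \<Longrightarrow> \<rho> a \<in> bergman_space k p"
    "\<And>a. a \<in> S \<Longrightarrow> bergman_norm k p (\<rho> a) \<le> C"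
    "\<And>a c. a \<in> S \<Longrightarrow> c \<in> S \<Longrightarrow> \<rho> a c = (if a = c then of_real (\<tau> a) else 0)"
    using assms(4) unfolding dual_bounded_def \<tau>_def by metis
  have hol: "holomorphic_several (\<rho> a) (ball 0 1)" and zero: "\<And>z. z \<notin> ball 0 1 \<Longrightarrow> \<rho> a z = 0" if "a \<in> S" for a
    using \<rho>(1)[OF that] by (auto simp: bergman_space_def)
  have meas: "\<rho> a \<in> borel_measurable borel" if "a \<in> S" for a
    using \<rho>(1)[OF that] by (rule bergman_space_measurable)
  have a1: "norm a < 1" if "a \<in> S" for a using that assms(2) by auto
  have "\<exists>E. bounded_linear_operator_lq_bergman k (ennreal q') S E \<and>
    (\<forall>l\<in>lq_space (ennreal q') S. \<forall>c\<in>S. E l c = l c * of_real (\<beta> c))"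
  proof (cases p)
    case (real p')
    have pe: "p = ennreal p'" using real by simp
    have qp: "q' < p'" using \<open>q < p\<close> q' real by (simp add: ennreal_less_iff)
    then have p': "1 < p'" using q' by simp
    obtain c where c: "c > 0" "\<And>a :: complex ^ 'n. norm a < 1 \<Longrightarrow> c * (1 - (norm a)\<^sup>2) powr (- (N / p')) \<le> \<tau> a"
      unfolding \<tau>_def pe N_def using bergman_kernel_norm_lower[OF p', where 'n = 'n and k = k] by blast
    \<comment> \<open>Rescaling replaces the diagonal value, a kernel norm, by the exact power that
      it approximates. The lower norm estimate bounds the factor, so the system stays
      bounded.\<close>
    define s where "s a = (1 - (norm a)\<^sup>2) powr (- (N / p')) / \<tau> a" for a
    have \<tau>0: "\<tau> a > 0" if "a \<in> S" for a
    proof -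
      have "0 < c * (1 - (norm a)\<^sup>2) powr (- (N / p'))"
        using c one_minus_norm_sq(1)[OF a1[OF that]] by simp
      then show ?thesis using c(2)[OF a1[OF that]] by linarith
    qed
    have s: "0 \<le> s a" "s a \<le> 1 / c" if "a \<in> S" for a
    proof -
      show "0 \<le> s a" using \<tau>0[OF that] by (simp add: s_def)
      show "s a \<le> 1 / c"
        using c(2)[OF a1[OF that]] \<tau>0[OF that] c(1) by (simp add: s_def field_simps)
    qed
    define \<sigma> where "\<sigma> a z = of_real (s a) * \<rho> a z" for a z
    define F where "F = (1 / c) powr p' * (C powr p' / ball_const k)"
    have F: "F > 0" using c C ball_const_pos[of k] by (simp add: F_def)
    have ip: "integrable (W (real k)) (\<lambda>z. norm (\<rho> a z) powr p')" if "a \<in> S" for a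
      using \<rho>(1)[OF that] p' unfolding pe by (subst (asm) bergman_space_real) auto
    have bp: "(\<integral>z. norm (\<rho> a z) powr p' \<partial>W (real k)) \<le> C powr p' / ball_const k" if "a \<in> S" for a
    proof -
      let ?J = "ball_const k * (\<integral>z. norm (\<rho> a z) powr p' \<partial>W (real k))"
      have J: "?J \<ge> 0" using ball_const_pos[of k] by (intro mult_nonneg_nonneg integral_nonneg_AE) auto
      have "?J powr (1 / p') \<le> C"
        using \<rho>(2)[OF that] p' unfolding pe by (subst (asm) bergman_norm_real) (auto intro: meas that)
      then have "(?J powr (1 / p')) powr p' \<le> C powr p'"
        using p' by (intro powr_mono2) auto
      then have "?J \<le> C powr p'"
        using J p' by (simp add: powr_powr)
      then show ?thesis
        using ball_const_pos[of k] by (simp add: field_simps)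
    qed
    have n\<sigma>: "norm (\<sigma> a z) powr p' = s a powr p' * norm (\<rho> a z) powr p'" if "a \<in> S" for a z
      using s[OF that] by (simp add: \<sigma>_def norm_mult powr_mult)
    obtain E where "bounded_linear_operator_lq_bergman k (ennreal q') S E"
      "\<And>l c. l \<in> lq_space (ennreal q') S \<Longrightarrow> c \<in> S \<Longrightarrow> E l c = l c * of_real (\<beta> c)"
    proof (rule dual_system_extension[where \<rho> = \<sigma> and \<beta> = \<beta> and S = S and q = q' and p = p' and k = k and F = F and C\<beta> = C\<beta>])
      show "holomorphic_several (\<sigma> a) (ball 0 1)" if "a \<in> S" for a
        unfolding \<sigma>_def[abs_def] by (intro holomorphic_several_mult holomorphic_several_const hol that)
      show "\<sigma> a z = 0" if "a \<in> S" "z \<notin> ball 0 1" for a z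
        using zero[OF that] by (simp add: \<sigma>_def)
      show "integrable (W (real k)) (\<lambda>z. norm (\<sigma> a z) powr p')" if "a \<in> S" for a
        unfolding n\<sigma>[OF that] by (intro integrable_mult_right ip that)
      show "(\<integral>z. norm (\<sigma> a z) powr p' \<partial>W (real k)) \<le> F" if "a \<in> S" for a
      proof -
        have "(\<integral>z. norm (\<sigma> a z) powr p' \<partial>W (real k)) = s a powr p' * (\<integral>z. norm (\<rho> a z) powr p' \<partial>W (real k))"
          unfolding n\<sigma>[OF that] by (rule integral_mult_right_zero)
        also have "\<dots> \<le> F"
          unfolding F_def using s[OF that] p' by (intro mult_mono powr_mono2 bp that integral_nonneg_AE) auto
        finally show ?thesis .
      qed
      show "\<sigma> a a = of_real ((1 - (norm a)\<^sup>2) powr (- (real (CARD('n) + 1 + k) / p')))" if "a \<in> S" for a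
        using \<tau>0[OF that] by (simp add: \<sigma>_def s_def \<rho>(3)[OF that that] N_def)
      show "\<sigma> a c = 0" if "a \<in> S" "c \<in> S" "a \<noteq> c" for a c
        using that by (simp add: \<sigma>_def \<rho>(3))
    qed (use assms(1,2) q' qp F C\<beta>(1) \<beta> in auto)
    then show ?thesis by blast
  next
    case top
    \<comment> \<open>A finite exponent above \<open>q'\<close>, in which bounded functions times
      kernels normalised in A^p' form the new dual system.\<close>
    define p' where "p' = q' + 1"
    have p': "1 < p'" "q' < p'" using q' by (auto simp: p'_def)
    obtain c where c: "c > 0" "\<And>a :: complex ^ 'n. norm a < 1 \<Longrightarrow> c \<le> \<tau> a"
      unfolding \<tau>_def using bergman_kernel_norm_lower_1[where 'n = 'n and k = k] top by auto
    have \<rho>C: "norm (\<rho> a z) \<le> C" if "a \<in> S" for a z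
    proof (cases "z \<in> ball 0 1")
      case True
      have "bounded (\<rho> a ` ball 0 1)"
        using \<rho>(1)[OF that] top by (simp add: bergman_space_def)
      then have "bdd_above ((\<lambda>z. norm (\<rho> a z)) ` ball 0 1)"
        unfolding bounded_iff bdd_above_def by auto
      then have "norm (\<rho> a z) \<le> (SUP z\<in>ball 0 1. norm (\<rho> a z))"
        using True by (intro cSUP_upper)
      then show ?thesis
        using \<rho>(2)[OF that] top by (simp add: bergman_norm_def)
    qed (use zero[OF that] C in simp)
    \<comment> \<open>M p' > N puts the p'-th power of the kernel in the Forelli-Rudin
      range.\<close>
    obtain M :: nat where M: "N / p' < real M"
      using reals_Archimedean2 by blast
    define x where "x = real M * p' - N"
    have x: "x > 0" using M p' by (simp add: x_def field_simps)
    have yx: "real CARD('n) + 1 + real k + x = real M * p'"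
      by (simp add: x_def N_def)
    obtain G where G: "G > 0" "\<And>w :: complex ^ 'n. norm w < 1 \<Longrightarrow>
      (\<integral>z. norm (1 - ip z w) powr (- (real M * p')) \<partial>W (real k)) \<le> G * (1 - (norm w)\<^sup>2) powr (- x)"
      using Forelli_Rudin_upper[of "real k" x, where 'n = 'n] x unfolding yx by auto
    define A where "A a = 1 - (norm a)\<^sup>2" for a :: "complex ^ 'n"
    have A: "A a > 0" if "a \<in> S" for a
      unfolding A_def by (rule one_minus_norm_sq(1)[OF a1[OF that]])
    \<comment> \<open>The quotient by \<tau> removes the diagonal value of \<rho>_a, and the power
      of A cancels the kernel's A^(-M) at \<open>a\<close> down to A^(-N/p'). The same power
      normalises the kernel in A^p', which gives the bound \<open>F\<close>.\<close>
    define s where "s a = A a powr (real M - N / p') / \<tau> a" for a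
    have \<tau>0: "\<tau> a > 0" if "a \<in> S" for a
      using c(1) c(2)[OF a1[OF that]] by linarith
    define \<sigma> where "\<sigma> a z = of_real (s a) * (\<rho> a z * ip_kernel M a z)" for a z
    define F where "F = (C / c) powr p' * G"
    have F: "F > 0" using c C G by (simp add: F_def)
    define B where "B a z = (C / c) powr p' * (A a powr x * norm (1 - ip z a) powr (- (real M * p')))" for a z
    have \<sigma>B: "norm (\<sigma> a z) powr p' \<le> B a z" if a: "a \<in> S" and z: "norm z < 1" for a z
    proof -
      have xz: "norm (1 - ip z a) > 0" using z a1[OF a] by (intro norm_one_minus_ip_pos) auto
      have kz: "norm (ip_kernel M a z) = norm (1 - ip z a) powr (- real M)"
        using z xz by (simp add: ip_kernel_def norm_inverse norm_power powr_minus powr_realpow)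
      have "norm (\<sigma> a z) = A a powr (real M - N / p') * norm (1 - ip z a) powr (- real M) * (norm (\<rho> a z) / \<tau> a)"
        using \<tau>0[OF a] by (simp add: \<sigma>_def s_def norm_mult norm_divide kz)
      also have "\<dots> \<le> A a powr (real M - N / p') * norm (1 - ip z a) powr (- real M) * (C / c)"
        using \<rho>C[OF a] c(1) c(2)[OF a1[OF a]] C by (intro mult_left_mono frac_le) auto
      finally have "norm (\<sigma> a z) powr p' \<le> (A a powr (real M - N / p') * norm (1 - ip z a) powr (- real M) * (C / c)) powr p'"
        using p' by (intro powr_mono2) auto
      also have "\<dots> = (C / c) powr p' * (A a powr ((real M - N / p') * p') * norm (1 - ip z a) powr (- real M * p'))"
      proof -
        have "(b powr \<alpha> * d powr \<gamma> * t) powr r = t powr r * (b powr (\<alpha> * r) * d powr (\<gamma> * r))" for b d t \<alpha> \<gamma> r :: real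
          by (simp add: powr_mult powr_powr mult_ac)
        then show ?thesis .
      qed
      also have "(real M - N / p') * p' = x"
        using p' by (simp add: x_def left_diff_distrib)
      finally show ?thesis by (simp add: B_def)
    qed
    have iB: "integrable (W (real k)) (B a)" if "a \<in> S" for a
      unfolding B_def[abs_def] using a1[OF that] p' by (intro integrable_mult_right integrable_ip_powr) auto
    have bB: "(\<integral>z. B a z \<partial>W (real k)) \<le> F" if "a \<in> S" for a
    proof -
      have "(\<integral>z. B a z \<partial>W (real k)) = (C / c) powr p' * (A a powr x * (\<integral>z. norm (1 - ip z a) powr (- (real M * p')) \<partial>W (real k)))"
        unfolding B_def by (simp only: integral_mult_right_zero)
      also have "\<dots> \<le> (C / c) powr p' * (A a powr x * (G * A a powr (- x)))"
        unfolding A_def by (intro mult_left_mono G a1 that) auto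
      also have "\<dots> = F"
        using A[OF that] by (simp add: F_def powr_minus)
      finally show ?thesis .
    qed
    have h\<sigma>: "holomorphic_several (\<sigma> a) (ball 0 1)" if "a \<in> S" for a
      unfolding \<sigma>_def[abs_def] by (intro holomorphic_several_mult holomorphic_several_const holomorphic_several_kernel hol a1 that)
    have z\<sigma>: "\<sigma> a z = 0" if "a \<in> S" "z \<notin> ball 0 1" for a z
      using zero[OF that] by (simp add: \<sigma>_def)
    have i\<sigma>: "integrable (W (real k)) (\<lambda>z. norm (\<sigma> a z) powr p')" if a: "a \<in> S" for a
    proof (rule Bochner_Integration.integrable_bound[OF iB[OF a]])
      have [measurable]: "\<sigma> a \<in> borel_measurable borel"
        using h\<sigma>[OF a] z\<sigma>[OF a] by (rule borel_measurable_ball_supported)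
      show "(\<lambda>z. norm (\<sigma> a z) powr p') \<in> borel_measurable (W (real k))"
        by (simp add: measurable_cong_sets[OF sets_radial refl])
      show "AE z in W (real k). norm (norm (\<sigma> a z) powr p') \<le> norm (B a z)"
        using AE_W
      proof eventually_elim
        case (elim z)
        show ?case using order_trans[OF \<sigma>B[OF a elim] abs_ge_self] by simp
      qed
    qed
    obtain E where "bounded_linear_operator_lq_bergman k (ennreal q') S E"
      "\<And>l c. l \<in> lq_space (ennreal q') S \<Longrightarrow> c \<in> S \<Longrightarrow> E l c = l c * of_real (\<beta> c)"
    proof (rule dual_system_extension[where \<rho> = \<sigma> and \<beta> = \<beta> and S = S and q = q' and p = p' and k = k and F = F and C\<beta> = C\<beta>])
      show "(\<integral>z. norm (\<sigma> a z) powr p' \<partial>W (real k)) \<le> F" if a: "a \<in> S" for a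
      proof (rule order_trans[OF integral_mono_AE[OF i\<sigma>[OF a] iB[OF a]] bB[OF a]])
        show "AE z in W (real k). norm (\<sigma> a z) powr p' \<le> B a z"
          using AE_W by eventually_elim (rule \<sigma>B[OF a])
      qed
      show "\<sigma> a a = of_real ((1 - (norm a)\<^sup>2) powr (- (real (CARD('n) + 1 + k) / p')))" if a: "a \<in> S" for a
      proof -
        have "1 - ip a a = of_real (A a)"
          by (simp add: ip_self A_def)
        then have "ip_kernel M a a = of_real (inverse (A a ^ M))"
          using a1[OF a] by (simp add: ip_kernel_def)
        moreover have "inverse (A a ^ M) = A a powr (- real M)"
          using A[OF a] by (simp add: powr_minus powr_realpow)
        ultimately have k: "ip_kernel M a a = of_real (A a powr (- real M))"
          by (simp only:)
        have "\<sigma> a a = of_real (A a powr (real M - N / p') * A a powr (- real M))"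
          unfolding \<sigma>_def s_def k using \<tau>0[OF a] by (simp add: \<rho>(3)[OF a a])
        also have "A a powr (real M - N / p') * A a powr (- real M) = A a powr (- (N / p'))"
          by (simp add: powr_add[symmetric])
        finally show ?thesis by (simp add: A_def N_def)
      qed
      show "\<sigma> a c = 0" if "a \<in> S" "c \<in> S" "a \<noteq> c" for a c
        using that by (simp add: \<sigma>_def \<rho>(3))
    qed (use assms(1,2) q' p' F C\<beta>(1) \<beta> h\<sigma> z\<sigma> i\<sigma> in auto)
    then show ?thesis by blast
  qed
  then obtain E where E: "bounded_linear_operator_lq_bergman k q S E" "\<forall>l\<in>lq_space q S. interpolates k q S l (E l)"
    unfolding q'(1)[symmetric] interpolates_def \<beta>_def by blast
  then have "interpolating k q S"
    unfolding interpolating_def bounded_linear_operator_lq_bergman_def by blast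
  then show ?thesis
    using E unfolding linear_extension_property_def by blast
qed

end
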